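(* Let $\mathcal{P}$ be a homogeneous Poisson process of intensity $1$ on $\mathbb{R}$, let $\mu$ be a degree distribution (a probability measure on the strictly positive integers), and consider the stable multi-matching. Let $N$ be the number of points of $[\mathcal{P}]$ that desire the origin. (i) For any degree distribution $\mu$, if (almost surely) there is no infinite component, then $N=\infty$ almost surely. (ii) If $\mu(\{1,2\})=1$ and (almost surely) there is an infinite component, then $N<\infty$ almost surely.
   Context: Setting. Write $[\mathcal{P}]=\{x\in\mathbb{R}:\mathcal{P}(\{x\})>0\}$ for the point-set of $\mathcal{P}$. Conditionally on $\mathcal{P}$, the points $x\in[\mathcal{P}]$ carry i.i.d. marks $D_x$ with law $\mu$ ($D_x$ is the number of stubs, i.e. half-edges, at $x$); the resulting marked point process is denoted $(\mathcal{P},\xi)$ with $\xi(\{x\})=D_x$. Matching scheme. A matching scheme for $(\mathcal{P},\xi)$ is a point process $\mathcal{M}$ on the space of unordered pairs of points of $\mathbb{R}$ such that almost surely every pair $(x,y)\in[\mathcal{M}]$ has $x,y\in[\mathcal{P}]$, and in the graph $G$ with vertex set $[\mathcal{P}]$ and edge set $[\mathcal{M}]$ each vertex $x$ has degree exactly $D_x$. All matching schemes are assumed simple (almost surely $G$ has no self-loops and no multiple edges) and translation-invariant ($\mathcal{M}$ is invariant in law under all translations of $\mathbb{R}$). "Component" means connected component of $G$; it is infinite if it has infinitely many vertices. The length of an edge $(x,y)$ is $|x-y|$. Stable multi-matching. A matching scheme is a stable multi-matching if a.s., for any two distinct $x,y\in[\mathcal{P}]$, either they are linked by an edge or at least one of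 them has no incident edge longer than $|x-y|$. It is known that for a Poisson process an a.s. unique stable multi-matching exists. By ergodicity, the event that there exists an infinite component has probability $0$ or $1$ for any $\mu$. Desire. For $x\in[\mathcal{P}]$, $M_x$ is the length of the longest edge incident to $x$; $x$ desires a site $y\in\mathbb{R}$ if $|y-x|<M_x$. *)

theory Defs
  imports "HOL-Probability.Probability"
begin

section \<open>Point processes\<close>

definition locally_finite_counting :: "'a::metric_space measure \<Rightarrow> 'a measure \<Rightarrow> bool" where
  "locally_finite_counting K m \<longleftrightarrow>
     sets m = sets K \<and>
     (\<forall>A\<in>sets K. bounded A \<longrightarrow> (\<exists>n::nat. emeasure m A = of_nat n))"

text \<open>The measurable space of locally finite counting measures on the space \<open>K\<close>, with the
  \<open>\<sigma>\<close>-algebra generated by the evaluations \<open>m \<mapsto> m A\<close> (compare \<^const>\<open>subprob_algebra\<close>).\<close>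

definition counting_algebra :: "'a::metric_space measure \<Rightarrow> 'a measure measure" where
  "counting_algebra K =
     (SUP A\<in>sets K. vimage_algebra {m. locally_finite_counting K m} (\<lambda>m. emeasure m A) borel)"

definition point_process ::
    "'w measure \<Rightarrow> 'a::metric_space measure \<Rightarrow> ('w \<Rightarrow> 'a measure) \<Rightarrow> bool" where
  "point_process W K N \<longleftrightarrow> N \<in> measurable W (counting_algebra K)"

definition point_set :: "'a measure \<Rightarrow> 'a set" where
  "point_set m = {x. emeasure m {x} > 0}"

text \<open>The Poisson probabilities are written out, because \<^const>\<open>poisson_pmf\<close> requires a positive
  rate and the set \<open>B\<close> may be a null set.\<close>

definition poisson_process :: "'w measure \<Rightarrow> real \<Rightarrow> ('w \<Rightarrow> real measure) \<Rightarrow> bool" where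
  "poisson_process W r P \<longleftrightarrow>
     point_process W borel P \<and>
     (\<forall>B\<in>sets borel. bounded B \<longrightarrow>
        (\<forall>k::nat. measure W {\<omega>\<in>space W. emeasure (P \<omega>) B = of_nat k} =
           (r * measure lborel B) ^ k / fact k * exp (- (r * measure lborel B)))) \<and>
     (\<forall>B::nat \<Rightarrow> real set. (\<forall>i. B i \<in> sets borel \<and> bounded (B i)) \<and> disjoint_family B \<longrightarrow>
        prob_space.indep_vars W (\<lambda>_. borel) (\<lambda>i \<omega>. emeasure (P \<omega>) (B i)) UNIV)"

text \<open>The marks of a process \<open>P\<close> with almost surely infinitely many points: conditionally on \<open>P\<close>,
  the marks \<open>\<xi>({x})\<close>, \<open>x \<in> [P]\<close>, are i.i.d. with law \<open>\<mu>\<close>. To express this, the points are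
  enumerated by random variables \<open>X 0, X 1, \<dots>\<close> that are functions of \<open>P\<close>, i.e. measurable with
  respect to \<open>\<sigma>(P)\<close>; the marks read in this order are i.i.d. and independent of \<open>P\<close>. The
  resulting joint law of \<open>P\<close> and \<open>\<xi>\<close> does not depend on the enumeration.\<close>

definition iid_marking ::
    "'w measure \<Rightarrow> nat pmf \<Rightarrow> ('w \<Rightarrow> real measure) \<Rightarrow> ('w \<Rightarrow> real measure) \<Rightarrow> bool" where
  "iid_marking W \<mu> P \<xi> \<longleftrightarrow>
     point_process W borel P \<and> point_process W borel \<xi> \<and>
     (AE \<omega> in W. point_set (\<xi> \<omega>) \<subseteq> point_set (P \<omega>)) \<and>
     (\<exists>X::nat \<Rightarrow> 'w \<Rightarrow> real.
        (\<forall>n. X n \<in> borel_measurable (vimage_algebra (space W) P (counting_algebra borel))) \<and>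
        (AE \<omega> in W. bij_betw (\<lambda>n. X n \<omega>) UNIV (point_set (P \<omega>))) \<and>
        prob_space.indep_vars W (\<lambda>_. borel) (\<lambda>n \<omega>. emeasure (\<xi> \<omega>) {X n \<omega>}) UNIV \<and>
        (\<forall>n. distr W borel (\<lambda>\<omega>. emeasure (\<xi> \<omega>) {X n \<omega>}) =
             distr (measure_pmf \<mu>) borel of_nat) \<and>
        prob_space.indep_set W
          (sets (vimage_algebra (space W) P (counting_algebra borel)))
          (sets (vimage_algebra (space W) (\<lambda>\<omega> n. emeasure (\<xi> \<omega>) {X n \<omega>})
                   (Pi\<^sub>M UNIV (\<lambda>_. borel)))))"

section \<open>Matching schemes\<close>

text \<open>The unordered pair of \<open>x\<close> and \<open>y\<close> is represented by \<open>(min x y, max x y)\<close>, so that the space of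
  unordered pairs of points of the real line is a closed half-plane.\<close>

definition upairs :: "(real \<times> real) set" where
  "upairs = {(x, y). x \<le> y}"

abbreviation upair_borel :: "(real \<times> real) measure" where
  "upair_borel \<equiv> restrict_space borel upairs"

definition translate_pairs :: "real \<Rightarrow> (real \<times> real) measure \<Rightarrow> (real \<times> real) measure" where
  "translate_pairs t E = distr E upair_borel (\<lambda>(x, y). (x + t, y + t))"

definition linked :: "(real \<times> real) measure \<Rightarrow> real \<Rightarrow> real \<Rightarrow> bool" where
  "linked E x y \<longleftrightarrow> (min x y, max x y) \<in> point_set E"

text \<open>A self-loop contributes 2 to the degree.\<close>

definition degree_at :: "(real \<times> real) measure \<Rightarrow> real \<Rightarrow> ennreal" where
  "degree_at E x = emeasure E {p\<in>upairs. fst p = x \<or> snd p = x} + emeasure E {(x, x)}"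

definition simple_edges :: "(real \<times> real) measure \<Rightarrow> bool" where
  "simple_edges E \<longleftrightarrow> (\<forall>x. emeasure E {(x, x)} = 0) \<and> (\<forall>p. emeasure E {p} \<le> 1)"

definition matching_scheme ::
    "'w measure \<Rightarrow> ('w \<Rightarrow> real measure) \<Rightarrow> ('w \<Rightarrow> real measure) \<Rightarrow>
     ('w \<Rightarrow> (real \<times> real) measure) \<Rightarrow> bool" where
  "matching_scheme W P \<xi> E \<longleftrightarrow>
     point_process W upair_borel E \<and>
     (AE \<omega> in W. \<forall>(x, y)\<in>point_set (E \<omega>). x \<in> point_set (P \<omega>) \<and> y \<in> point_set (P \<omega>)) \<and>
     (AE \<omega> in W. \<forall>x\<in>point_set (P \<omega>). degree_at (E \<omega>) x = emeasure (\<xi> \<omega>) {x}) \<and>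
     (AE \<omega> in W. simple_edges (E \<omega>)) \<and>
     (\<forall>t. distr W (counting_algebra upair_borel) (\<lambda>\<omega>. translate_pairs t (E \<omega>)) =
          distr W (counting_algebra upair_borel) E)"

definition stable_multi_matching ::
    "'w measure \<Rightarrow> ('w \<Rightarrow> real measure) \<Rightarrow> ('w \<Rightarrow> real measure) \<Rightarrow>
     ('w \<Rightarrow> (real \<times> real) measure) \<Rightarrow> bool" where
  "stable_multi_matching W P \<xi> E \<longleftrightarrow>
     matching_scheme W P \<xi> E \<and>
     (AE \<omega> in W. \<forall>x\<in>point_set (P \<omega>). \<forall>y\<in>point_set (P \<omega>). x \<noteq> y \<longrightarrow>
        linked (E \<omega>) x y \<or>
        (\<forall>z. linked (E \<omega>) x z \<longrightarrow> \<bar>x - z\<bar> \<le> \<bar>x - y\<bar>) \<or>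
        (\<forall>z. linked (E \<omega>) y z \<longrightarrow> \<bar>y - z\<bar> \<le> \<bar>x - y\<bar>))"

section \<open>Components and desire\<close>

definition component :: "(real \<times> real) measure \<Rightarrow> real \<Rightarrow> real set" where
  "component E x = {y. (linked E)\<^sup>*\<^sup>* x y}"

definition has_infinite_component :: "real measure \<Rightarrow> (real \<times> real) measure \<Rightarrow> bool" where
  "has_infinite_component m E \<longleftrightarrow> (\<exists>x\<in>point_set m. infinite (component E x))"

definition longest_edge :: "(real \<times> real) measure \<Rightarrow> real \<Rightarrow> real" where
  "longest_edge E x = Max {\<bar>x - z\<bar> |z. linked E x z}"

definition desires :: "(real \<times> real) measure \<Rightarrow> real \<Rightarrow> real \<Rightarrow> bool" where
  "desires E x y \<longleftrightarrow> \<bar>y - x\<bar> < longest_edge E x"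

definition desiring_points :: "real measure \<Rightarrow> (real \<times> real) measure \<Rightarrow> real \<Rightarrow> real set" where
  "desiring_points m E y = {x\<in>point_set m. desires E x y}"

end

theory Submission
  imports Defs
begin

text \<open>
  The first claim is proved by deleting and inserting points. Suppose that all components are finite, but
  that only finitely many points desire a site \<open>u\<close>. Delete the components of these points. The remaining
  edges still form a stable matching, and now nobody desires \<open>u\<close>. Insert a point with \<open>k\<close> stubs at \<open>u\<close>:
  keeping the edges and leaving the new point unmatched is again stable. Stable matchings are unique, so
  the new configuration has no stable matching in which all stubs are used. But deleting finitely many
  points and inserting one at a typical site leads to a law that is absolutely continuous with respect to
  that of the marked Poisson process, for which such a matching almost surely exists. Hence infinitely many
  points desire almost every \<open>u\<close>, and by translation invariance infinitely many desire the origin.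

  The edge process \<open>E\<close> is not assumed to be a function of the marked points, whereas absolute continuity
  speaks about the marked points only. The contradiction is therefore expressed through \<open>unfilled\<close>, a
  measurable property of positions and marks which says that at every scale \<open>r\<close> there is a finite window,
  separated by gaps longer than \<open>r\<close>, whose stable matching with edges of length at most \<open>r\<close> leaves the
  first point with a free stub. It fails for the given process (\<open>not_unfilled\<close>) and holds after the
  modification (\<open>unfilled_insert\<close>). Absolute continuity is \<open>AE_not_unfilled_insert\<close>; it rests on the law of
  a single point in a region (\<open>AE_resample\<close>) and on the fact that the marks are i.i.d. in any order
  determined by the points (\<open>AE_marks_iff\<close>). Uniqueness needs that no point is the midpoint of two others
  (\<open>AE_no_ties\<close>).

  For the second claim all degrees are at most \<open>2\<close>. By mass transport no infinite component has an end
  (\<open>AE_no_infinite_leaf\<close>), so the infinite components are two-sided paths. Stability and a parity argument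
  then show that at most two points of infinite components lie below any edge (\<open>C_enclosed_subset\<close>,
  \<open>card_C_enclosed\<close>). Consequently only finitely many edges cross the origin, and a point \<open>x\<close> far away that
  desires the origin has an edge across the whole interval between \<open>x\<close> and \<open>2 * x\<close>. By stationarity,
  however, the points of infinite components are too dense for this: for all large \<open>t\<close> there are three of
  them between \<open>t\<close> and \<open>2 * t\<close> on either side (\<open>AE_three_points\<close>). This contradiction is \<open>finite_desire\<close>.
\<close>

section \<open>Stable graphs on the line\<close>

lemma card_le_one_iff_unique: "finite A \<Longrightarrow> card A \<le> 1 \<longleftrightarrow> (\<forall>x\<in>A. \<forall>y\<in>A. x = y)"
  by (metis One_nat_def card_le_Suc0_iff_eq)

lemma even_card_symmetric:
  fixes A :: "('a::linorder \<times> 'a) set"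
  assumes "finite A" and sym: "\<And>x y. (x, y) \<in> A \<Longrightarrow> (y, x) \<in> A" and irrefl: "\<And>x. (x, x) \<notin> A"
  shows "even (card A)"
proof -
  let ?U = "{p\<in>A. fst p < snd p}" and ?D = "{p\<in>A. snd p < fst p}"
  have "A = ?U \<union> ?D" using irrefl by (auto simp: neq_iff) (metis linorder_neqE)
  moreover have "?U \<inter> ?D = {}" by auto
  ultimately have "card A = card ?U + card ?D"
    using \<open>finite A\<close> by (metis (no_types, lifting) card_Un_disjoint finite_Un)
  moreover have "card ?U = card ?D"
    by (rule bij_betw_same_card[of prod.swap], rule bij_betw_byWitness[of _ prod.swap]) (auto intro: sym)
  ultimately show ?thesis by simp
qed

text \<open>One realization of a stable multi-matching: \<open>V\<close> is the locally finite point set, \<open>D\<close> the marks, and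
  \<open>L\<close> the edge relation.\<close>

locale stable_graph =
  fixes V :: "real set" and D :: "real \<Rightarrow> nat" and L :: "real \<Rightarrow> real \<Rightarrow> bool"
  assumes L_sym: "L x y \<Longrightarrow> L y x"
    and L_irrefl: "\<not> L x x"
    and L_vertex: "L x y \<Longrightarrow> x \<in> V"
    and finite_nbrs: "x \<in> V \<Longrightarrow> finite {y. L x y}"
    and card_nbrs: "x \<in> V \<Longrightarrow> card {y. L x y} = D x"
    and D_pos: "x \<in> V \<Longrightarrow> 1 \<le> D x"
    and finite_window: "finite (V \<inter> {a..b})"
    and stable: "x \<in> V \<Longrightarrow> y \<in> V \<Longrightarrow> x \<noteq> y \<Longrightarrow>
      L x y \<or> (\<forall>z. L x z \<longrightarrow> \<bar>x - z\<bar> \<le> \<bar>x - y\<bar>) \<or> (\<forall>z. L y z \<longrightarrow> \<bar>y - z\<bar> \<le> \<bar>x - y\<bar>)"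
begin

definition comp :: "real \<Rightarrow> real set" where
  "comp x = {y. L\<^sup>*\<^sup>* x y}"

lemma L_vertex2: "L x y \<Longrightarrow> y \<in> V"
  using L_sym L_vertex by blast

lemma star_sym: "L\<^sup>*\<^sup>* x y \<Longrightarrow> L\<^sup>*\<^sup>* y x"
  by (metis L_sym symp_def symp_rtranclp)

lemma comp_eq: "L\<^sup>*\<^sup>* x y \<Longrightarrow> comp x = comp y"
  unfolding comp_def using star_sym by (auto intro: rtranclp_trans)

lemma comp_subset_closed:
  assumes "x \<in> A" "\<And>y z. y \<in> A \<Longrightarrow> L y z \<Longrightarrow> z \<in> A"
  shows "comp x \<subseteq> A"
proof
  fix y assume "y \<in> comp x"
  then have "L\<^sup>*\<^sup>* x y" by (simp add: comp_def)
  then show "y \<in> A" by (induction rule: rtranclp_induct) (use assms in auto)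
qed

lemma comp_subset_V: "x \<in> V \<Longrightarrow> comp x \<subseteq> V"
  by (rule comp_subset_closed) (auto intro: L_vertex2)

lemma longest_edge_attained:
  assumes "x \<in> V"
  obtains z where "L x z" "Max {\<bar>x - z\<bar> |z. L x z} = \<bar>x - z\<bar>" "\<And>w. L x w \<Longrightarrow> \<bar>x - w\<bar> \<le> \<bar>x - z\<bar>"
proof -
  have eq: "{\<bar>x - z\<bar> |z. L x z} = (\<lambda>z. \<bar>x - z\<bar>) ` {z. L x z}" by auto
  have ne: "{z. L x z} \<noteq> {}"
    using D_pos[OF assms] card_nbrs[OF assms] by (metis card.empty not_one_le_zero)
  have fin: "finite ((\<lambda>z. \<bar>x - z\<bar>) ` {z. L x z})" using finite_nbrs[OF assms] by simp
  have "Max ((\<lambda>z. \<bar>x - z\<bar>) ` {z. L x z}) \<in> (\<lambda>z. \<bar>x - z\<bar>) ` {z. L x z}"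
    using fin ne by (intro Max_in) auto
  then obtain z where z: "L x z" "Max ((\<lambda>z. \<bar>x - z\<bar>) ` {z. L x z}) = \<bar>x - z\<bar>" by auto
  moreover have "\<bar>x - w\<bar> \<le> \<bar>x - z\<bar>" if "L x w" for w
    unfolding z(2)[symmetric] using fin that by (intro Max_ge) auto
  ultimately show thesis using that unfolding eq by blast
qed

lemma less_longest_edge_iff:
  "x \<in> V \<Longrightarrow> r < Max {\<bar>x - z\<bar> |z. L x z} \<longleftrightarrow> (\<exists>z. L x z \<and> r < \<bar>x - z\<bar>)"
  by (rule longest_edge_attained[of x]) (auto intro: less_le_trans)

end

section \<open>Long edges and infinite paths\<close>

text \<open>All degrees are at most \<open>2\<close>, and \<open>C\<close> collects the points in infinite components. Since these have
  degree exactly \<open>2\<close>, every infinite component is a path without an end.\<close>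

locale path_graph = stable_graph +
  fixes C
  defines "C \<equiv> {x\<in>V. infinite (comp x)}"
  assumes D_le_2: "x \<in> V \<Longrightarrow> D x \<le> 2"
    and D_C: "x \<in> C \<Longrightarrow> D x = 2"
begin

lemma C_step: "x \<in> C \<Longrightarrow> L x y \<Longrightarrow> y \<in> C"
  unfolding C_def using comp_eq[OF r_into_rtranclp, of x y] L_vertex2 by auto

text \<open>Points of \<open>C\<close> below an edge are rare. A point \<open>z\<close> strictly between \<open>a\<close> and \<open>b\<close> that is not linked to
  \<open>a\<close> has no edge longer than its distance to \<open>a\<close>, because \<open>a\<close> does have the longer edge to \<open>b\<close>; the same
  holds for \<open>b\<close>. So unless \<open>z\<close> is linked to \<open>a\<close> or \<open>b\<close>, all its edges stay inside the interval. Let \<open>R\<close>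
  consist of \<open>a\<close>, \<open>b\<close> and their neighbours, and \<open>F\<close> of the remaining points of \<open>C\<close> in between. Then edges
  leave the finite set \<open>F\<close> only towards \<open>R\<close>. Each point of \<open>F\<close> has degree \<open>2\<close>, so counting the edge ends
  at \<open>F\<close> shows that the number of edges from \<open>F\<close> to \<open>R\<close> is even; only the at most two points of \<open>R\<close>
  different from \<open>a\<close> and \<open>b\<close> can have an edge to \<open>F\<close>, and at most one each. If there is no such edge, then
  \<open>F\<close> is closed under \<open>L\<close>; if there are two, then \<open>F \<union> R\<close> is. Either way a point of \<open>F\<close> would lie in a
  finite component.\<close>

lemma C_enclosed_subset:
  assumes ab: "L a b" "a < b"
  shows "C \<inter> {a<..<b} \<subseteq> {y. L a y} \<union> {y. L b y}"
proof (rule ccontr)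
  assume no: "\<not> ?thesis"
  define R where "R = {a, b} \<union> {y. L a y} \<union> {y. L b y}"
  define R' where "R' = R - {a, b}"
  define F where "F = C \<inter> {a<..<b} - R"
  have aV: "a \<in> V" and bV: "b \<in> V" using ab L_vertex L_vertex2 by auto
  have finR: "finite R" unfolding R_def using finite_nbrs aV bV by auto
  have finF: "finite F"
    by (rule finite_subset[OF _ finite_window[of a b]]) (auto simp: F_def C_def)
  have Fne: "F \<noteq> {}" using no by (auto simp: F_def R_def)
  have F_C: "F \<subseteq> C" by (auto simp: F_def)
  have F_closed: "y \<in> F \<union> R'" if f: "f \<in> F" and L: "L f y" for f y
  proof -
    have fin: "a < f" "f < b" "f \<in> V" "\<not> L a f" "\<not> L b f" "f \<in> C"
      using f by (auto simp: F_def C_def R_def)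
    have "L a b \<and> \<bar>a - b\<bar> > \<bar>f - a\<bar>" "L b a \<and> \<bar>b - a\<bar> > \<bar>f - b\<bar>"
      using ab fin L_sym by auto
    then have "\<bar>f - y\<bar> \<le> \<bar>f - a\<bar>" "\<bar>f - y\<bar> \<le> \<bar>f - b\<bar>"
      using stable[OF fin(3) aV] stable[OF fin(3) bV] fin L L_sym by (metis less_irrefl not_le)+
    then have "a \<le> y" "y \<le> b" using fin by auto
    moreover have "y \<noteq> a" "y \<noteq> b" using L L_sym fin by blast+
    moreover have "y \<in> C" using C_step fin L by blast
    ultimately show ?thesis by (auto simp: F_def R'_def)
  qed
  \<comment> \<open>The edge ends at \<open>F\<close>: \<open>Oe\<close> collects those of edges inside \<open>F\<close>, and \<open>X\<close> those of edges to \<open>R\<close>.\<close>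
  define N where "N = {(f, y). f \<in> F \<and> L f y}"
  define Oe where "Oe = {(f, g). f \<in> F \<and> g \<in> F \<and> L f g}"
  define X where "X = {(f, r). f \<in> F \<and> r \<in> R' \<and> L f r}"
  have FR: "F \<inter> R' = {}" by (auto simp: F_def R'_def)
  have "N = (SIGMA f:F. {y. L f y})" by (auto simp: N_def)
  then have "card N = (\<Sum>f\<in>F. card {y. L f y})"
    using finF F_C finite_nbrs by (simp add: C_def subset_eq)
  also have "\<dots> = (\<Sum>f\<in>F. 2)"
    using F_C D_C card_nbrs by (intro sum.cong) (auto simp: C_def)
  finally have cardN: "card N = 2 * card F" by simp
  have finOe: "finite Oe" by (rule finite_subset[of _ "F \<times> F"]) (auto simp: Oe_def finF)
  have finX: "finite X" by (rule finite_subset[of _ "F \<times> R"]) (auto simp: X_def R'_def finF finR)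
  have "N = Oe \<union> X" "Oe \<inter> X = {}"
    using F_closed FR by (auto simp: N_def Oe_def X_def)
  then have "card N = card Oe + card X" using finOe finX card_Un_disjoint by blast
  moreover have "even (card Oe)"
    by (rule even_card_symmetric) (use finOe L_sym L_irrefl in \<open>auto simp: Oe_def\<close>)
  ultimately have evenX: "even (card X)" using cardN by presburger
  have other: "card {y. L x y \<and> y \<noteq> z} \<le> 1" if "L x z" for x z
  proof -
    have x: "x \<in> V" using that L_vertex by auto
    have "{y. L x y \<and> y \<noteq> z} = {y. L x y} - {z}" by auto
    then have "card {y. L x y \<and> y \<noteq> z} = D x - 1" using that finite_nbrs card_nbrs x by simp
    then show ?thesis using D_le_2[OF x] by simp
  qed
  have uniq: "y = y'" if "L x z" "L x y" "L x y'" "y \<noteq> z" "y' \<noteq> z" for x y y' z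
    using other[OF that(1)] that finite_nbrs[OF L_vertex[OF that(1)]]
    by (subst (asm) card_le_one_iff_unique) auto
  have R'_sub: "R' = {y. L a y \<and> y \<noteq> b} \<union> {y. L b y \<and> y \<noteq> a}"
    using L_irrefl ab L_sym by (auto simp: R'_def R_def)
  have cardR': "card R' \<le> 2"
    using card_Un_le[of "{y. L a y \<and> y \<noteq> b}" "{y. L b y \<and> y \<noteq> a}"] other[OF ab(1)] other[OF L_sym[OF ab(1)]]
    unfolding R'_sub by linarith
  have anchor: "\<exists>z\<in>{a, b}. L r z" if "r \<in> R'" for r using that L_sym by (auto simp: R'_sub)
  have aR: "a \<notin> F" "b \<notin> F" by (auto simp: F_def)
  have inj: "inj_on snd X"
  proof (rule inj_onI)
    fix p q assume "p \<in> X" "q \<in> X" "snd p = snd q"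
    moreover obtain f r where p: "p = (f, r)" by (cases p)
    moreover obtain f' r' where q: "q = (f', r')" by (cases q)
    ultimately have *: "f \<in> F" "f' \<in> F" "r \<in> R'" "L r f" "L r f'" "r' = r"
      by (auto simp: X_def L_sym)
    moreover obtain z where "z \<in> {a, b}" "L r z" using anchor * by blast
    ultimately show "p = q" using uniq[of r z f f'] aR p q by auto
  qed
  have sub: "snd ` X \<subseteq> R'" by (auto simp: X_def)
  have finR': "finite R'" using finR by (simp add: R'_def)
  have "card X \<le> 2"
    using card_inj_on_le[OF inj sub finR'] cardR' by simp
  with evenX have "card X = 0 \<or> card X = 2" by (auto elim!: evenE)
  obtain f where f: "f \<in> F" using Fne by auto
  have inf: "infinite (comp f)" using f F_C by (auto simp: C_def)
  show False
    using \<open>card X = 0 \<or> card X = 2\<close>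
  proof
    assume "card X = 0"
    then have "X = {}" using finX by simp
    then have "z \<in> F" if "y \<in> F" "L y z" for y z using F_closed[OF that] that by (auto simp: X_def)
    then have "comp f \<subseteq> F" using comp_subset_closed f by blast
    then show False using inf finF finite_subset by blast
  next
    assume "card X = 2"
    then have "card (snd ` X) = 2" using inj by (simp add: card_image)
    then have "snd ` X = R'" using card_mono[OF finR' sub] cardR' sub finR'
      by (intro card_subset_eq) auto
    have "z \<in> F \<union> R" if y: "y \<in> F \<union> R" and L: "L y z" for y z
    proof -
      consider "y \<in> F" | "y \<in> {a, b}" | "y \<in> R'" using y by (auto simp: R'_def)
      then show ?thesis
      proof cases
        case 1 then show ?thesis using F_closed L by (auto simp: R'_def)
      next
        case 2 then show ?thesis using L by (auto simp: R_def)
      next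
        case 3
        then have "y \<in> snd ` X" using \<open>snd ` X = R'\<close> by simp
        then obtain g where g: "g \<in> F" "L y g" by (auto simp: X_def L_sym)
        obtain w where w: "w \<in> {a, b}" "L y w" using anchor 3 by blast
        show ?thesis
        proof (cases "z = w")
          case True then show ?thesis using w by (auto simp: R_def)
        next
          case False
          then show ?thesis using uniq[of y w z g] w g L aR by auto
        qed
      qed
    qed
    then have "comp f \<subseteq> F \<union> R" using comp_subset_closed[of f "F \<union> R"] f by blast
    then show False using inf finF finR finite_subset by blast
  qed
qed

lemma card_C_enclosed:
  assumes ab: "L a b" "a < b"
  shows "card (C \<inter> {a<..<b}) \<le> 2"
proof -
  have aV: "a \<in> V" and bV: "b \<in> V" using ab L_vertex L_vertex2 by auto
  have other: "finite ({y. L x y} - {z})" "card ({y. L x y} - {z}) \<le> 1" if "L x z" for x z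
  proof -
    have x: "x \<in> V" using that L_vertex by auto
    show "finite ({y. L x y} - {z})" using finite_nbrs[OF x] by simp
    show "card ({y. L x y} - {z}) \<le> 1" using that finite_nbrs card_nbrs[OF x] D_le_2[OF x] x by simp
  qed
  have "C \<inter> {a<..<b} \<subseteq> ({y. L a y} - {b}) \<union> ({y. L b y} - {a})"
    using C_enclosed_subset[OF ab] by auto
  then have "card (C \<inter> {a<..<b}) \<le> card (({y. L a y} - {b}) \<union> ({y. L b y} - {a}))"
    using other[OF ab(1)] other[OF L_sym[OF ab(1)]] by (intro card_mono) auto
  also have "\<dots> \<le> 2"
    using card_Un_le[of "{y. L a y} - {b}" "{y. L b y} - {a}"]
      other(2)[OF ab(1)] other(2)[OF L_sym[OF ab(1)]] by linarith
  finally show ?thesis .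
qed

text \<open>Infinitely many edges across the origin would include edges that enclose any given bounded set,
  because the point set is locally finite and the degrees are finite; but no edge encloses three points
  of \<open>C\<close>.\<close>

lemma finite_crossing_edges:
  assumes "C \<noteq> {}"
  shows "finite {(a, b). L a b \<and> a < 0 \<and> 0 < b}"
proof -
  obtain x where x: "x \<in> C" using assms by auto
  have "comp x \<subseteq> C" by (rule comp_subset_closed) (use x C_step in auto)
  then have "infinite C" using x finite_subset[of "comp x" C] by (auto simp: C_def)
  then obtain S where S: "S \<subseteq> C" "card S = 3" "finite S" by (meson infinite_arbitrarily_large)
  then have "bounded S" using finite_imp_bounded by blast
  then obtain K where K: "\<And>s. s \<in> S \<Longrightarrow> \<bar>s\<bar> \<le> K" unfolding bounded_iff by auto
  have "S \<noteq> {}" using S(2) by auto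
  then obtain s where "s \<in> S" by blast
  then have K0: "0 \<le> K" using K[of s] by linarith
  have far: "-K - 1 \<le> a \<or> b \<le> K + 1" if "L a b" "a < 0" "0 < b" for a b
  proof (rule ccontr)
    assume "\<not> ?thesis"
    then have "S \<subseteq> C \<inter> {a<..<b}" using S K by fastforce
    moreover have "finite (C \<inter> {a<..<b})"
      by (rule finite_subset[OF _ finite_window[of a b]]) (auto simp: C_def)
    ultimately have "card S \<le> card (C \<inter> {a<..<b})" by (intro card_mono)
    then have "3 \<le> card (C \<inter> {a<..<b})" using S by simp
    then show False using card_C_enclosed[of a b] that by simp
  qed
  define A where "A = V \<inter> {-K-1..K+1}"
  have A: "finite A" "A \<subseteq> V" using finite_window by (auto simp: A_def)
  have "{(a, b). L a b \<and> a < 0 \<and> 0 < b} \<subseteq> (SIGMA a:A. {b. L a b}) \<union> (\<lambda>(x, y). (y, x)) ` (SIGMA a:A. {b. L a b})"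
  proof safe
    fix a b assume *: "L a b" "a < 0" "0 < b" and "(a, b) \<notin> (\<lambda>(x, y). (y, x)) ` (SIGMA a:A. {b. L a b})"
    then have "b \<notin> A" using L_sym by force
    then have "\<not> b \<le> K + 1" using *(3) L_vertex2[OF *(1)] K0 by (auto simp: A_def)
    then have "-K - 1 \<le> a" using far[OF *] by simp
    then show "a \<in> A" using *(2) L_vertex[OF *(1)] K0 by (auto simp: A_def)
  qed
  moreover have "finite (SIGMA a:A. {b. L a b})" using A finite_nbrs by (intro finite_SigmaI) auto
  ultimately show ?thesis by (meson finite_UnI finite_imageI finite_subset)
qed


text \<open>The deterministic half of the second claim. A point \<open>x\<close> that desires the origin has an edge longer
  than \<open>\<bar>x\<bar>\<close>. Either this edge crosses the origin, which happens only finitely often, or it leads beyond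
  \<open>2 * x\<close> and then it encloses at most two points of \<open>C\<close>. The hypothesis \<open>dense\<close>, with \<open>s\<close> selecting the
  side, excludes the latter for large \<open>\<bar>x\<bar>\<close>.\<close>

lemma finite_desire:
  assumes "C \<noteq> {}"
    and dense: "\<And>s. s \<in> {1, -1} \<Longrightarrow> \<exists>t0>0. \<forall>t\<ge>t0. \<exists>S\<subseteq>C. card S = 3 \<and> (\<forall>c\<in>S. t < s * c \<and> s * c < 2 * t)"
  shows "finite {x\<in>V. \<exists>z. L x z \<and> \<bar>x\<bar> < \<bar>x - z\<bar>}"
proof -
  define Cr where "Cr = {(a, b). L a b \<and> a < 0 \<and> 0 < b}"
  have finCr: "finite Cr" unfolding Cr_def by (rule finite_crossing_edges) fact
  obtain t1 where t1: "t1 > 0" "\<And>t. t \<ge> t1 \<Longrightarrow> \<exists>S\<subseteq>C. card S = 3 \<and> (\<forall>c\<in>S. t < c \<and> c < 2 * t)"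
    using dense[of 1] by auto
  obtain t2 where t2: "t2 > 0" "\<And>t. t \<ge> t2 \<Longrightarrow> \<exists>S\<subseteq>C. card S = 3 \<and> (\<forall>c\<in>S. t < - c \<and> - c < 2 * t)"
    using dense[of "-1"] by auto
  define B where "B = V \<inter> {- t2..t1}"
  have no3: False if "L a b" "a < b" "S \<subseteq> C" "card S = 3" "\<And>c. c \<in> S \<Longrightarrow> a < c \<and> c < b" for a b S
  proof -
    have "finite (C \<inter> {a<..<b})"
      by (rule finite_subset[OF _ finite_window[of a b]]) (auto simp: C_def)
    then have "card S \<le> card (C \<inter> {a<..<b})" using that by (intro card_mono) auto
    then show False using card_C_enclosed[of a b] that by simp
  qed
  have "{x\<in>V. \<exists>z. L x z \<and> \<bar>x\<bar> < \<bar>x - z\<bar>} \<subseteq> B \<union> fst ` Cr \<union> snd ` Cr"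
  proof safe
    fix x z assume x: "x \<in> V" and L: "L x z" and less: "\<bar>x\<bar> < \<bar>x - z\<bar>"
      and "x \<notin> snd ` Cr" "x \<notin> fst ` Cr"
    then have nc: "(x, z) \<notin> Cr" "(z, x) \<notin> Cr" by force+
    have nc: "\<not> (x < 0 \<and> 0 < z)" "\<not> (z < 0 \<and> 0 < x)"
      using nc L L_sym by (auto simp: Cr_def)
    show "x \<in> B"
    proof (rule ccontr)
      assume "x \<notin> B"
      then consider "x > t1" | "x < - t2" using x by (auto simp: B_def)
      then show False
      proof cases
        case 1
        then have "2 * x < z" using less nc t1(1) by linarith
        moreover obtain S where "S \<subseteq> C" "card S = 3" "\<forall>c\<in>S. x < c \<and> c < 2 * x" using t1(2)[of x] 1 by auto
        ultimately show False using no3[of x z S] L 1 t1(1) by force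
      next
        case 2
        then have "z < 2 * x" using less nc t2(1) by linarith
        moreover obtain S where "S \<subseteq> C" "card S = 3" "\<forall>c\<in>S. - x < - c \<and> - c < 2 * (- x)" using t2(2)[of "- x"] 2 by auto
        ultimately show False using no3[of z x S] L_sym[OF L] 2 t2(1) by force
      qed
    qed
  qed
  moreover have "finite (B \<union> fst ` Cr \<union> snd ` Cr)" using finCr finite_window by (simp add: B_def)
  ultimately show ?thesis by (rule finite_subset)
qed

end

section \<open>Truncated stable matchings of finite windows\<close>

text \<open>These definitions replace the infinite matching by an event that depends measurably on the
  positions \<open>y\<close> and the marks \<open>d\<close> only. If no other point is within distance \<open>r\<close> of the points with index in
  a finite set \<open>I\<close>, then the edges of length at most \<open>r\<close> inside \<open>I\<close> form a stable matching in which stubs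
  may remain free, and this matching can be studied on \<open>I\<close> alone.\<close>

definition far_isolated :: "real \<Rightarrow> (nat \<Rightarrow> real) \<Rightarrow> nat set \<Rightarrow> bool" where
  "far_isolated r y I \<longleftrightarrow> (\<forall>i\<in>I. \<forall>n. n \<in> I \<or> r < \<bar>y i - y n\<bar>)"

definition sated :: "(nat \<Rightarrow> real) \<Rightarrow> (nat \<Rightarrow> nat) \<Rightarrow> (nat \<times> nat) set \<Rightarrow> nat \<Rightarrow> nat \<Rightarrow> bool" where
  "sated y d M i j \<longleftrightarrow> card (M `` {i}) = d i \<and> (\<forall>l\<in>M `` {i}. \<bar>y i - y l\<bar> \<le> \<bar>y i - y j\<bar>)"

definition truncated_stable ::
    "real \<Rightarrow> (nat \<Rightarrow> real) \<Rightarrow> (nat \<Rightarrow> nat) \<Rightarrow> nat set \<Rightarrow> (nat \<times> nat) set \<Rightarrow> bool" where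
  "truncated_stable r y d I M \<longleftrightarrow>
     M \<subseteq> I \<times> I \<and> sym M \<and> irrefl M \<and>
     (\<forall>p\<in>M. \<bar>y (fst p) - y (snd p)\<bar> \<le> r) \<and>
     (\<forall>i\<in>I. card (M `` {i}) \<le> d i) \<and>
     (\<forall>i\<in>I. \<forall>j\<in>I. i \<noteq> j \<and> \<bar>y i - y j\<bar> \<le> r \<longrightarrow> (i, j) \<in> M \<or> sated y d M i j \<or> sated y d M j i)"

text \<open>For every \<open>r\<close>, the stable matching with edges of length at most \<open>r\<close> leaves the point with index \<open>0\<close> with
  a free stub. All quantifiers range over countable sets, which makes this a measurable condition.\<close>

definition unfilled :: "(nat \<Rightarrow> real) \<Rightarrow> (nat \<Rightarrow> nat) \<Rightarrow> bool" where
  "unfilled y d \<longleftrightarrow> (\<forall>r::nat. \<exists>I\<in>Collect finite. \<exists>M\<in>Collect finite.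
     0 \<in> I \<and> far_isolated (real r) y I \<and> truncated_stable (real r) y d I M \<and> card (M `` {0}) < d 0)"

text \<open>Consider a shortest edge in the symmetric difference of two stable matchings. In the matching that
  misses it, one end is full with edges that are strictly shorter, since there are no ties. These edges
  belong to both matchings, so in the other matching this end would have one edge too many.\<close>

lemma truncated_stable_unique:
  assumes "finite I" and M: "truncated_stable r y d I M" and M': "truncated_stable r y d I M'"
    and no_ties: "\<And>i j l. i \<in> I \<Longrightarrow> j \<in> I \<Longrightarrow> l \<in> I \<Longrightarrow> j \<noteq> i \<Longrightarrow> l \<noteq> i \<Longrightarrow> \<bar>y i - y j\<bar> = \<bar>y i - y l\<bar> \<Longrightarrow> j = l"
  shows "M = M'"
proof (rule ccontr)
  assume "M \<noteq> M'"
  define S where "S = (M \<union> M') - (M \<inter> M')"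
  define len where "len p = \<bar>y (fst p) - y (snd p)\<bar>" for p
  have "finite S" "S \<noteq> {}"
    using M M' \<open>M \<noteq> M'\<close> \<open>finite I\<close> finite_subset[of S "I \<times> I"] by (auto simp: S_def truncated_stable_def)
  then obtain p where p: "p \<in> S" "\<And>q. q \<in> S \<Longrightarrow> len p \<le> len q"
    using ex_min_if_finite[of "len ` S"] by (metis finite_imageI image_iff image_is_empty not_le)
  obtain i j where ij: "p = (i, j)" by (cases p)
  have overfull: False
    if A: "truncated_stable r y d I A" and B: "truncated_stable r y d I B"
      and ij: "(i, j) \<in> A" "(i, j) \<notin> B" and c: "sated y d B i j"
      and shorter: "\<And>l. \<bar>y i - y l\<bar> < \<bar>y i - y j\<bar> \<Longrightarrow> (i, l) \<in> A \<longleftrightarrow> (i, l) \<in> B" for A B i j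
  proof -
    have AI: "A \<subseteq> I \<times> I" "B \<subseteq> I \<times> I" "irrefl A" "irrefl B" using A B by (auto simp: truncated_stable_def)
    have "(i, l) \<in> A" if l: "(i, l) \<in> B" for l
    proof -
      have "\<bar>y i - y l\<bar> \<le> \<bar>y i - y j\<bar>" using c l by (auto simp: sated_def)
      moreover have "\<bar>y i - y l\<bar> \<noteq> \<bar>y i - y j\<bar>"
        using no_ties[of i l j] l ij AI by (auto simp: irrefl_def)
      ultimately show ?thesis using shorter l by force
    qed
    then have "insert j (B `` {i}) \<subseteq> A `` {i}" using ij by auto
    moreover have "finite (A `` {i})" using AI \<open>finite I\<close> by (auto intro!: finite_subset[of "A `` {i}" I])
    ultimately have "card (insert j (B `` {i})) \<le> card (A `` {i})" by (intro card_mono)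
    moreover have "card (insert j (B `` {i})) = Suc (d i)"
      using c ij AI \<open>finite I\<close> by (subst card_insert_disjoint) (auto simp: sated_def intro!: finite_subset[of "B `` {i}" I])
    moreover have "card (A `` {i}) \<le> d i" using A AI ij by (auto simp: truncated_stable_def)
    ultimately show False by simp
  qed
  have no: False
    if A: "truncated_stable r y d I A" and B: "truncated_stable r y d I B"
      and ij: "(i, j) \<in> A" "(i, j) \<notin> B"
      and shorter: "\<And>q. len q < len (i, j) \<Longrightarrow> q \<in> A \<longleftrightarrow> q \<in> B" for A B
  proof -
    have "i \<in> I" "j \<in> I" "i \<noteq> j" "\<bar>y i - y j\<bar> \<le> r"
      using A ij by (auto simp: truncated_stable_def irrefl_def)
    then consider "sated y d B i j" | "sated y d B j i" using B ij(2) unfolding truncated_stable_def by metis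
    then show False
    proof cases
      case 1
      then show False using overfull[OF A B ij] shorter by (auto simp: len_def)
    next
      case 2
      have "(j, i) \<in> A" "(j, i) \<notin> B" using A B ij by (auto simp: truncated_stable_def sym_def)
      then show False using overfull[OF A B _ _ 2] shorter by (auto simp: len_def abs_minus_commute)
    qed
  qed
  have eq: "q \<in> M \<longleftrightarrow> q \<in> M'" if "len q < len (i, j)" for q
    using p(2)[of q] that ij by (auto simp: S_def)
  show False using no[OF M M'] no[OF M' M] eq p(1) ij by (auto simp: S_def)
qed

text \<open>If a point is content in the whole graph because of edges of length at most \<open>r\<close>, then by isolation
  these edges stay inside \<open>I\<close>, so truncation keeps them all. The graph may leave stubs free, which is
  needed for a configuration with an unmatched point.\<close>

lemma truncation_of_stable:
  assumes "finite I" and iso: "far_isolated r y I"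
    and G_sym: "\<And>i j. G i j \<Longrightarrow> G j i" and G_irrefl: "\<And>i. \<not> G i i"
    and fin: "\<And>i. finite {l. G i l}" and card: "\<And>i. card {l. G i l} \<le> d i"
    and stable: "\<And>i j. i \<noteq> j \<Longrightarrow> G i j \<or>
      card {l. G i l} = d i \<and> (\<forall>l. G i l \<longrightarrow> \<bar>y i - y l\<bar> \<le> \<bar>y i - y j\<bar>) \<or>
      card {l. G j l} = d j \<and> (\<forall>l. G j l \<longrightarrow> \<bar>y j - y l\<bar> \<le> \<bar>y j - y i\<bar>)"
  defines "M \<equiv> {(i, j). i \<in> I \<and> j \<in> I \<and> G i j \<and> \<bar>y i - y j\<bar> \<le> r}"
  shows "truncated_stable r y d I M"
proof -
  have nb: "M `` {i} = {l. G i l}" if "i \<in> I" "\<And>l. G i l \<Longrightarrow> \<bar>y i - y l\<bar> \<le> r" for i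
    using that iso by (auto simp: M_def far_isolated_def) (meson not_le)
  have sub: "M `` {i} \<subseteq> {l. G i l}" for i by (auto simp: M_def)
  have "card (M `` {i}) \<le> d i" for i using card_mono[OF fin sub] card le_trans by blast
  moreover have "(i, j) \<in> M \<or> sated y d M i j \<or> sated y d M j i"
    if "i \<in> I" "j \<in> I" "i \<noteq> j" "\<bar>y i - y j\<bar> \<le> r" for i j
  proof -
    have *: "sated y d M i j"
      if "i \<in> I" "\<bar>y i - y j\<bar> \<le> r" "card {l. G i l} = d i" "\<forall>l. G i l \<longrightarrow> \<bar>y i - y l\<bar> \<le> \<bar>y i - y j\<bar>" for i j
      unfolding sated_def using nb[of i] that by force
    show ?thesis using stable[OF that(3)] *[of i j] *[of j i] that by (auto simp: M_def abs_minus_commute)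
  qed
  moreover have "M \<subseteq> I \<times> I" "sym M" "irrefl M" "\<forall>p\<in>M. \<bar>y (fst p) - y (snd p)\<bar> \<le> r"
    by (auto simp: M_def sym_def irrefl_def G_sym G_irrefl abs_minus_commute)
  ultimately show ?thesis unfolding truncated_stable_def by blast
qed

context stable_graph
begin

lemma card_nbrs_reindex:
  assumes "bij_betw y UNIV W" "{z. L (y i) z} \<subseteq> W"
  shows "card {l. L (y i) (y l)} = card {z. L (y i) z}" "finite {z. L (y i) z} \<Longrightarrow> finite {l. L (y i) (y l)}"
proof -
  have eq: "{z. L (y i) z} = y ` {l. L (y i) (y l)}"
    using assms by (auto simp: bij_betw_def)
  have inj: "inj_on y A" for A using assms(1) by (auto simp: bij_betw_def inj_on_def)
  show "card {l. L (y i) (y l)} = card {z. L (y i) z}" unfolding eq by (simp add: card_image inj)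
  show "finite {z. L (y i) z} \<Longrightarrow> finite {l. L (y i) (y l)}" unfolding eq using finite_imageD inj by blast
qed

text \<open>Take \<open>r\<close> at least the length of the longest edge at \<open>y 0\<close>. By uniqueness, the matching offered by
  \<open>unfilled\<close> is the truncation of \<open>L\<close>, which contains all edges at \<open>y 0\<close>.\<close>

lemma not_unfilled:
  assumes bij: "bij_betw y UNIV V"
    and no_ties: "\<And>x w z. x \<in> V \<Longrightarrow> w \<in> V \<Longrightarrow> z \<in> V \<Longrightarrow> w \<noteq> x \<Longrightarrow> z \<noteq> x \<Longrightarrow> \<bar>x - w\<bar> = \<bar>x - z\<bar> \<Longrightarrow> w = z"
  shows "\<not> unfilled y (\<lambda>n. D (y n))"
proof
  assume un: "unfilled y (\<lambda>n. D (y n))"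
  have V: "y n \<in> V" for n using bij by (auto simp: bij_betw_def)
  have inj: "y i = y j \<longleftrightarrow> i = j" for i j using bij by (auto simp: bij_betw_def inj_eq)
  have nsub: "{z. L (y i) z} \<subseteq> V" for i using L_vertex2 by auto
  have card: "card {l. L (y i) (y l)} = D (y i)" "finite {l. L (y i) (y l)}" for i
    using card_nbrs_reindex[OF bij nsub] card_nbrs[OF V] finite_nbrs[OF V] by auto
  obtain z where z: "\<And>w. L (y 0) w \<Longrightarrow> \<bar>y 0 - w\<bar> \<le> \<bar>y 0 - z\<bar>"
    using longest_edge_attained[OF V] by metis
  obtain r :: nat where r: "\<bar>y 0 - z\<bar> \<le> real r" using real_arch_simple by blast
  obtain I M where I: "finite I" "0 \<in> I" "far_isolated r y I"
    and M: "truncated_stable r y (\<lambda>n. D (y n)) I M" "card (M `` {0}) < D (y 0)"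
    using un unfolding unfilled_def by blast
  define M' where "M' = {(i, j). i \<in> I \<and> j \<in> I \<and> L (y i) (y j) \<and> \<bar>y i - y j\<bar> \<le> real r}"
  have "truncated_stable r y (\<lambda>n. D (y n)) I M'"
    unfolding M'_def
  proof (rule truncation_of_stable)
    fix i j :: nat assume "i \<noteq> j"
    then show "L (y i) (y j) \<or>
      card {l. L (y i) (y l)} = D (y i) \<and> (\<forall>l. L (y i) (y l) \<longrightarrow> \<bar>y i - y l\<bar> \<le> \<bar>y i - y j\<bar>) \<or>
      card {l. L (y j) (y l)} = D (y j) \<and> (\<forall>l. L (y j) (y l) \<longrightarrow> \<bar>y j - y l\<bar> \<le> \<bar>y j - y i\<bar>)"
      using stable[OF V V, of i j] inj card by (auto simp: abs_minus_commute[of "y j" "y i"])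
  qed (use I card L_sym L_irrefl in auto)
  then have "M = M'"
    using truncated_stable_unique[OF I(1) M(1)] no_ties V inj by metis
  moreover have "M' `` {0} = {l. L (y 0) (y l)}"
    using I z r by (auto simp: M'_def far_isolated_def) (meson not_le order_trans)+
  ultimately show False using M(2) card by simp
qed

text \<open>Delete a finite union \<open>A\<close> of components that contains every point desiring \<open>u\<close>, and insert a new
  point at \<open>u\<close> with index \<open>0\<close> and \<open>k\<close> stubs. The surviving edges form a matching that is stable although
  the new point has no edge at all. Gaps in \<open>V\<close> on both sides of \<open>u\<close> cut out a window that is isolated at
  scale \<open>r\<close>; asking for gaps of length \<open>r + 1\<close> makes the separation strict.\<close>

lemma unfilled_insert:
  assumes "u \<notin> V" and "finite A" and closed: "\<And>x y. x \<in> A \<Longrightarrow> L x y \<Longrightarrow> y \<in> A"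
    and undesired: "\<And>x z. x \<in> V - A \<Longrightarrow> L x z \<Longrightarrow> \<bar>x - z\<bar> \<le> \<bar>x - u\<bar>"
    and bij: "bij_betw Z UNIV (V - A)" and "1 \<le> k"
    and gaps: "\<And>s (r::nat) (K::nat). s \<in> {1, -1} \<Longrightarrow> \<exists>t. real K < s * t \<and> V \<inter> {t..t + real r} = {}"
  shows "unfilled (case_nat u Z) (case_nat k (\<lambda>n. D (Z n)))"
  unfolding unfilled_def
proof
  fix r :: nat
  let ?y = "case_nat u Z" and ?d = "case_nat k (\<lambda>n. D (Z n))"
  define G where "G i j \<longleftrightarrow> (case (i, j) of (Suc i, Suc j) \<Rightarrow> L (Z i) (Z j) | _ \<Rightarrow> False)" for i j
  have G_simps [simp]: "G 0 j = False" "G i 0 = False" "G (Suc m) (Suc n) = L (Z m) (Z n)" for i j m n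
    by (auto simp: G_def split: nat.splits)
  have V: "Z n \<in> V" "Z n \<notin> A" for n using bij by (auto simp: bij_betw_def)
  have inj: "Z i = Z j \<longleftrightarrow> i = j" for i j using bij by (auto simp: bij_betw_def inj_eq)
  have nsub: "{z. L (Z i) z} \<subseteq> V - A" for i using L_vertex2 closed L_sym V by blast
  have card: "card {l. L (Z i) (Z l)} = D (Z i)" "finite {l. L (Z i) (Z l)}" for i
    using card_nbrs_reindex[OF bij nsub] card_nbrs[OF V(1)] finite_nbrs[OF V(1)] by auto
  have full: "L (Z i) z \<Longrightarrow> \<exists>l. z = Z l" for i z using nsub[of i] bij by (auto simp: bij_betw_def)
  have nb: "{l. G (Suc i) l} = Suc ` {l. L (Z i) (Z l)}" for i
  proof (rule set_eqI)
    show "l \<in> {l. G (Suc i) l} \<longleftrightarrow> l \<in> Suc ` {l. L (Z i) (Z l)}" for l by (cases l) auto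
  qed
  have nb0: "{l. G 0 l} = {}" by simp
  obtain K :: nat where K: "\<bar>u\<bar> + real (Suc r) \<le> real K" using real_arch_simple by blast
  obtain t where "real K < 1 * t" "V \<inter> {t..t + real (Suc r)} = {}" using gaps[of 1 K "Suc r"] by auto
  then have t: "t > u" "V \<inter> {t..t + real (Suc r)} = {}" using K by auto
  obtain s where "real K < - 1 * s" "V \<inter> {s..s + real (Suc r)} = {}" using gaps[of "- 1" K "Suc r"] by auto
  then have s: "s < u - real (Suc r)" "V \<inter> {s..s + real (Suc r)} = {}" using K by auto
  define I where "I = insert 0 (Suc ` {n. Z n \<in> {s..t}})"
  have "finite (Z ` {n. Z n \<in> {s..t}})"
    by (rule finite_subset[OF _ finite_window[of s t]]) (use V in auto)
  then have finI: "finite I" unfolding I_def using inj by (auto dest!: finite_imageD simp: inj_on_def)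
  have posI: "s + Suc r \<le> ?y i \<and> ?y i \<le> t" if "i \<in> I" for i
  proof -
    have "s + Suc r \<le> Z n" if "Z n \<in> {s..t}" for n
      using s(2) V(1)[of n] that by (auto simp: disjoint_iff not_le)
    then show ?thesis using that s t by (auto simp: I_def)
  qed
  have pos_out: "?y n < s \<or> t + Suc r < ?y n" if nI: "n \<notin> I" for n
  proof -
    obtain m where n: "n = Suc m" using nI by (cases n) (auto simp: I_def)
    then have "Z m \<notin> {s..t}" using nI by (auto simp: I_def)
    note m = n this
    then show ?thesis using t(2) V(1)[of m] by (auto simp: disjoint_iff not_le)
  qed
  have iso: "far_isolated r ?y I"
    unfolding far_isolated_def
  proof (intro ballI allI)
    fix i n assume "i \<in> I"
    then show "n \<in> I \<or> real r < \<bar>?y i - ?y n\<bar>" using posI[of i] pos_out[of n] by fastforce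
  qed
  define M where "M = {(i, j). i \<in> I \<and> j \<in> I \<and> G i j \<and> \<bar>?y i - ?y j\<bar> \<le> real r}"
  have "truncated_stable r ?y ?d I M"
    unfolding M_def
  proof (rule truncation_of_stable[OF finI iso])
    show "G i j \<Longrightarrow> G j i" for i j using L_sym by (auto simp: G_def split: nat.splits)
    show "\<not> G i i" for i using L_irrefl by (auto simp: G_def split: nat.splits)
    show "finite {l. G i l}" for i by (cases i) (auto simp: nb card)
    show "card {l. G i l} \<le> ?d i" for i by (cases i) (auto simp: nb card card_image)
    have sat: "card {l. G (Suc i) l} = ?d (Suc i)" for i by (auto simp: nb card card_image)
    have u: "\<forall>l. G (Suc i) l \<longrightarrow> \<bar>?y (Suc i) - ?y l\<bar> \<le> \<bar>?y (Suc i) - ?y 0\<bar>" for i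
      using undesired V by (auto simp: G_def split: nat.splits)
    fix i j :: nat assume "i \<noteq> j"
    show "G i j \<or>
      card {l. G i l} = ?d i \<and> (\<forall>l. G i l \<longrightarrow> \<bar>?y i - ?y l\<bar> \<le> \<bar>?y i - ?y j\<bar>) \<or>
      card {l. G j l} = ?d j \<and> (\<forall>l. G j l \<longrightarrow> \<bar>?y j - ?y l\<bar> \<le> \<bar>?y j - ?y i\<bar>)"
    proof (cases i)
      case 0
      then obtain m where "j = Suc m" using \<open>i \<noteq> j\<close> by (cases j) auto
      then show ?thesis using sat[of m] u[of m] 0 by blast
    next
      case (Suc m)
      note i = this
      show ?thesis
      proof (cases j)
        case 0
        then show ?thesis using sat[of m] u[of m] i by blast
      next
        case (Suc n)
        have "Z m \<noteq> Z n" using i Suc \<open>i \<noteq> j\<close> inj by auto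
        from stable[OF V(1) V(1) this]
        consider "L (Z m) (Z n)" | "\<forall>z. L (Z m) z \<longrightarrow> \<bar>Z m - z\<bar> \<le> \<bar>Z m - Z n\<bar>"
          | "\<forall>z. L (Z n) z \<longrightarrow> \<bar>Z n - z\<bar> \<le> \<bar>Z n - Z m\<bar>" by (auto simp: abs_minus_commute)
        then show ?thesis
        proof cases
          case 1 then show ?thesis using i Suc by simp
        next
          case 2
          then have "\<forall>l. G i l \<longrightarrow> \<bar>?y i - ?y l\<bar> \<le> \<bar>?y i - ?y j\<bar>"
            using i Suc by (auto simp: G_def split: nat.splits)
          then show ?thesis using sat[of m] i by blast
        next
          case 3
          then have "\<forall>l. G j l \<longrightarrow> \<bar>?y j - ?y l\<bar> \<le> \<bar>?y j - ?y i\<bar>"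
            using i Suc by (auto simp: G_def split: nat.splits)
          then show ?thesis using sat[of n] Suc by blast
        qed
      qed
    qed
  qed
  moreover have "M `` {0} = {}" by (auto simp: M_def)
  moreover have "finite M" by (rule finite_subset[of _ "I \<times> I"]) (auto simp: M_def finI)
  ultimately show "\<exists>I\<in>Collect finite. \<exists>M\<in>Collect finite.
     0 \<in> I \<and> far_isolated (real r) ?y I \<and> truncated_stable (real r) ?y ?d I M \<and> card (M `` {0}) < ?d 0"
    using finI iso \<open>1 \<le> k\<close> by (intro bexI[of _ I] bexI[of _ M]) (auto simp: I_def)
qed

end

section \<open>Locally finite counting measures\<close>

text \<open>\<open>Int_open\<close> holds for the Borel sets of the line and for those of the half-plane of unordered pairs,
  so that both point and edge processes are instances.\<close>

locale counting_measure =
  fixes K m :: "'a::heine_borel measure"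
  assumes lfc: "locally_finite_counting K m"
    and Int_open: "A \<in> sets K \<Longrightarrow> open U \<Longrightarrow> A \<inter> U \<in> sets K"
begin

lemma sets_eq: "sets m = sets K"
  using lfc by (simp add: locally_finite_counting_def)

lemma emeasure_bounded:
  assumes "A \<in> sets K" "bounded A"
  obtains n where "emeasure m A = of_nat n"
  using assms lfc by (auto simp: locally_finite_counting_def)

lemma point_set_in_sets: "x \<in> point_set m \<Longrightarrow> {x} \<in> sets K"
  unfolding point_set_def using emeasure_notin_sets[of "{x}" m] sets_eq by fastforce

lemma one_le_emeasure_point: "x \<in> point_set m \<Longrightarrow> 1 \<le> emeasure m {x}"
  using emeasure_bounded[OF point_set_in_sets, of x] unfolding point_set_def
  by (metis (mono_tags, lifting) bounded_insert bounded_empty mem_Collect_eq less_numeral_extra(3)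
      nat_neq_iff not_less_eq of_nat_0 of_nat_1 of_nat_mono less_one not_le)

text \<open>An integer-valued measure has no continuous part: around a point that is no atom, balls eventually
  have measure below \<open>1\<close>, hence \<open>0\<close>, and finitely many such balls cover a bounded set.\<close>

lemma atom_of_bounded:
  assumes A: "A \<in> sets K" "bounded A" "0 < emeasure m A"
  shows "\<exists>x\<in>A. x \<in> point_set m"
proof (rule ccontr)
  assume no: "\<not> ?thesis"
  have "\<exists>e>0. emeasure m (A \<inter> ball x e) = 0" for x
  proof -
    define B where "B n = A \<inter> ball x (inverse (Suc n))" for n
    have B: "B n \<in> sets K" "bounded (B n)" for n
      using A by (auto simp: B_def intro!: Int_open intro: bounded_subset)
    have "(INF n. emeasure m (B n)) = emeasure m (\<Inter>n. B n)"
    proof (rule INF_emeasure_decseq)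
      show "range B \<subseteq> sets m" using B sets_eq by auto
      show "decseq B" unfolding B_def decseq_def
        by (auto intro: less_le_trans le_imp_inverse_le simp del: inverse_inverse_eq)
          (smt (verit) le_imp_inverse_le of_nat_le_iff of_nat_Suc of_nat_0_le_iff)
      show "emeasure m (B n) \<noteq> \<infinity>" for n using emeasure_bounded[OF B, of n] by (metis ennreal_of_nat_neq_top infinity_ennreal_def)
    qed
    also have "(\<Inter>n. B n) \<subseteq> A \<inter> {x}"
    proof
      fix y assume y: "y \<in> (\<Inter>n. B n)"
      have "dist x y < e" if "0 < e" for e
      proof -
        obtain n where "inverse (Suc n) < e" using reals_Archimedean \<open>0 < e\<close> by blast
        moreover have "dist x y < inverse (Suc n)" using y by (auto simp: B_def)
        ultimately show ?thesis by simp
      qed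
      then have "dist x y \<le> 0" by (meson less_irrefl not_le)
      then show "y \<in> A \<inter> {x}" using y by (auto simp: B_def)
    qed
    then have "(\<Inter>n. B n) = {} \<or> (\<Inter>n. B n) = {x} \<and> x \<in> A" by blast
    then have "emeasure m (\<Inter>n. B n) = 0" using no by (auto simp: point_set_def)
    finally have "(INF n. emeasure m (B n)) < 1" by simp
    then obtain n where "emeasure m (B n) < 1" by (auto simp: INF_less_iff)
    moreover obtain k where "emeasure m (B n) = of_nat k" using emeasure_bounded[OF B] .
    ultimately have "emeasure m (B n) = 0" by (cases k) (auto simp: not_less[symmetric])
    then show ?thesis unfolding B_def by (intro exI[of _ "inverse (Suc n)"]) auto
  qed
  then obtain e where e: "\<And>x. e x > 0" "\<And>x. emeasure m (A \<inter> ball x (e x)) = 0" by metis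
  have "compact (closure A)" using A by simp
  then obtain T where T: "T \<subseteq> closure A" "finite T" "closure A \<subseteq> (\<Union>x\<in>T. ball x (e x))"
    by (rule compactE_image[of _ "closure A" "\<lambda>x. ball x (e x)"]) (use e(1) in auto)
  have "A = (\<Union>x\<in>T. A \<inter> ball x (e x))" using T(3) closure_subset[of A] by blast
  also have "\<dots> \<in> null_sets m"
    using T(2) A e by (intro null_sets.finite_UN) (auto simp: null_sets_def sets_eq intro!: Int_open)
  finally show False using A(3) by (simp add: null_sets_def)
qed

lemma atom_of_positive:
  assumes A: "A \<in> sets K" "0 < emeasure m A"
  shows "\<exists>x\<in>A. x \<in> point_set m"
proof (rule ccontr)
  assume no: "\<not> ?thesis"
  fix p :: 'a
  have "emeasure m (A \<inter> ball p (real n)) = 0" for n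
    using atom_of_bounded[of "A \<inter> ball p (real n)"] no A Int_open
    by (auto intro: bounded_subset simp: zero_less_iff_neq_zero)
  then have "emeasure m (\<Union>n. A \<inter> ball p (real n)) = 0"
    by (intro emeasure_UN_eq_0) (auto simp: sets_eq intro!: Int_open A)
  also have "(\<Union>n. A \<inter> ball p (real n)) = A" using reals_Archimedean2 by auto
  finally show False using A by simp
qed

lemma positive_iff_atom:
  assumes "A \<in> sets K"
  shows "0 < emeasure m A \<longleftrightarrow> (\<exists>x\<in>A. x \<in> point_set m)"
proof
  assume "\<exists>x\<in>A. x \<in> point_set m"
  then obtain x where x: "x \<in> A" "x \<in> point_set m" by auto
  then have "emeasure m {x} \<le> emeasure m A" using assms sets_eq by (intro emeasure_mono) auto
  then show "0 < emeasure m A" using x(2) by (auto simp: point_set_def)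
qed (rule atom_of_positive[OF assms])

lemma sum_le_emeasure:
  assumes "A \<in> sets K" "finite T" "T \<subseteq> A \<inter> point_set m"
  shows "of_nat (card T) \<le> emeasure m A"
proof -
  have "(of_nat (card T) :: ennreal) = (\<Sum>x\<in>T. 1)" by simp
  also have "\<dots> \<le> (\<Sum>x\<in>T. emeasure m {x})" using assms one_le_emeasure_point by (intro sum_mono) auto
  also have "\<dots> = emeasure m T"
    using assms point_set_in_sets sets_eq by (intro emeasure_eq_sum_singleton[symmetric]) auto
  also have "\<dots> \<le> emeasure m A" using assms sets_eq by (intro emeasure_mono) auto
  finally show ?thesis .
qed

lemma finite_points:
  assumes "A \<in> sets K" "emeasure m A \<noteq> \<infinity>"
  shows "finite (A \<inter> point_set m)"
proof (rule ccontr)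
  assume inf: "infinite (A \<inter> point_set m)"
  obtain n where "emeasure m A < of_nat n" using ennreal_Ex_less_of_nat[of "emeasure m A"] assms by (auto simp: less_top)
  moreover obtain T where "finite T" "card T = n" "T \<subseteq> A \<inter> point_set m"
    using infinite_arbitrarily_large[OF inf] by blast
  ultimately show False using sum_le_emeasure[OF assms(1), of T] by (auto simp: not_less)
qed

lemma finite_points_bounded:
  assumes "A \<in> sets K" "bounded A"
  shows "finite (A \<inter> point_set m)"
  using finite_points[OF assms(1)] emeasure_bounded[OF assms] by (metis ennreal_of_nat_neq_top infinity_ennreal_def)

lemma card_points_le:
  assumes "A \<in> sets K"
  shows "of_nat (card (A \<inter> point_set m)) \<le> emeasure m A"
  using sum_le_emeasure[OF assms, of "A \<inter> point_set m"] by (cases "finite (A \<inter> point_set m)") auto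

lemma emeasure_eq_card:
  assumes A: "A \<in> sets K" "finite (A \<inter> point_set m)" and simple: "\<And>x. emeasure m {x} \<le> 1"
  shows "emeasure m A = of_nat (card (A \<inter> point_set m))"
proof -
  let ?T = "A \<inter> point_set m"
  have T: "?T \<in> sets K"
    by (rule sets.countable[OF _ countable_finite[OF A(2)]]) (simp add: point_set_in_sets)
  have "emeasure m (A - ?T) = 0"
    using atom_of_positive[of "A - ?T"] T A by (fastforce simp: zero_less_iff_neq_zero)
  moreover have "emeasure m A = emeasure m ?T + emeasure m (A - ?T)"
    using T A sets_eq by (subst plus_emeasure) (auto intro!: arg_cong[where f="emeasure m"])
  moreover have "emeasure m ?T = (\<Sum>x\<in>?T. emeasure m {x})"
    using A point_set_in_sets sets_eq by (intro emeasure_eq_sum_singleton) auto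
  moreover have "\<dots> = (\<Sum>x\<in>?T. 1)"
    using simple one_le_emeasure_point by (intro sum.cong) (auto intro: antisym)
  ultimately show ?thesis by simp
qed

end

lemma counting_measure_borel:
  "locally_finite_counting borel m \<Longrightarrow> counting_measure borel (m :: 'a::heine_borel measure)"
  by unfold_locales auto

lemma space_counting_algebra: "space (counting_algebra K) = {m. locally_finite_counting K m}"
  by (auto simp add: counting_algebra_def space_Sup_eq_UN)

lemma measurable_emeasure_counting [measurable]:
  "A \<in> sets K \<Longrightarrow> (\<lambda>m. emeasure m A) \<in> borel_measurable (counting_algebra K)"
  by (auto intro!: measurable_Sup1 measurable_vimage_algebra1 simp: counting_algebra_def)

lemma measurable_counting_algebraI:
  assumes "\<And>w. w \<in> space W \<Longrightarrow> locally_finite_counting K (N w)"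
    and "\<And>A. A \<in> sets K \<Longrightarrow> (\<lambda>w. emeasure (N w) A) \<in> borel_measurable W"
  shows "N \<in> measurable W (counting_algebra K)"
  unfolding counting_algebra_def
proof (rule measurable_Sup2)
  show "N \<in> measurable W M"
    if "M \<in> (\<lambda>A. vimage_algebra {m. locally_finite_counting K m} (\<lambda>m. emeasure m A) borel) ` sets K" for M
    using that assms by (auto intro!: measurable_vimage_algebra2)
qed auto

lemma closed_upairs: "closed upairs"
proof -
  have "closed {p :: real \<times> real. fst p \<le> snd p}" by (intro closed_Collect_le continuous_intros)
  then show ?thesis by (simp add: upairs_def case_prod_beta')
qed

lemma sets_upair_borel: "A \<in> sets upair_borel \<longleftrightarrow> A \<in> sets borel \<and> A \<subseteq> upairs"
  using closed_upairs by (subst sets_restrict_space_iff) auto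

lemma space_upair_borel: "space upair_borel = upairs"
  by (simp add: space_restrict_space)

lemma counting_measure_upair:
  "locally_finite_counting upair_borel m \<Longrightarrow> counting_measure upair_borel m"
  by unfold_locales (auto simp: sets_upair_borel)

section \<open>The graph of an edge process\<close>

lemma linked_sym: "linked E x y \<longleftrightarrow> linked E y x"
  by (simp add: linked_def min.commute max.commute)

definition star_at :: "real \<Rightarrow> (real \<times> real) set" where
  "star_at x = {p\<in>upairs. fst p = x \<or> snd p = x}"

lemma star_at_sets: "star_at x \<in> sets upair_borel"
proof -
  have "closed ({p :: real \<times> real. fst p = x} \<union> {p. snd p = x})"
    by (intro closed_Un closed_Collect_eq continuous_intros)
  then have "closed (upairs \<inter> ({p. fst p = x} \<union> {p. snd p = x}))" using closed_upairs by blast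
  moreover have "upairs \<inter> ({p. fst p = x} \<union> {p. snd p = x}) = star_at x" by (auto simp: star_at_def)
  ultimately show ?thesis by (auto simp: sets_upair_borel star_at_def)
qed

lemma point_set_upairs:
  assumes "locally_finite_counting upair_borel E"
  shows "point_set E \<subseteq> upairs"
  using counting_measure.point_set_in_sets[OF counting_measure_upair[OF assms]]
  by (auto simp: sets_upair_borel)

lemma nbrs_bij:
  assumes "locally_finite_counting upair_borel E"
  shows "bij_betw (\<lambda>y. (min x y, max x y)) {y. linked E x y} (star_at x \<inter> point_set E)"
proof (rule bij_betw_byWitness[where f' = "\<lambda>p. fst p + snd p - x"])
  show "(\<lambda>p. fst p + snd p - x) ` (star_at x \<inter> point_set E) \<subseteq> {y. linked E x y}"
    by (auto simp: star_at_def linked_def upairs_def min_def max_def)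
  show "\<forall>p\<in>star_at x \<inter> point_set E. (min x (fst p + snd p - x), max x (fst p + snd p - x)) = p"
    by (auto simp: star_at_def upairs_def min_def max_def)
qed (use point_set_upairs[OF assms] in \<open>auto simp: star_at_def linked_def upairs_def min_def max_def\<close>)

lemma nbrs_of_degree:
  assumes E: "locally_finite_counting upair_borel E" "simple_edges E"
    and deg: "degree_at E x = of_nat d"
  shows "finite {y. linked E x y}" "card {y. linked E x y} = d"
proof -
  interpret counting_measure upair_borel E using E(1) by (rule counting_measure_upair)
  have star: "emeasure E (star_at x) = of_nat d"
    using deg E(2) by (simp add: degree_at_def star_at_def simple_edges_def)
  have fin: "finite (star_at x \<inter> point_set E)"
    by (rule finite_points[OF star_at_sets]) (simp add: star)
  have "emeasure E (star_at x) = of_nat (card (star_at x \<inter> point_set E))"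
    by (rule emeasure_eq_card[OF star_at_sets fin]) (use E(2) in \<open>auto simp: simple_edges_def\<close>)
  then have "card (star_at x \<inter> point_set E) = d" using star by simp
  then show "finite {y. linked E x y}" "card {y. linked E x y} = d"
    using fin bij_betw_finite[OF nbrs_bij[OF E(1)]] bij_betw_same_card[OF nbrs_bij[OF E(1)]] by auto
qed

definition mark :: "real measure \<Rightarrow> real \<Rightarrow> nat" where
  "mark m x = nat \<lfloor>enn2real (emeasure m {x})\<rfloor>"

lemma mark_eq: "emeasure m {x} = of_nat n \<Longrightarrow> mark m x = n"
  by (simp add: mark_def)

text \<open>Realizations outside a null set satisfy these conditions; everything deterministic about them is
  then available from the locale.\<close>

lemma stable_graphI:
  assumes P: "locally_finite_counting borel P" and \<xi>: "locally_finite_counting borel \<xi>"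
    and E: "locally_finite_counting upair_borel E" "simple_edges E"
    and ends: "\<forall>(x, y)\<in>point_set E. x \<in> point_set P \<and> y \<in> point_set P"
    and deg: "\<forall>x\<in>point_set P. degree_at E x = emeasure \<xi> {x}"
    and pos: "\<forall>x\<in>point_set P. 1 \<le> mark \<xi> x"
    and stable: "\<forall>x\<in>point_set P. \<forall>y\<in>point_set P. x \<noteq> y \<longrightarrow>
        linked E x y \<or>
        (\<forall>z. linked E x z \<longrightarrow> \<bar>x - z\<bar> \<le> \<bar>x - y\<bar>) \<or>
        (\<forall>z. linked E y z \<longrightarrow> \<bar>y - z\<bar> \<le> \<bar>x - y\<bar>)"
  shows "stable_graph (point_set P) (mark \<xi>) (linked E)"
proof
  interpret P: counting_measure borel P using P by (rule counting_measure_borel)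
  have d: "degree_at E x = of_nat (mark \<xi> x)" if "x \<in> point_set P" for x
  proof -
    obtain n where "emeasure \<xi> {x} = of_nat n"
      using \<xi> unfolding locally_finite_counting_def by (metis bounded_empty bounded_insert borel_singleton sets.empty_sets)
    then show ?thesis using deg that mark_eq by metis
  qed
  show "linked E x y \<Longrightarrow> linked E y x" for x y by (simp add: linked_sym)
  show "\<not> linked E x x" for x using E(2) by (auto simp: linked_def point_set_def simple_edges_def)
  show "linked E x y \<Longrightarrow> x \<in> point_set P" for x y
    using ends by (auto simp: linked_def min_def max_def split: if_splits)
  show "finite {y. linked E x y}" "card {y. linked E x y} = mark \<xi> x" if "x \<in> point_set P" for x
    using nbrs_of_degree[OF E d[OF that]] by auto
  show "finite (point_set P \<inter> {a..b})" for a b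
    using P.finite_points_bounded[of "{a..b}"] by (simp add: Int_commute)
qed (use pos stable in auto)

section \<open>Translates of an edge process\<close>

lemma shift_measurable:
  "(\<lambda>(x, y). (x + t, y + t)) \<in> measurable upair_borel upair_borel"
proof (rule measurable_restrict_space2)
  show "(\<lambda>(x, y). (x + t, y + t)) \<in> space upair_borel \<rightarrow> upairs"
    unfolding space_upair_borel by (auto simp: upairs_def)
  show "(\<lambda>(x, y). (x + t, y + t)) \<in> borel_measurable upair_borel"
    by (rule measurable_restrict_space1)
      (auto intro!: borel_measurable_continuous_onI continuous_intros simp: case_prod_beta')
qed

lemma emeasure_translate:
  assumes "locally_finite_counting upair_borel E" "A \<in> sets upair_borel"
  shows "emeasure (translate_pairs t E) A = emeasure E {(x, y)\<in>upairs. (x + t, y + t) \<in> A}"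
proof -
  have "sets E = sets upair_borel" using assms by (simp add: locally_finite_counting_def)
  then have "(\<lambda>(x, y). (x + t, y + t)) \<in> measurable E upair_borel" "space E = upairs"
    using shift_measurable measurable_cong_sets sets_eq_imp_space_eq space_upair_borel by metis+
  then show ?thesis
    unfolding translate_pairs_def using assms(2)
    by (subst emeasure_distr) (auto intro!: arg_cong[where f="emeasure E"])
qed

lemma preimage_shift_sets:
  assumes "A \<in> sets upair_borel"
  shows "{(x, y)\<in>upairs. (x + t, y + t) \<in> A} \<in> sets upair_borel"
proof -
  have "{(x, y)\<in>upairs. (x + t, y + t) \<in> A} = (\<lambda>(x, y). (x + t, y + t)) -` A \<inter> space upair_borel"
    by (auto simp: space_upair_borel)
  then show ?thesis using measurable_sets[OF shift_measurable assms] by simp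
qed

lemma locally_finite_translate:
  assumes "locally_finite_counting upair_borel E"
  shows "locally_finite_counting upair_borel (translate_pairs t E)"
  unfolding locally_finite_counting_def
proof (intro conjI ballI impI)
  show "sets (translate_pairs t E) = sets upair_borel" by (simp add: translate_pairs_def)
  fix A assume A: "A \<in> sets upair_borel" "bounded A"
  have "{(x, y)\<in>upairs. (x + t, y + t) \<in> A} \<subseteq> (\<lambda>p. p - (t, t)) ` A"
    by (auto simp: image_iff intro!: bexI[where x="(_ + t, _ + t)"])
  moreover have "bounded ((\<lambda>p. p - (t, t)) ` A)" using A(2) by (simp add: bounded_translation_minus)
  ultimately have "bounded {(x, y)\<in>upairs. (x + t, y + t) \<in> A}" using bounded_subset by blast
  then show "\<exists>n::nat. emeasure (translate_pairs t E) A = of_nat n"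
    using assms preimage_shift_sets[OF A(1)] emeasure_translate[OF assms A(1)]
    by (auto simp: locally_finite_counting_def)
qed

lemma measurable_translate [measurable]:
  "translate_pairs t \<in> measurable (counting_algebra upair_borel) (counting_algebra upair_borel)"
proof (rule measurable_counting_algebraI)
  fix A assume A: "A \<in> sets upair_borel"
  have "(\<lambda>E. emeasure E {(x, y)\<in>upairs. (x + t, y + t) \<in> A}) \<in> borel_measurable (counting_algebra upair_borel)"
    by (rule measurable_emeasure_counting[OF preimage_shift_sets[OF A]])
  then show "(\<lambda>E. emeasure (translate_pairs t E) A) \<in> borel_measurable (counting_algebra upair_borel)"
    by (rule measurable_cong[THEN iffD1, rotated]) (simp add: emeasure_translate A space_counting_algebra)
qed (simp add: locally_finite_translate space_counting_algebra)

lemma linked_translate: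
  assumes "locally_finite_counting upair_borel E"
  shows "linked (translate_pairs t E) x y \<longleftrightarrow> linked E (x - t) (y - t)"
proof -
  have "{(min x y, max x y)} \<in> sets upair_borel" unfolding sets_upair_borel by (auto simp: upairs_def)
  moreover have "{(u, v)\<in>upairs. (u + t, v + t) \<in> {(min x y, max x y)}} = {(min (x - t) (y - t), max (x - t) (y - t))}"
    by (auto simp: upairs_def min_def max_def)
  ultimately show ?thesis
    using emeasure_translate[OF assms, of "{(min x y, max x y)}" t] by (simp add: linked_def point_set_def)
qed

section \<open>Measurable selection of the points of a locally finite set\<close>

text \<open>Dyadic intervals of level \<open>fst c\<close>. A locally finite set is determined by the countably many answers
  to the question whether it meets a given cell.\<close>

definition cell :: "nat \<times> int \<Rightarrow> real set" where
  "cell c = {x. \<lfloor>2 ^ fst c * x\<rfloor> = snd c}"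

definition right_end :: "nat \<times> int \<Rightarrow> real" where
  "right_end c = (of_int (snd c) + 1) / 2 ^ fst c"

definition cell_at :: "nat \<Rightarrow> real \<Rightarrow> nat \<times> int" where
  "cell_at j x = (j, \<lfloor>2 ^ j * x\<rfloor>)"

lemma mem_cell_iff: "x \<in> cell (j, i) \<longleftrightarrow> of_int i / 2 ^ j \<le> x \<and> x < (of_int i + 1) / 2 ^ j"
  by (auto simp: cell_def floor_eq_iff field_simps)

lemma mem_cell_at: "x \<in> cell (cell_at j x)"
  by (simp add: cell_def cell_at_def)

lemma cell_at_eq: "x \<in> cell c \<Longrightarrow> cell_at (fst c) x = c"
  by (auto simp: cell_def cell_at_def)

lemma cell_eq: "cell (j, i) = {of_int i / 2 ^ j..<(of_int i + 1) / 2 ^ j}"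
  by (auto simp: mem_cell_iff)

lemma cell_sets [measurable]: "cell c \<in> sets borel"
  by (cases c) (simp add: cell_eq)

lemma bounded_cell: "bounded (cell c)"
  by (cases c) (simp add: cell_eq)

lemma less_right_end: "x \<in> cell c \<Longrightarrow> x < right_end c"
  by (cases c) (simp add: mem_cell_iff right_end_def)

lemma cell_at_near: "y \<in> cell (cell_at j x) \<Longrightarrow> \<bar>x - y\<bar> < 1 / 2 ^ j"
  using mem_cell_at[of x j] by (auto simp: cell_at_def mem_cell_iff add_divide_distrib)

lemma right_end_cell_at: "right_end (cell_at j x) \<le> x + 1 / 2 ^ j"
  using mem_cell_at[of x j] by (auto simp: cell_at_def mem_cell_iff add_divide_distrib right_end_def)

lemma cell_nonempty: "\<exists>x. x \<in> cell c"
  by (cases c, rule exI[of _ "of_int (snd c) / 2 ^ fst c"]) (simp add: mem_cell_iff divide_strict_right_mono)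

lemma cell_at_antimono:
  assumes "k \<le> j"
  shows "cell (cell_at j x) \<subseteq> cell (cell_at k x)"
proof -
  have "\<lfloor>2 ^ k * y\<rfloor> = \<lfloor>2 ^ j * y\<rfloor> div 2 ^ (j - k)" for y :: real
  proof -
    have "(2::real) ^ j = 2 ^ k * 2 ^ (j - k)" using assms by (simp flip: power_add)
    then have "2 ^ k * y = (2 ^ j * y) / real_of_int (2 ^ (j - k))" by simp
    then show ?thesis by (simp only: floor_divide_real_eq_div[of "2 ^ (j - k)"] zero_le_power zero_le_numeral)
  qed
  then show ?thesis by (auto simp: cell_def cell_at_def)
qed

lemma small_cell:
  assumes "(0::real) < e"
  obtains j where "1 / 2 ^ j < e" "k \<le> j"
proof -
  obtain n where "(1 / 2 :: real) ^ n < e" using real_arch_pow_inv[of e "1/2"] assms by auto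
  moreover have "(1 / 2 :: real) ^ (n + k) \<le> (1 / 2) ^ n" by (intro power_decreasing) auto
  ultimately have "1 / 2 ^ (n + k) < e" by (simp add: power_divide)
  then show thesis using that[of "n + k"] by simp
qed

text \<open>The leftmost point of a set in the cell \<open>c\<close>, computed from the cells that the set meets. Right ends
  are used since they converge to the leftmost point from above, so that the infimum is a countable one
  and hence measurable.\<close>

definition first_point :: "(nat \<times> int \<Rightarrow> bool) \<Rightarrow> nat \<times> int \<Rightarrow> real" where
  "first_point h c = Inf (right_end ` {c'. cell c' \<subseteq> cell c \<and> h c'})"

definition hit_cells :: "real set \<Rightarrow> nat \<times> int \<Rightarrow> bool" where
  "hit_cells V c \<longleftrightarrow> V \<inter> cell c \<noteq> {}"

lemma first_point_eq_Min:
  assumes fin: "finite (V \<inter> cell c)" and ne: "hit_cells V c"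
  shows "first_point (hit_cells V) c = Min (V \<inter> cell c)"
proof -
  let ?x = "Min (V \<inter> cell c)"
  let ?S = "right_end ` {c'. cell c' \<subseteq> cell c \<and> hit_cells V c'}"
  have x: "?x \<in> V \<inter> cell c" using fin ne by (intro Min_in) (auto simp: hit_cells_def)
  have lower: "?x \<le> r" if "r \<in> ?S" for r
  proof -
    obtain c' y where "cell c' \<subseteq> cell c" "r = right_end c'" "y \<in> V" "y \<in> cell c'"
      using \<open>r \<in> ?S\<close> by (auto simp: hit_cells_def)
    then show ?thesis using Min_le[OF fin, of y] less_right_end[of y c'] by auto
  qed
  have upper: "\<exists>r\<in>?S. r < ?x + e" if "0 < e" for e
  proof -
    obtain j where j: "1 / 2 ^ j < e" "fst c \<le> j" using small_cell[OF \<open>0 < e\<close>] .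
    have "cell (cell_at j ?x) \<subseteq> cell c" using cell_at_antimono[OF j(2), of ?x] cell_at_eq[of ?x c] x by auto
    moreover have "hit_cells V (cell_at j ?x)" using x mem_cell_at by (auto simp: hit_cells_def)
    ultimately show ?thesis using right_end_cell_at[of j ?x] j(1) by (intro bexI[of _ "right_end (cell_at j ?x)"]) auto
  qed
  have ne: "?S \<noteq> {}" using upper[of 1] by auto
  have bdd: "bdd_below ?S" using lower by (intro bdd_belowI)
  have "?x \<le> Inf ?S" by (rule cInf_greatest[OF ne lower])
  moreover have "Inf ?S \<le> ?x + e" if e: "0 < e" for e
  proof -
    obtain r where "r \<in> ?S" "r < ?x + e" using upper[OF e] by blast
    then show ?thesis using cInf_lower[of r ?S, OF _ bdd] by linarith
  qed
  then have "Inf ?S \<le> ?x" by (rule field_le_epsilon)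
  ultimately show ?thesis unfolding first_point_def by (rule antisym[rotated])
qed

lemma first_point_mem:
  assumes "finite (V \<inter> cell c)" "hit_cells V c"
  shows "first_point (hit_cells V) c \<in> V \<inter> cell c"
  using Min_in[of "V \<inter> cell c"] assms by (simp add: first_point_eq_Min) (simp add: hit_cells_def)

text \<open>Small cells separate the points, so each point is the first one in some cell.\<close>

lemma first_point_surj:
  assumes fin: "\<And>a b. finite (V \<inter> {a..b})" and "x \<in> V"
  obtains c where "hit_cells V c" "first_point (hit_cells V) c = x"
proof -
  let ?F = "V \<inter> {x - 1..x + 1} - {x}"
  have "\<exists>e>0. \<forall>y\<in>?F. e \<le> dist x y" using finite_set_avoid[of ?F x] fin by auto
  then obtain e where e: "0 < e" "\<And>y. y \<in> ?F \<Longrightarrow> e \<le> \<bar>x - y\<bar>" by (auto simp: dist_real_def)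
  obtain j where j: "1 / 2 ^ j < min e 1" using small_cell[of "min e 1" 0] e by auto
  have "V \<inter> cell (cell_at j x) = {x}"
  proof -
    have "y = x" if "y \<in> V" "y \<in> cell (cell_at j x)" for y
    proof (rule ccontr)
      assume "y \<noteq> x"
      have "\<bar>x - y\<bar> < 1 / 2 ^ j" using cell_at_near that by blast
      then have "\<bar>x - y\<bar> < e" "\<bar>x - y\<bar> < 1" using j by linarith+
      moreover from this(2) have "y \<in> ?F" using that \<open>y \<noteq> x\<close> by auto
      ultimately show False using e(2) by fastforce
    qed
    then show ?thesis using \<open>x \<in> V\<close> mem_cell_at by auto
  qed
  then show thesis
    using that[of "cell_at j x"] first_point_eq_Min[of V "cell_at j x"] by (simp add: hit_cells_def)
qed

lemma measurable_first_point [measurable]: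
  "(\<lambda>h. first_point h c) \<in> borel_measurable (Pi\<^sub>M UNIV (\<lambda>_. count_space UNIV))"
proof (subst borel_measurable_iff_less, intro allI)
  fix t :: real
  let ?M = "Pi\<^sub>M UNIV (\<lambda>_::nat \<times> int. count_space (UNIV :: bool set))"
  have [measurable]: "Measurable.pred ?M (\<lambda>h. h c')" for c' by measurable
  have bdd: "bdd_below (right_end ` {c'. cell c' \<subseteq> cell c \<and> h c'})" for h
  proof (rule bdd_belowI)
    fix r assume "r \<in> right_end ` {c'. cell c' \<subseteq> cell c \<and> h c'}"
    then obtain c' where c': "cell c' \<subseteq> cell c" "r = right_end c'" by auto
    obtain y where y: "y \<in> cell c'" using cell_nonempty by blast
    then have "of_int (snd c) / 2 ^ fst c \<le> y" using c' mem_cell_iff[of y "fst c" "snd c"] by auto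
    then show "of_int (snd c) / 2 ^ fst c \<le> r" using less_right_end[OF y] c' by simp
  qed
  have "first_point h c < t \<longleftrightarrow>
    (if \<exists>c'. cell c' \<subseteq> cell c \<and> h c' then \<exists>c'. cell c' \<subseteq> cell c \<and> h c' \<and> right_end c' < t else Inf {} < t)"
    (is "_ = (if ?ex h then _ else _)") for h
  proof (cases "\<exists>c'. cell c' \<subseteq> cell c \<and> h c'")
    case True
    then show ?thesis unfolding first_point_def by (subst cInf_less_iff[OF _ bdd]) auto
  next
    case False
    then have *: "{c'. cell c' \<subseteq> cell c \<and> h c'} = {}" by blast
    show ?thesis unfolding first_point_def * image_empty using False by (simp only: if_False)
  qed
  then have "{h \<in> space ?M. first_point h c < t} = {h \<in> space ?M.
    (if \<exists>c'. cell c' \<subseteq> cell c \<and> h c' then \<exists>c'. cell c' \<subseteq> cell c \<and> h c' \<and> right_end c' < t else Inf {} < t)}"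
    by simp
  also have "\<dots> \<in> sets ?M" by measurable
  finally show "{h \<in> space ?M. first_point h c < t} \<in> sets ?M" .
qed

lemma measurable_hit_cells [measurable (raw)]:
  assumes "\<And>c. Measurable.pred N (\<lambda>w. V w \<inter> cell c \<noteq> {})"
  shows "(\<lambda>w. hit_cells (V w)) \<in> measurable N (Pi\<^sub>M UNIV (\<lambda>_. count_space UNIV))"
  by (rule measurable_PiM_single') (use assms in \<open>auto simp: hit_cells_def\<close>)

text \<open>A quantifier over random points is a quantifier over the countably many cells. This lets the
  measurability of graph properties follow their definitions.\<close>

lemma pred_bex_points:
  assumes V: "\<And>c. Measurable.pred N (\<lambda>w. V w \<inter> cell c \<noteq> {})"
    and fin: "\<And>w a b. w \<in> space N \<Longrightarrow> finite (V w \<inter> {a..b})"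
    and \<Phi>: "Measurable.pred (N \<Otimes>\<^sub>M borel) (\<lambda>p. \<Phi> (fst p) (snd p))"
  shows "Measurable.pred N (\<lambda>w. \<exists>x\<in>V w. \<Phi> w x)"
proof -
  have finc: "finite (V w \<inter> cell c)" if "w \<in> space N" for w c
  proof -
    have "V w \<inter> cell c \<subseteq> V w \<inter> {of_int (snd c) / 2 ^ fst c..(of_int (snd c) + 1) / 2 ^ fst c}"
      by (cases c) (auto simp: cell_eq)
    then show ?thesis using fin[OF that] finite_subset by blast
  qed
  have h: "(\<lambda>w. hit_cells (V w)) \<in> measurable N (Pi\<^sub>M UNIV (\<lambda>_. count_space UNIV))"
    by (rule measurable_hit_cells[OF V])
  have "(\<exists>x\<in>V w. \<Phi> w x) \<longleftrightarrow> (\<exists>c. V w \<inter> cell c \<noteq> {} \<and> \<Phi> w (first_point (hit_cells (V w)) c))"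
    if w: "w \<in> space N" for w
  proof
    assume "\<exists>x\<in>V w. \<Phi> w x"
    then obtain x where x: "x \<in> V w" "\<Phi> w x" by auto
    obtain c where "hit_cells (V w) c" "first_point (hit_cells (V w)) c = x"
      using first_point_surj[OF fin[OF w] x(1)] by blast
    then show "\<exists>c. V w \<inter> cell c \<noteq> {} \<and> \<Phi> w (first_point (hit_cells (V w)) c)"
      using x unfolding hit_cells_def by blast
  next
    assume "\<exists>c. V w \<inter> cell c \<noteq> {} \<and> \<Phi> w (first_point (hit_cells (V w)) c)"
    then obtain c where "hit_cells (V w) c" "\<Phi> w (first_point (hit_cells (V w)) c)"
      unfolding hit_cells_def by blast
    then show "\<exists>x\<in>V w. \<Phi> w x" using first_point_mem[OF finc[OF w]] by blast
  qed
  moreover have "Measurable.pred N (\<lambda>w. \<exists>c. V w \<inter> cell c \<noteq> {} \<and> \<Phi> w (first_point (hit_cells (V w)) c))"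
  proof (intro pred_intros_countable pred_intros_logic(3))
    fix c
    show "Measurable.pred N (\<lambda>w. V w \<inter> cell c \<noteq> {})" by (rule V)
    have "(\<lambda>w. (w, first_point (hit_cells (V w)) c)) \<in> measurable N (N \<Otimes>\<^sub>M borel)"
      using measurable_compose[OF h measurable_first_point[of c]] by measurable
    from measurable_compose[OF this \<Phi>]
    show "Measurable.pred N (\<lambda>w. \<Phi> w (first_point (hit_cells (V w)) c))" by simp
  qed
  ultimately show ?thesis by (subst measurable_cong) auto
qed

section \<open>Measurable properties of the graph\<close>

definition cell_rect :: "nat \<Rightarrow> int \<Rightarrow> int \<Rightarrow> (real \<times> real) set" where
  "cell_rect j a b = upairs \<inter> (cell (j, a) \<times> cell (j, b))"

lemma upairs_borel [measurable]: "upairs \<in> sets borel"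
  using closed_upairs by (rule borel_closed)

lemma cell_rect_sets: "cell_rect j a b \<in> sets upair_borel"
  unfolding sets_upair_borel cell_rect_def
  by (auto simp: borel_prod[symmetric] intro!: sets.Int upairs_borel[unfolded borel_prod[symmetric]])

lemma bounded_cell_rect: "bounded (cell_rect j a b)"
  unfolding cell_rect_def by (auto intro: bounded_Int bounded_Times bounded_cell)

text \<open>By continuity from above along shrinking rectangles; needed because the position \<open>(a, b)\<close> will
  itself be random.\<close>

lemma positive_point_iff:
  assumes E: "locally_finite_counting upair_borel E" and "a \<le> b"
  shows "(a, b) \<in> point_set E \<longleftrightarrow> (\<forall>j. 1 \<le> emeasure E (cell_rect j \<lfloor>2 ^ j * a\<rfloor> \<lfloor>2 ^ j * b\<rfloor>))"
    (is "_ \<longleftrightarrow> (\<forall>j. 1 \<le> emeasure E (?R j))")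
proof -
  interpret counting_measure upair_borel E using E by (rule counting_measure_upair)
  have R: "?R j = upairs \<inter> (cell (cell_at j a) \<times> cell (cell_at j b))" for j
    by (simp add: cell_rect_def cell_at_def)
  have in_R: "(a, b) \<in> ?R j" for j using \<open>a \<le> b\<close> by (simp add: R mem_cell_at upairs_def)
  have sR: "?R j \<in> sets E" for j using cell_rect_sets sets_eq by simp
  show ?thesis
  proof
    assume p: "(a, b) \<in> point_set E"
    have "emeasure E {(a, b)} \<le> emeasure E (?R j)" for j
      by (rule emeasure_mono) (use in_R sR in auto)
    then show "\<forall>j. 1 \<le> emeasure E (?R j)" using one_le_emeasure_point[OF p] order_trans by blast
  next
    assume one: "\<forall>j. 1 \<le> emeasure E (?R j)"
    have "(INF j. emeasure E (?R j)) = emeasure E (\<Inter>j. ?R j)"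
    proof (rule INF_emeasure_decseq)
      show "range ?R \<subseteq> sets E" using sR by auto
      show "decseq ?R" unfolding decseq_def R using cell_at_antimono by blast
      show "emeasure E (?R j) \<noteq> \<infinity>" for j
        using emeasure_bounded[OF cell_rect_sets bounded_cell_rect] by (metis ennreal_of_nat_neq_top infinity_ennreal_def)
    qed
    also have "(\<Inter>j. ?R j) = {(a, b)}"
    proof -
      have "y = x" if y: "\<And>j. y \<in> cell (cell_at j x)" for x y :: real
      proof (rule ccontr)
        assume "y \<noteq> x"
        then obtain j where "1 / 2 ^ j < \<bar>x - y\<bar>" using small_cell[of "\<bar>x - y\<bar>" 0] by auto
        then show False using cell_at_near[OF y, of j] by linarith
      qed
      then have only: "p = (a, b)" if "\<forall>j. p \<in> ?R j" for p
        using that by (cases p) (simp add: R)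
      show ?thesis
      proof (intro equalityI subsetI)
        fix p assume "p \<in> (\<Inter>j. ?R j)"
        then have "\<forall>j. p \<in> ?R j" by (simp only: INT_iff ball_UNIV simp_thms)
        then show "p \<in> {(a, b)}" using only by (simp only: singleton_iff)
      qed (simp only: INT_iff singleton_iff in_R ball_UNIV simp_thms)
    qed
    finally have "emeasure E {(a, b)} = (INF j. emeasure E (?R j))" by simp
    then have "1 \<le> emeasure E {(a, b)}" using one by (simp add: le_INF_iff)
    then show "(a, b) \<in> point_set E" by (auto simp: point_set_def intro: less_le_trans[OF zero_less_one])
  qed
qed

lemma pred_linked:
  assumes e: "e \<in> measurable N (counting_algebra upair_borel)"
    and f [measurable]: "f \<in> borel_measurable N" and g [measurable]: "g \<in> borel_measurable N"
  shows "Measurable.pred N (\<lambda>w. linked (e w) (f w) (g w))"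
proof -
  have [measurable]: "(\<lambda>w. emeasure (e w) (cell_rect j a b)) \<in> borel_measurable N" for j a b
    by (rule measurable_compose[OF e measurable_emeasure_counting[OF cell_rect_sets]])
  have "linked (e w) (f w) (g w) \<longleftrightarrow> (\<forall>j. \<exists>a b. \<lfloor>2 ^ j * min (f w) (g w)\<rfloor> = a \<and> \<lfloor>2 ^ j * max (f w) (g w)\<rfloor> = b \<and>
      1 \<le> emeasure (e w) (cell_rect j a b))" if "w \<in> space N" for w
    using measurable_space[OF e that] unfolding linked_def
    by (subst positive_point_iff) (auto simp: space_counting_algebra)
  then show ?thesis by (subst measurable_cong) measurable
qed

definition vertices :: "(real \<times> real) measure \<Rightarrow> real set" where
  "vertices E = {x. \<exists>y. linked E x y}"

text \<open>The edge process is locally finite on pairs, which does not prevent its vertices from accumulating.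
  The trace \<open>graph_space\<close> of the \<open>\<sigma>\<close>-algebra on the well-behaved edge sets serves to speak about
  measurability; the set of these need not itself be measurable.\<close>

definition locally_finite_graph :: "(real \<times> real) measure \<Rightarrow> bool" where
  "locally_finite_graph E \<longleftrightarrow>
     locally_finite_counting upair_borel E \<and> (\<forall>a b. finite (vertices E \<inter> {a..b}))"

abbreviation graph_space :: "(real \<times> real) measure measure" where
  "graph_space \<equiv> restrict_space (counting_algebra upair_borel) {E. locally_finite_graph E}"

lemma graph_spaceD: "E \<in> space graph_space \<Longrightarrow> locally_finite_graph E"
  by (simp add: space_restrict_space)

lemma measurable_graph_space: "e \<in> measurable N graph_space \<Longrightarrow> e \<in> measurable N (counting_algebra upair_borel)"
  by (simp add: measurable_restrict_space2_iff)

lemma pred_vertices_cell: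
  assumes e: "e \<in> measurable N graph_space"
  shows "Measurable.pred N (\<lambda>w. vertices (e w) \<inter> cell c \<noteq> {})"
proof -
  define T where "T = upairs \<inter> (cell c \<times> UNIV \<union> UNIV \<times> cell c)"
  have T: "T \<in> sets upair_borel"
    unfolding sets_upair_borel T_def
    by (auto simp: borel_prod[symmetric] intro!: sets.Int upairs_borel[unfolded borel_prod[symmetric]])
  have "vertices (e w) \<inter> cell c \<noteq> {} \<longleftrightarrow> 0 < emeasure (e w) T" if "w \<in> space N" for w
  proof -
    have lf: "locally_finite_counting upair_borel (e w)"
      using graph_spaceD[OF measurable_space[OF e that]] by (simp add: locally_finite_graph_def)
    interpret counting_measure upair_borel "e w" using lf by (rule counting_measure_upair)
    have "vertices (e w) \<inter> cell c \<noteq> {} \<longleftrightarrow> (\<exists>x\<in>T. x \<in> point_set (e w))"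
    proof
      assume "vertices (e w) \<inter> cell c \<noteq> {}"
      then obtain x y where "x \<in> cell c" "linked (e w) x y" by (auto simp: vertices_def)
      then show "\<exists>x\<in>T. x \<in> point_set (e w)"
        by (intro bexI[of _ "(min x y, max x y)"]) (auto simp: linked_def T_def upairs_def min_def max_def)
    next
      assume "\<exists>x\<in>T. x \<in> point_set (e w)"
      then obtain x y where xy: "(x, y) \<in> T" "(x, y) \<in> point_set (e w)" by auto
      then have "linked (e w) x y" by (auto simp: T_def upairs_def linked_def min_def max_def)
      moreover from this have "linked (e w) y x" by (simp add: linked_sym)
      ultimately show "vertices (e w) \<inter> cell c \<noteq> {}" using xy by (auto simp: T_def vertices_def)
    qed
    then show ?thesis using positive_iff_atom[OF T] by simp
  qed
  moreover have "Measurable.pred N (\<lambda>w. 0 < emeasure (e w) T)"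
    using measurable_compose[OF measurable_graph_space[OF e] measurable_emeasure_counting[OF T]] by measurable
  ultimately show ?thesis by (subst measurable_cong) auto
qed

lemma pred_bex_vertices:
  assumes e: "e \<in> measurable N graph_space"
    and \<Phi>: "Measurable.pred (N \<Otimes>\<^sub>M borel) (\<lambda>p. \<Phi> (fst p) (snd p))"
  shows "Measurable.pred N (\<lambda>w. \<exists>x\<in>vertices (e w). \<Phi> w x)"
  using pred_vertices_cell[OF e] _ \<Phi>
  by (rule pred_bex_points) (use graph_spaceD[OF measurable_space[OF e]] in \<open>simp add: locally_finite_graph_def\<close>)

lemma linked_vertices: "linked E x y \<Longrightarrow> x \<in> vertices E" "linked E x y \<Longrightarrow> y \<in> vertices E"
  using linked_sym by (auto simp: vertices_def)

text \<open>Stated on a fixed product space, with both end points as coordinates, so that the induction on the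
  length of the path stays within one type.\<close>

lemma pred_linked_relpow:
  "Measurable.pred (graph_space \<Otimes>\<^sub>M (borel \<Otimes>\<^sub>M borel)) (\<lambda>q. (linked (fst q) ^^ n) (fst (snd q)) (snd (snd q)))"
proof (induction n)
  case 0
  show ?case by simp
next
  case (Suc n)
  let ?N = "graph_space \<Otimes>\<^sub>M (borel \<Otimes>\<^sub>M (borel :: real measure))"
  have eq: "(linked (fst q) ^^ Suc n) (fst (snd q)) (snd (snd q)) \<longleftrightarrow>
    (\<exists>x\<in>vertices (fst q). (linked (fst q) ^^ n) (fst (snd q)) x \<and> linked (fst q) x (snd (snd q)))"
    for q :: "(real \<times> real) measure \<times> real \<times> real"
    using linked_vertices(1) by (auto simp: relcompp_apply)
  show ?case
    unfolding eq
  proof (rule pred_bex_vertices, (measurable)[1], rule pred_intros_logic(3))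
    have "(\<lambda>p. (fst (fst p), fst (snd (fst p)), snd p)) \<in> measurable (?N \<Otimes>\<^sub>M borel) ?N" by measurable
    from measurable_compose[OF this Suc.IH]
    show "Measurable.pred (?N \<Otimes>\<^sub>M borel) (\<lambda>p. (linked (fst (fst p)) ^^ n) (fst (snd (fst p))) (snd p))" by simp
    show "Measurable.pred (?N \<Otimes>\<^sub>M borel) (\<lambda>p. linked (fst (fst p)) (snd p) (snd (snd (fst p))))"
    proof (rule pred_linked)
      have "(\<lambda>p. fst (fst p)) \<in> measurable (?N \<Otimes>\<^sub>M borel) graph_space" by measurable
      then show "(\<lambda>p. fst (fst p)) \<in> measurable (?N \<Otimes>\<^sub>M (borel :: real measure)) (counting_algebra upair_borel)"
        by (rule measurable_graph_space)
    qed measurable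
  qed
qed

lemma pred_connected:
  assumes e: "e \<in> measurable N graph_space"
    and f: "f \<in> borel_measurable N" and g: "g \<in> borel_measurable N"
  shows "Measurable.pred N (\<lambda>w. (linked (e w))\<^sup>*\<^sup>* (f w) (g w))"
proof -
  have "(\<lambda>w. (e w, f w, g w)) \<in> measurable N (graph_space \<Otimes>\<^sub>M (borel \<Otimes>\<^sub>M borel))"
    using e f g by measurable
  from measurable_compose[OF this pred_linked_relpow]
  have "Measurable.pred N (\<lambda>w. (linked (e w) ^^ n) (f w) (g w))" for n by simp
  then show ?thesis unfolding rtranclp_power by measurable
qed

lemma component_subset: "component E x \<subseteq> insert x (vertices E)"
proof
  fix y assume "y \<in> component E x"
  then have "(linked E)\<^sup>*\<^sup>* x y" by (simp add: component_def)
  then show "y \<in> insert x (vertices E)" by (cases rule: rtranclp.cases) (auto dest: linked_vertices)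
qed

lemma infinite_iff_unbounded:
  assumes "\<And>a b. finite (V \<inter> {a..b})" "A \<subseteq> V"
  shows "infinite A \<longleftrightarrow> (\<forall>K::nat. \<exists>y\<in>V. real K < \<bar>y\<bar> \<and> y \<in> A)"
proof
  assume inf: "infinite A"
  show "\<forall>K::nat. \<exists>y\<in>V. real K < \<bar>y\<bar> \<and> y \<in> A"
  proof (rule ccontr)
    assume "\<not> ?thesis"
    then obtain K :: nat where "\<And>y. y \<in> A \<Longrightarrow> \<bar>y\<bar> \<le> K" using assms(2) by (meson not_le subsetD)
    then have "A \<subseteq> V \<inter> {- real K..real K}" using assms(2) by fastforce
    then show False using inf assms(1) finite_subset by blast
  qed
next
  assume un: "\<forall>K::nat. \<exists>y\<in>V. real K < \<bar>y\<bar> \<and> y \<in> A"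
  show "infinite A"
  proof
    assume "finite A"
    then obtain B where "\<forall>y\<in>A. \<bar>y\<bar> \<le> B" using finite_imp_bounded[of A] unfolding bounded_iff by auto
    moreover obtain K :: nat where "B \<le> K" using real_arch_simple by blast
    ultimately show False using un by (meson order.trans not_le)
  qed
qed

lemma infinite_component_iff:
  assumes "locally_finite_graph E" "x \<in> vertices E"
  shows "infinite (component E x) \<longleftrightarrow> (\<forall>K::nat. \<exists>y\<in>vertices E. real K < \<bar>y\<bar> \<and> (linked E)\<^sup>*\<^sup>* x y)"
  using infinite_iff_unbounded[of "vertices E" "component E x"] assms component_subset[of E x]
  by (auto simp: locally_finite_graph_def component_def)

definition block :: "int \<Rightarrow> real set" where
  "block m = {of_int m..<of_int m + 1}"

lemma block_sets [measurable]: "block m \<in> sets borel" by (simp add: block_def)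

definition infinite_in_block :: "int \<Rightarrow> (real \<times> real) measure \<Rightarrow> bool" where
  "infinite_in_block m E \<longleftrightarrow> (\<exists>x\<in>vertices E. x \<in> block m \<and> infinite (component E x))"

definition is_leaf :: "(real \<times> real) measure \<Rightarrow> real \<Rightarrow> bool" where
  "is_leaf E x \<longleftrightarrow> \<not> (\<exists>y\<in>vertices E. \<exists>z\<in>vertices E. y \<noteq> z \<and> linked E x y \<and> linked E x z)"

definition infinite_leaf_block :: "int \<Rightarrow> int \<Rightarrow> (real \<times> real) measure \<Rightarrow> bool" where
  "infinite_leaf_block m n E \<longleftrightarrow> (\<exists>x\<in>vertices E. x \<in> block m \<and> is_leaf E x \<and> infinite (component E x) \<and>
     (\<exists>y\<in>vertices E. y \<in> block n \<and> (linked E)\<^sup>*\<^sup>* x y))"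

definition infinitely_desired :: "real \<Rightarrow> (real \<times> real) measure \<Rightarrow> bool" where
  "infinitely_desired u E \<longleftrightarrow> infinite {x\<in>vertices E. \<exists>y. linked E x y \<and> \<bar>x - u\<bar> < \<bar>x - y\<bar>}"

lemma pred_infinite_component:
  assumes e: "e \<in> measurable N graph_space" and f: "f \<in> borel_measurable N"
  shows "Measurable.pred N (\<lambda>w. \<forall>K::nat. \<exists>y\<in>vertices (e w). real K < \<bar>y\<bar> \<and> (linked (e w))\<^sup>*\<^sup>* (f w) y)"
proof (intro pred_intros_countable pred_bex_vertices e pred_intros_logic)
  have [measurable]: "(\<lambda>p. e (fst p)) \<in> measurable (N \<Otimes>\<^sub>M borel) graph_space"
    "(\<lambda>p. f (fst p)) \<in> borel_measurable (N \<Otimes>\<^sub>M (borel :: real measure))" using e f by measurable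
  show "Measurable.pred (N \<Otimes>\<^sub>M borel) (\<lambda>p. real K < \<bar>snd p\<bar>)" for K by measurable
  show "Measurable.pred (N \<Otimes>\<^sub>M borel) (\<lambda>p. (linked (e (fst p)))\<^sup>*\<^sup>* (f (fst p)) (snd p))"
    by (rule pred_connected) measurable
qed

lemma pred_is_leaf:
  assumes e: "e \<in> measurable N graph_space" and f: "f \<in> borel_measurable N"
  shows "Measurable.pred N (\<lambda>w. is_leaf (e w) (f w))"
  unfolding is_leaf_def
proof (intro pred_intros_logic pred_bex_vertices e)
  let ?N = "N \<Otimes>\<^sub>M (borel :: real measure)"
  show "(\<lambda>p. e (fst p)) \<in> measurable ?N graph_space" using e by measurable
  have ef: "(\<lambda>p. e (fst (fst p))) \<in> measurable (?N \<Otimes>\<^sub>M (borel :: real measure)) (counting_algebra upair_borel)"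
    "(\<lambda>p. f (fst (fst p))) \<in> borel_measurable (?N \<Otimes>\<^sub>M (borel :: real measure))"
    using measurable_graph_space[OF e] f by measurable
  show "Measurable.pred (?N \<Otimes>\<^sub>M borel) (\<lambda>p. snd (fst p) = snd p)" by measurable
  show "Measurable.pred (?N \<Otimes>\<^sub>M borel) (\<lambda>p. linked (e (fst (fst p))) (f (fst (fst p))) (snd p))"
    by (rule pred_linked[OF ef]) measurable
  show "Measurable.pred (?N \<Otimes>\<^sub>M (borel :: real measure)) (\<lambda>p. linked (e (fst (fst p))) (f (fst (fst p))) (snd (fst p)))"
    by (rule pred_linked[OF ef]) measurable
qed

lemma pred_infinite_in_block: "Measurable.pred graph_space (infinite_in_block m)"
proof -
  have "infinite_in_block m E \<longleftrightarrow> (\<exists>x\<in>vertices E. x \<in> block m \<and>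
     (\<forall>K::nat. \<exists>y\<in>vertices E. real K < \<bar>y\<bar> \<and> (linked E)\<^sup>*\<^sup>* x y))" if "E \<in> space graph_space" for E
    using infinite_component_iff[OF graph_spaceD[OF that]] by (auto simp: infinite_in_block_def)
  moreover have "Measurable.pred graph_space (\<lambda>E. \<exists>x\<in>vertices E. x \<in> block m \<and>
     (\<forall>K::nat. \<exists>y\<in>vertices E. real K < \<bar>y\<bar> \<and> (linked E)\<^sup>*\<^sup>* x y))"
  proof (rule pred_bex_vertices, (measurable)[1], rule pred_intros_logic(3))
    show "Measurable.pred (graph_space \<Otimes>\<^sub>M borel) (\<lambda>p. snd p \<in> block m)" by measurable
    show "Measurable.pred (graph_space \<Otimes>\<^sub>M borel) (\<lambda>p. \<forall>K::nat. \<exists>y\<in>vertices (fst p). real K < \<bar>y\<bar> \<and> (linked (fst p))\<^sup>*\<^sup>* (snd p) y)"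
      by (rule pred_infinite_component) measurable
  qed
  ultimately show ?thesis by (subst measurable_cong) auto
qed

lemma pred_infinite_leaf_block: "Measurable.pred graph_space (infinite_leaf_block m n)"
proof -
  have "infinite_leaf_block m n E \<longleftrightarrow> (\<exists>x\<in>vertices E. x \<in> block m \<and> is_leaf E x \<and>
     (\<forall>K::nat. \<exists>y\<in>vertices E. real K < \<bar>y\<bar> \<and> (linked E)\<^sup>*\<^sup>* x y) \<and>
     (\<exists>y\<in>vertices E. y \<in> block n \<and> (linked E)\<^sup>*\<^sup>* x y))" if "E \<in> space graph_space" for E
    using infinite_component_iff[OF graph_spaceD[OF that]] by (auto simp: infinite_leaf_block_def)
  moreover have "Measurable.pred graph_space (\<lambda>E. \<exists>x\<in>vertices E. x \<in> block m \<and> is_leaf E x \<and>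
     (\<forall>K::nat. \<exists>y\<in>vertices E. real K < \<bar>y\<bar> \<and> (linked E)\<^sup>*\<^sup>* x y) \<and>
     (\<exists>y\<in>vertices E. y \<in> block n \<and> (linked E)\<^sup>*\<^sup>* x y))"
  proof (rule pred_bex_vertices, (measurable)[1], intro pred_intros_logic(3))
    let ?N = "graph_space \<Otimes>\<^sub>M (borel :: real measure)"
    show "Measurable.pred ?N (\<lambda>p. snd p \<in> block m)" by measurable
    show "Measurable.pred ?N (\<lambda>p. \<forall>K::nat. \<exists>y\<in>vertices (fst p). real K < \<bar>y\<bar> \<and> (linked (fst p))\<^sup>*\<^sup>* (snd p) y)"
      by (rule pred_infinite_component) measurable
    show "Measurable.pred ?N (\<lambda>p. is_leaf (fst p) (snd p))"
      by (rule pred_is_leaf) measurable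
    show "Measurable.pred ?N (\<lambda>p. \<exists>y\<in>vertices (fst p). y \<in> block n \<and> (linked (fst p))\<^sup>*\<^sup>* (snd p) y)"
    proof (rule pred_bex_vertices, (measurable)[1], rule pred_intros_logic(3))
      show "Measurable.pred (?N \<Otimes>\<^sub>M borel) (\<lambda>p. snd p \<in> block n)" by measurable
      show "Measurable.pred (?N \<Otimes>\<^sub>M borel) (\<lambda>p. (linked (fst (fst p)))\<^sup>*\<^sup>* (snd (fst p)) (snd p))"
        by (rule pred_connected) measurable
    qed
  qed
  ultimately show ?thesis by (subst measurable_cong) auto
qed

lemma pred_infinitely_desired: "Measurable.pred graph_space (infinitely_desired u)"
proof -
  have "infinitely_desired u E \<longleftrightarrow> (\<forall>K::nat. \<exists>x\<in>vertices E. real K < \<bar>x\<bar> \<and>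
     (\<exists>y\<in>vertices E. linked E x y \<and> \<bar>x - u\<bar> < \<bar>x - y\<bar>))" if "E \<in> space graph_space" for E
  proof -
    have "infinitely_desired u E \<longleftrightarrow> (\<forall>K::nat. \<exists>x\<in>vertices E. real K < \<bar>x\<bar> \<and>
       x \<in> {x\<in>vertices E. \<exists>y. linked E x y \<and> \<bar>x - u\<bar> < \<bar>x - y\<bar>})"
      unfolding infinitely_desired_def
      by (rule infinite_iff_unbounded) (use graph_spaceD[OF that] in \<open>auto simp: locally_finite_graph_def\<close>)
    then show ?thesis using linked_vertices(2) by blast
  qed
  moreover have "Measurable.pred graph_space (\<lambda>E. \<forall>K::nat. \<exists>x\<in>vertices E. real K < \<bar>x\<bar> \<and>
     (\<exists>y\<in>vertices E. linked E x y \<and> \<bar>x - u\<bar> < \<bar>x - y\<bar>))"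
  proof (intro pred_intros_countable pred_bex_vertices pred_intros_logic(3))
    let ?N = "graph_space \<Otimes>\<^sub>M (borel :: real measure)"
    show "(\<lambda>E. E) \<in> measurable graph_space graph_space" "fst \<in> measurable ?N graph_space" by measurable
    show "Measurable.pred ?N (\<lambda>p. real K < \<bar>snd p\<bar>)" for K by measurable
    have e: "(\<lambda>p. fst (fst p)) \<in> measurable (?N \<Otimes>\<^sub>M (borel :: real measure)) graph_space" by measurable
    show "Measurable.pred (?N \<Otimes>\<^sub>M borel) (\<lambda>p. linked (fst (fst p)) (snd (fst p)) (snd p))"
      by (rule pred_linked[OF measurable_graph_space[OF e]]) measurable
    show "Measurable.pred (?N \<Otimes>\<^sub>M borel) (\<lambda>p. \<bar>snd (fst p) - u\<bar> < \<bar>snd (fst p) - snd p\<bar>)" by measurable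
  qed
  ultimately show ?thesis by (subst measurable_cong) auto
qed

section \<open>Translation covariance of graph properties\<close>

lemma vertices_translate:
  assumes "locally_finite_counting upair_borel E"
  shows "x \<in> vertices (translate_pairs t E) \<longleftrightarrow> x - t \<in> vertices E"
  unfolding vertices_def linked_translate[OF assms]
  by auto (metis add_diff_cancel_right')

lemma rtranclp_translate:
  assumes R: "\<And>x y. R' x y \<longleftrightarrow> R (x - t) (y - t :: real)"
  shows "R'\<^sup>*\<^sup>* x y \<longleftrightarrow> R\<^sup>*\<^sup>* (x - t) (y - t)"
proof
  show "R'\<^sup>*\<^sup>* x y \<Longrightarrow> R\<^sup>*\<^sup>* (x - t) (y - t)"
    by (induction rule: rtranclp_induct) (auto simp: R intro: rtranclp.rtrancl_into_rtrancl)
  have "R\<^sup>*\<^sup>* a b \<Longrightarrow> R'\<^sup>*\<^sup>* (a + t) (b + t)" for a b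
    by (induction rule: rtranclp_induct) (auto simp: R intro: rtranclp.rtrancl_into_rtrancl)
  from this[of "x - t" "y - t"] show "R\<^sup>*\<^sup>* (x - t) (y - t) \<Longrightarrow> R'\<^sup>*\<^sup>* x y" by simp
qed

lemma connected_translate:
  assumes "locally_finite_counting upair_borel E"
  shows "(linked (translate_pairs t E))\<^sup>*\<^sup>* x y \<longleftrightarrow> (linked E)\<^sup>*\<^sup>* (x - t) (y - t)"
  by (rule rtranclp_translate[where R' = "linked (translate_pairs t E)" and R = "linked E"])
    (rule linked_translate[OF assms])

lemma mem_image_shift: "x \<in> (\<lambda>y. y + t) ` A \<longleftrightarrow> x - t \<in> A" for t :: real
  by (auto simp: image_iff) (metis diff_add_cancel)

lemma component_translate:
  assumes "locally_finite_counting upair_borel E"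
  shows "component (translate_pairs t E) x = (\<lambda>y. y + t) ` component E (x - t)"
  by (simp add: set_eq_iff mem_image_shift component_def connected_translate[OF assms])

lemma infinite_component_translate:
  assumes "locally_finite_counting upair_borel E"
  shows "infinite (component (translate_pairs t E) x) \<longleftrightarrow> infinite (component E (x - t))"
  unfolding component_translate[OF assms] by (simp add: finite_image_iff inj_on_def)

lemma is_leaf_translate:
  assumes "locally_finite_counting upair_borel E"
  shows "is_leaf (translate_pairs t E) x \<longleftrightarrow> is_leaf E (x - t)"
proof -
  have *: "is_leaf E x \<longleftrightarrow> (\<forall>y z. linked E x y \<longrightarrow> linked E x z \<longrightarrow> y = z)" for E x
    unfolding is_leaf_def using linked_vertices(2) by blast
  show ?thesis
    unfolding * linked_translate[OF assms] by (metis add_diff_cancel_right' diff_add_cancel)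
qed

lemma locally_finite_graph_translate:
  assumes "locally_finite_graph E"
  shows "locally_finite_graph (translate_pairs t E)"
proof -
  have E: "locally_finite_counting upair_borel E" using assms by (simp add: locally_finite_graph_def)
  have "vertices (translate_pairs t E) \<inter> {a..b} = (\<lambda>y. y + t) ` (vertices E \<inter> {a - t..b - t})" for a b
    by (auto simp: set_eq_iff mem_image_shift vertices_translate[OF E])
  then show ?thesis
    using assms locally_finite_translate[OF E] by (simp add: locally_finite_graph_def)
qed

lemma bex_shift:
  fixes t :: real
  assumes "\<And>x. x \<in> A \<longleftrightarrow> x - t \<in> B"
  shows "(\<exists>x\<in>A. \<Phi> (x - t)) \<longleftrightarrow> (\<exists>x\<in>B. \<Phi> x)"
  using assms by (metis add_diff_cancel_right')

lemma block_shift: "x \<in> block m \<longleftrightarrow> x - of_int k \<in> block (m - k)"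
  by (auto simp: block_def)

lemma infinite_in_block_translate:
  assumes "locally_finite_counting upair_borel E"
  shows "infinite_in_block m (translate_pairs (of_int k) E) \<longleftrightarrow> infinite_in_block (m - k) E"
  unfolding infinite_in_block_def infinite_component_translate[OF assms] block_shift[of _ m k]
  by (rule bex_shift[where \<Phi> = "\<lambda>x. x \<in> block (m - k) \<and> infinite (component E x)"])
    (rule vertices_translate[OF assms])

lemma infinite_leaf_block_translate:
  assumes "locally_finite_counting upair_borel E"
  shows "infinite_leaf_block m n (translate_pairs (of_int k) E) \<longleftrightarrow> infinite_leaf_block (m - k) (n - k) E"
proof -
  note sh = bex_shift[OF vertices_translate[OF assms, of _ "of_int k"]]
  have "(\<exists>y\<in>vertices (translate_pairs (of_int k) E). y \<in> block n \<and> (linked (translate_pairs (of_int k) E))\<^sup>*\<^sup>* x y)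
    \<longleftrightarrow> (\<exists>y\<in>vertices E. y \<in> block (n - k) \<and> (linked E)\<^sup>*\<^sup>* (x - of_int k) y)" for x
    unfolding connected_translate[OF assms] block_shift[of _ n k]
    by (rule sh[where \<Phi> = "\<lambda>y. y \<in> block (n - k) \<and> (linked E)\<^sup>*\<^sup>* (x - of_int k) y"])
  then show ?thesis
    unfolding infinite_leaf_block_def infinite_component_translate[OF assms] is_leaf_translate[OF assms] block_shift[of _ m k]
    by (simp only: sh[where \<Phi> = "\<lambda>x. x \<in> block (m - k) \<and> is_leaf E x \<and> infinite (component E x) \<and>
      (\<exists>y\<in>vertices E. y \<in> block (n - k) \<and> (linked E)\<^sup>*\<^sup>* x y)"])
qed

lemma infinitely_desired_translate:
  assumes "locally_finite_counting upair_borel E"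
  shows "infinitely_desired u (translate_pairs t E) \<longleftrightarrow> infinitely_desired (u - t) E"
proof -
  have "{x\<in>vertices (translate_pairs t E). \<exists>y. linked (translate_pairs t E) x y \<and> \<bar>x - u\<bar> < \<bar>x - y\<bar>} =
    (\<lambda>x. x + t) ` {x\<in>vertices E. \<exists>y. linked E x y \<and> \<bar>x - (u - t)\<bar> < \<bar>x - y\<bar>}" (is "?A = _ ` ?B")
  proof (intro set_eqI)
    fix x
    have "x \<in> ?A \<longleftrightarrow> x - t \<in> vertices E \<and> (\<exists>y. linked E (x - t) (y - t) \<and> \<bar>x - u\<bar> < \<bar>x - y\<bar>)"
      by (simp add: vertices_translate[OF assms] linked_translate[OF assms])
    also have "(\<exists>y. linked E (x - t) (y - t) \<and> \<bar>x - u\<bar> < \<bar>x - y\<bar>) \<longleftrightarrow> (\<exists>y. linked E (x - t) y \<and> \<bar>x - u\<bar> < \<bar>x - (y + t)\<bar>)"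
      by (metis add_diff_cancel_right' diff_add_cancel)
    also have "x - t \<in> vertices E \<and> \<dots> \<longleftrightarrow> x - t \<in> ?B" by (simp add: algebra_simps)
    also have "\<dots> \<longleftrightarrow> x \<in> (\<lambda>x. x + t) ` ?B" by (simp only: mem_image_shift)
    finally show "x \<in> ?A \<longleftrightarrow> x \<in> (\<lambda>x. x + t) ` ?B" .
  qed
  then show ?thesis unfolding infinitely_desired_def by (simp add: finite_image_iff inj_on_def)
qed

section \<open>Stationary graphs\<close>

text \<open>\<open>\<Omega>\<close> is an almost sure event on which the realizations are well behaved, so that the sets below are
  measurable without completing \<open>W\<close>.\<close>

locale stationary_graph = prob_space W for W :: "'w measure" +
  fixes E :: "'w \<Rightarrow> (real \<times> real) measure" and \<Omega> :: "'w set"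
  assumes E_measurable: "E \<in> measurable W (counting_algebra upair_borel)"
    and \<Omega>_sets [measurable]: "\<Omega> \<in> sets W" and AE_\<Omega>: "AE \<omega> in W. \<omega> \<in> \<Omega>"
    and graph: "\<omega> \<in> \<Omega> \<Longrightarrow> locally_finite_graph (E \<omega>)"
    and stationary: "distr W (counting_algebra upair_borel) (\<lambda>\<omega>. translate_pairs t (E \<omega>)) =
       distr W (counting_algebra upair_borel) E"
begin

lemma counting: "\<omega> \<in> \<Omega> \<Longrightarrow> locally_finite_counting upair_borel (E \<omega>)"
  using graph by (simp add: locally_finite_graph_def)

lemma event_representation:
  assumes "Measurable.pred graph_space \<Phi>"
  obtains A where "A \<in> sets (counting_algebra upair_borel)"
    "\<And>e. locally_finite_graph e \<Longrightarrow> e \<in> A \<longleftrightarrow> \<Phi> e"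
proof -
  have "{e \<in> space graph_space. \<Phi> e} \<in> sets graph_space" using assms by simp
  then obtain A where A: "A \<in> sets (counting_algebra upair_borel)"
    "{e \<in> space graph_space. \<Phi> e} = {e. locally_finite_graph e} \<inter> A"
    by (auto simp: sets_restrict_space)
  moreover have "e \<in> A \<longleftrightarrow> \<Phi> e" if "locally_finite_graph e" for e
  proof -
    have "e \<in> space graph_space"
      using that by (simp add: space_restrict_space space_counting_algebra locally_finite_graph_def)
    then show ?thesis using A(2) that by blast
  qed
  ultimately show thesis using that by blast
qed

lemma event_sets:
  assumes "Measurable.pred graph_space \<Phi>"
  shows "{\<omega>\<in>\<Omega>. \<Phi> (E \<omega>)} \<in> sets W"
proof -
  obtain A where A: "A \<in> sets (counting_algebra upair_borel)" "\<And>e. locally_finite_graph e \<Longrightarrow> e \<in> A \<longleftrightarrow> \<Phi> e"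
    using event_representation[OF assms] by blast
  have "{\<omega>\<in>\<Omega>. \<Phi> (E \<omega>)} = \<Omega> \<inter> (E -` A \<inter> space W)"
    using A graph sets.sets_into_space[OF \<Omega>_sets] by auto
  then show ?thesis using measurable_sets[OF E_measurable A(1)] by auto
qed

lemma prob_translate:
  assumes "Measurable.pred graph_space \<Phi>"
  shows "prob {\<omega>\<in>\<Omega>. \<Phi> (translate_pairs t (E \<omega>))} = prob {\<omega>\<in>\<Omega>. \<Phi> (E \<omega>)}"
    and "{\<omega>\<in>\<Omega>. \<Phi> (translate_pairs t (E \<omega>))} \<in> sets W"
proof -
  obtain A where A: "A \<in> sets (counting_algebra upair_borel)" "\<And>e. locally_finite_graph e \<Longrightarrow> e \<in> A \<longleftrightarrow> \<Phi> e"
    using event_representation[OF assms] by blast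
  have tE: "(\<lambda>\<omega>. translate_pairs t (E \<omega>)) \<in> measurable W (counting_algebra upair_borel)"
    using E_measurable by measurable
  have "{\<omega>\<in>\<Omega>. \<Phi> (E \<omega>)} = \<Omega> \<inter> (E -` A \<inter> space W)"
    using A graph sets.sets_into_space[OF \<Omega>_sets] by auto
  then have "prob {\<omega>\<in>\<Omega>. \<Phi> (E \<omega>)} = prob (E -` A \<inter> space W)"
    using measurable_sets[OF E_measurable A(1)] AE_\<Omega> by (intro finite_measure_eq_AE) auto
  also have "\<dots> = measure (distr W (counting_algebra upair_borel) E) A"
    by (rule measure_distr[symmetric, OF E_measurable A(1)])
  also have "\<dots> = prob ((\<lambda>\<omega>. translate_pairs t (E \<omega>)) -` A \<inter> space W)"
    unfolding stationary[symmetric, of t] by (rule measure_distr[OF tE A(1)])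
  also have eq: "{\<omega>\<in>\<Omega>. \<Phi> (translate_pairs t (E \<omega>))} = \<Omega> \<inter> ((\<lambda>\<omega>. translate_pairs t (E \<omega>)) -` A \<inter> space W)"
    using A locally_finite_graph_translate[OF graph] sets.sets_into_space[OF \<Omega>_sets] by auto
  have "prob ((\<lambda>\<omega>. translate_pairs t (E \<omega>)) -` A \<inter> space W) = prob {\<omega>\<in>\<Omega>. \<Phi> (translate_pairs t (E \<omega>))}"
    unfolding eq using measurable_sets[OF tE A(1)] AE_\<Omega> by (intro finite_measure_eq_AE) auto
  finally show "prob {\<omega>\<in>\<Omega>. \<Phi> (translate_pairs t (E \<omega>))} = prob {\<omega>\<in>\<Omega>. \<Phi> (E \<omega>)}" by simp
  show "{\<omega>\<in>\<Omega>. \<Phi> (translate_pairs t (E \<omega>))} \<in> sets W"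
    unfolding eq using measurable_sets[OF tE A(1)] by auto
qed

lemma AE_eventI:
  assumes "Measurable.pred graph_space \<Phi>" "prob {\<omega>\<in>\<Omega>. \<Phi> (E \<omega>)} = 1"
  shows "AE \<omega> in W. \<Phi> (E \<omega>)"
  using prob_eq_1[OF event_sets[OF assms(1)]] assms(2) by auto

lemma prob_eventD:
  assumes "Measurable.pred graph_space \<Phi>" "AE \<omega> in W. \<Phi> (E \<omega>)"
  shows "prob {\<omega>\<in>\<Omega>. \<Phi> (E \<omega>)} = 1"
  using prob_eq_1[OF event_sets[OF assms(1)]] assms(2) AE_\<Omega> by auto

lemma AE_infinitely_desired:
  assumes "AE \<omega> in W. infinitely_desired u (E \<omega>)"
  shows "AE \<omega> in W. infinitely_desired 0 (E \<omega>)"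
proof (rule AE_eventI[OF pred_infinitely_desired])
  have "prob {\<omega>\<in>\<Omega>. infinitely_desired 0 (E \<omega>)} = prob {\<omega>\<in>\<Omega>. infinitely_desired 0 (translate_pairs (- u) (E \<omega>))}"
    by (rule prob_translate(1)[symmetric, OF pred_infinitely_desired])
  also have "{\<omega>\<in>\<Omega>. infinitely_desired 0 (translate_pairs (- u) (E \<omega>))} = {\<omega>\<in>\<Omega>. infinitely_desired u (E \<omega>)}"
    using infinitely_desired_translate[OF counting] by auto
  finally show "prob {\<omega>\<in>\<Omega>. infinitely_desired 0 (E \<omega>)} = 1"
    using prob_eventD[OF pred_infinitely_desired assms] by simp
qed

definition Inf_block :: "int \<Rightarrow> 'w \<Rightarrow> bool" where
  "Inf_block m \<omega> \<longleftrightarrow> infinite_in_block m (E \<omega>)"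

lemma pred_gap_event:
  "Measurable.pred graph_space (\<lambda>e. infinite_in_block m e \<and> (\<forall>i\<in>I. \<not> infinite_in_block (f i) e))" for I :: "int set"
  using pred_infinite_in_block by (intro pred_intros_logic pred_intros_countable_bounded) auto

text \<open>Block \<open>m\<close> contains a point of an infinite component and the next \<open>n\<close> blocks in direction \<open>s\<close> do not.\<close>

definition gap_event :: "int \<Rightarrow> int \<Rightarrow> nat \<Rightarrow> 'w set" where
  "gap_event s m n = {\<omega>\<in>\<Omega>. Inf_block m \<omega> \<and> (\<forall>i\<in>{1..int n}. \<not> Inf_block (m + s * i) \<omega>)}"

lemma gap_event_sets [measurable]: "gap_event s m n \<in> sets W"
  unfolding gap_event_def Inf_block_def by (rule event_sets[OF pred_gap_event])

lemma prob_gap_event: "prob (gap_event s m n) = prob (gap_event s 0 n)"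
proof -
  let ?\<Phi> = "\<lambda>e. infinite_in_block 0 e \<and> (\<forall>i\<in>{1..int n}. \<not> infinite_in_block (s * i) e)"
  have "prob (gap_event s 0 n) = prob {\<omega>\<in>\<Omega>. ?\<Phi> (E \<omega>)}" by (simp add: gap_event_def Inf_block_def)
  also have "\<dots> = prob {\<omega>\<in>\<Omega>. ?\<Phi> (translate_pairs (of_int (- m)) (E \<omega>))}"
    by (rule prob_translate(1)[symmetric, OF pred_gap_event])
  also have "{\<omega>\<in>\<Omega>. ?\<Phi> (translate_pairs (of_int (- m)) (E \<omega>))} = gap_event s m n"
    unfolding gap_event_def Inf_block_def
    by (intro Collect_cong conj_cong refl)
      (simp_all only: infinite_in_block_translate[OF counting], simp_all add: add.commute)
  finally show ?thesis by simp
qed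

text \<open>Shift the \<open>n\<close>-th event so that its empty run ends at the origin. The shifted events say which is the
  last occupied block on the way to the origin in direction \<open>s\<close>, so they are disjoint.\<close>

lemma sum_gap_le_1:
  assumes s: "s \<in> {1, -1}"
  shows "(\<Sum>n<N. prob (gap_event s 0 n)) \<le> 1"
proof -
  have "(\<Sum>n<N. prob (gap_event s 0 n)) = (\<Sum>n<N. prob (gap_event s (- s * int n) n))"
    by (intro sum.cong refl prob_gap_event[symmetric])
  also have "\<dots> = prob (\<Union>n\<in>{..<N}. gap_event s (- s * int n) n)"
  proof (rule finite_measure_finite_Union[symmetric])
    have disj: "gap_event s (- s * int n) n \<inter> gap_event s (- s * int n') n' = {}" if "n < n'" for n n'
    proof -
      have "- s * int n' + s * int (n' - n) = - s * int n" using that by (simp add: algebra_simps of_nat_diff)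
      moreover have "int (n' - n) \<in> {1..int n'}" using that by auto
      ultimately have "\<not> Inf_block (- s * int n) \<omega>" if "\<omega> \<in> gap_event s (- s * int n') n'" for \<omega>
        using that unfolding gap_event_def by (metis (mono_tags, lifting) mem_Collect_eq)
      then show ?thesis by (auto simp: gap_event_def)
    qed
    show "disjoint_family_on (\<lambda>n. gap_event s (- s * int n) n) {..<N}"
      unfolding disjoint_family_on_def by (metis disj Int_commute linorder_neqE_nat)
  qed auto
  also have "\<dots> \<le> 1" by simp
  finally show ?thesis .
qed

text \<open>By Borel and Cantelli: the probability of an empty run of length \<open>m div 8\<close> after block \<open>m\<close> depends on
  \<open>m div 8\<close> only, and each value of \<open>m div 8\<close> is taken eight times.\<close>

lemma AE_no_long_gap:
  assumes s: "s \<in> {1, -1}"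
  shows "AE \<omega> in W. \<forall>\<^sub>F m in sequentially. Inf_block (s * int m) \<omega> \<longrightarrow>
    (\<exists>i\<in>{1..m div 8}. Inf_block (s * int (m + i)) \<omega>)"
proof -
  let ?a = "\<lambda>n. prob (gap_event s 0 n)"
  let ?G = "\<lambda>m. gap_event s (s * int m) (m div 8)"
  have "(\<Sum>m<N. ?a (m div 8)) \<le> 8" for N
  proof -
    have "(\<Sum>m<N. ?a (m div 8)) \<le> (\<Sum>m<N * 8. ?a (m div 8))" by (rule sum_mono2) auto
    also have "\<dots> = (\<Sum>n<N. \<Sum>m\<in>{n * 8..<n * 8 + 8}. ?a (m div 8))" by (rule sum.nat_group[symmetric])
    also have "\<dots> = (\<Sum>n<N. \<Sum>m\<in>{n * 8..<n * 8 + 8}. ?a n)"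
    proof (intro sum.cong refl arg_cong[where f = ?a])
      fix n m :: nat assume "m \<in> {n * 8..<n * 8 + 8}"
      then show "m div 8 = n" by auto
    qed
    also have "\<dots> = 8 * (\<Sum>n<N. ?a n)" by (simp add: sum_distrib_left)
    also have "\<dots> \<le> 8" using sum_gap_le_1[OF s, of N] by simp
    finally show ?thesis .
  qed
  then have "summable (\<lambda>m. ?a (m div 8))" by (intro summableI_nonneg_bounded) auto
  moreover have "(\<lambda>m. measure W (?G m)) = (\<lambda>m. ?a (m div 8))" by (intro ext prob_gap_event)
  ultimately have "summable (\<lambda>m. measure W (?G m))" by (simp only:)
  then have "AE \<omega> in W. \<forall>\<^sub>F m in sequentially. \<omega> \<in> space W - ?G m"
    by (intro borel_cantelli_AE1) (auto simp: emeasure_eq_measure)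
  then show ?thesis
    using AE_\<Omega>
  proof eventually_elim
    case (elim \<omega>)
    from elim(1) show ?case
    proof eventually_elim
      case (elim m)
      show ?case
      proof (rule impI, rule ccontr)
        assume B: "Inf_block (s * int m) \<omega>" and no: "\<not> (\<exists>i\<in>{1..m div 8}. Inf_block (s * int (m + i)) \<omega>)"
        have "\<not> Inf_block (s * int m + s * i) \<omega>" if "i \<in> {1..int (m div 8)}" for i
        proof -
          have "nat i \<in> {1..m div 8}" "s * int m + s * i = s * int (m + nat i)"
            using that by (auto simp: algebra_simps nat_le_iff)
          then show ?thesis using no by metis
        qed
        then have "\<omega> \<in> ?G m" using B \<open>\<omega> \<in> \<Omega>\<close> by (auto simp: gap_event_def)
        then show False using elim by simp
      qed
    qed
  qed
qed

text \<open>The event that some block from \<open>k\<close> onwards is occupied has the same probability for all \<open>k\<close>; as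
  \<open>k\<close> decreases it exhausts an event of probability \<open>1\<close>.\<close>

lemma AE_recurrent:
  assumes s: "s \<in> {1, -1}" and ex: "AE \<omega> in W. \<exists>x\<in>vertices (E \<omega>). infinite (component (E \<omega>) x)"
  shows "AE \<omega> in W. \<forall>N. \<exists>m\<ge>N. Inf_block (s * int m) \<omega>"
proof -
  let ?\<Phi> = "\<lambda>k e. \<exists>m::nat. infinite_in_block (s * (int m + k)) e"
  define U where "U k = {\<omega>\<in>\<Omega>. ?\<Phi> k (E \<omega>)}" for k
  have pred: "Measurable.pred graph_space (?\<Phi> k)" for k
    using pred_infinite_in_block by (intro pred_intros_countable)
  have U_sets: "U k \<in> sets W" for k unfolding U_def by (rule event_sets[OF pred])
  have const: "prob (U k) = prob (U 0)" for k
  proof -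
    have "prob (U 0) = prob {\<omega>\<in>\<Omega>. ?\<Phi> 0 (translate_pairs (of_int (- s * k)) (E \<omega>))}"
      unfolding U_def by (rule prob_translate(1)[symmetric, OF pred])
    also have "{\<omega>\<in>\<Omega>. ?\<Phi> 0 (translate_pairs (of_int (- s * k)) (E \<omega>))} = U k"
      unfolding U_def
      by (intro Collect_cong conj_cong refl)
        (simp only: infinite_in_block_translate[OF counting], simp add: algebra_simps)
    finally show ?thesis by simp
  qed
  have "(\<lambda>j. prob (U (- int j))) \<longlonglongrightarrow> prob (\<Union>j. U (- int j))"
  proof (rule finite_Lim_measure_incseq)
    show "incseq (\<lambda>j. U (- int j))"
    proof (rule incseq_SucI, rule subsetI)
      fix j \<omega> assume "\<omega> \<in> U (- int j)"
      then obtain m where "\<omega> \<in> \<Omega>" "infinite_in_block (s * (int m + - int j)) (E \<omega>)" by (auto simp: U_def)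
      moreover have "int m + - int j = int (Suc m) + - int (Suc j)" by simp
      ultimately show "\<omega> \<in> U (- int (Suc j))" unfolding U_def by (metis (mono_tags, lifting) mem_Collect_eq)
    qed
  qed (use U_sets in auto)
  moreover have "(\<lambda>j. prob (U (- int j))) = (\<lambda>j. prob (U 0))" by (intro ext const)
  ultimately have "prob (\<Union>j. U (- int j)) = prob (U 0)" by (simp only: LIMSEQ_const_iff)
  moreover have "AE \<omega> in W. \<omega> \<in> (\<Union>j. U (- int j))"
    using ex AE_\<Omega>
  proof eventually_elim
    case (elim \<omega>)
    then obtain x where x: "x \<in> vertices (E \<omega>)" "infinite (component (E \<omega>) x)" by auto
    then have "infinite_in_block \<lfloor>x\<rfloor> (E \<omega>)" unfolding infinite_in_block_def block_def
      by (intro bexI[of _ x]) auto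
    moreover have eq: "\<lfloor>x\<rfloor> = s * (int (nat (s * \<lfloor>x\<rfloor> + \<bar>\<lfloor>x\<rfloor>\<bar>)) + - int (nat \<bar>\<lfloor>x\<rfloor>\<bar>))" using s by auto
    ultimately have "\<exists>m. infinite_in_block (s * (int m + - int (nat \<bar>\<lfloor>x\<rfloor>\<bar>))) (E \<omega>)" by metis
    then have "\<omega> \<in> U (- int (nat \<bar>\<lfloor>x\<rfloor>\<bar>))" using \<open>\<omega> \<in> \<Omega>\<close> unfolding U_def by blast
    then show ?case by blast
  qed
  ultimately have "prob (U 0) = 1" using prob_eq_1[of "\<Union>j. U (- int j)"] U_sets by auto
  then have "AE \<omega> in W. \<omega> \<in> U (int N)" for N
    using const[of "int N"] prob_eq_1[OF U_sets, of "int N"] by simp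
  then have "AE \<omega> in W. \<forall>N. \<omega> \<in> U (int N)" by (simp add: AE_all_countable)
  then show ?thesis
  proof eventually_elim
    case (elim \<omega>)
    show ?case
    proof
      fix N
      obtain m where "infinite_in_block (s * (int m + int N)) (E \<omega>)" using elim[rule_format, of N] by (auto simp: U_def)
      then show "\<exists>m\<ge>N. Inf_block (s * int m) \<omega>" by (intro exI[of _ "m + N"]) (auto simp: Inf_block_def)
    qed
  qed
qed

end

text \<open>Three jumps by a factor of at most \<open>9 / 8\<close> stay below a factor of \<open>3 / 2\<close>, which leaves room for the
  rounding at both ends.\<close>

lemma three_in_dyadic:
  fixes B :: "nat \<Rightarrow> bool"
  assumes gap: "\<And>m. M \<le> m \<Longrightarrow> B m \<Longrightarrow> \<exists>i\<in>{1..m div 8}. B (m + i)"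
    and rec: "\<And>N. \<exists>m\<ge>N. B m"
  shows "\<exists>t0>0. \<forall>t\<ge>t0::real. \<exists>k l m. k < l \<and> l < m \<and> B k \<and> B l \<and> B m \<and> t + 1 \<le> k \<and> m \<le> 2 * t - 1"
proof -
  obtain p0 where p0: "p0 \<ge> M" "B p0" using rec by blast
  show ?thesis
  proof (intro exI[of _ "real p0 + 100"] conjI allI impI)
    fix t :: real assume t: "real p0 + 100 \<le> t"
    define k where "k = nat \<lceil>t\<rceil> + 1"
    have k: "t + 1 \<le> k" "k \<le> t + 2" "p0 < k" using t unfolding k_def by linarith+
    define p where "p = Max {m. p0 \<le> m \<and> m < k \<and> B m}"
    have "p \<in> {m. p0 \<le> m \<and> m < k \<and> B m}"
      unfolding p_def using p0 k(3) by (intro Max_in) auto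
    then have p: "p0 \<le> p" "p < k" "B p" by auto
    obtain i where i: "i \<in> {1..p div 8}" "B (p + i)" using gap[of p] p p0 by auto
    have "k \<le> p + i"
    proof (rule ccontr)
      assume "\<not> k \<le> p + i"
      then have "p + i \<le> p" using i p unfolding p_def by (intro Max_ge) auto
      then show False using i by auto
    qed
    moreover obtain i' where i': "i' \<in> {1..(p + i) div 8}" "B (p + i + i')"
      using gap[of "p + i"] i p p0 by auto
    moreover obtain i'' where i'': "i'' \<in> {1..(p + i + i') div 8}" "B (p + i + i' + i'')"
      using gap[of "p + i + i'"] i' p p0 by auto
    moreover have "8 * i \<le> p" "8 * i' \<le> p + i" "8 * i'' \<le> p + i + i'" using i i' i'' by auto
    then have "real (p + i + i' + i'') \<le> 2 * t - 1"
      using p(2) k t by linarith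
    moreover have "t + 1 \<le> real (p + i)" using \<open>k \<le> p + i\<close> k by linarith
    moreover have "p + i < p + i + i'" "p + i + i' < p + i + i' + i''" using i' i'' by auto
    ultimately show "\<exists>k l m. k < l \<and> l < m \<and> B k \<and> B l \<and> B m \<and> t + 1 \<le> k \<and> m \<le> 2 * t - 1"
      using i(2) by blast
  qed simp
qed

context stationary_graph
begin

lemma AE_three_points:
  assumes s: "s \<in> {1, -1}" and ex: "AE \<omega> in W. \<exists>x\<in>vertices (E \<omega>). infinite (component (E \<omega>) x)"
  shows "AE \<omega> in W. \<exists>t0>0. \<forall>t\<ge>t0::real. \<exists>S\<subseteq>{x\<in>vertices (E \<omega>). infinite (component (E \<omega>) x)}.
    card S = 3 \<and> (\<forall>c\<in>S. t < of_int s * c \<and> of_int s * c < 2 * t)"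
  using AE_no_long_gap[OF s] AE_recurrent[OF s ex]
proof eventually_elim
  case (elim \<omega>)
  define B where "B m = Inf_block (s * int m) \<omega>" for m :: nat
  let ?C = "{x\<in>vertices (E \<omega>). infinite (component (E \<omega>) x)}"
  obtain M where gap: "\<And>m. M \<le> m \<Longrightarrow> B m \<Longrightarrow> \<exists>i\<in>{1..m div 8}. B (m + i)"
    using elim(1) unfolding eventually_sequentially B_def by blast
  have rec: "\<exists>m\<ge>N. B m" for N using elim(2) unfolding B_def by blast
  obtain t0 where t0: "t0 > 0" "\<forall>t\<ge>t0. \<exists>k l m. k < l \<and> l < m \<and> B k \<and> B l \<and> B m \<and> t + 1 \<le> real k \<and> real m \<le> 2 * t - 1"
    using three_in_dyadic[of M B, OF _ rec] gap by blast
  show ?case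
  proof (intro exI[of _ t0] conjI allI impI t0(1))
    fix t assume "t0 \<le> t"
    then obtain k l m where klm: "k < l" "l < m" "B k" "B l" "B m" "t + 1 \<le> real k" "real m \<le> 2 * t - 1"
      using t0(2)[rule_format, OF \<open>t0 \<le> t\<close>] by (elim exE conjE)
    have pt: "\<exists>c\<in>?C. c \<in> block (s * int j)" if "B j" for j
      using that by (auto simp: B_def Inf_block_def infinite_in_block_def)
    obtain c1 c2 c3 where c: "c1 \<in> ?C" "c1 \<in> block (s * int k)" "c2 \<in> ?C" "c2 \<in> block (s * int l)"
      "c3 \<in> ?C" "c3 \<in> block (s * int m)" using pt klm(3-5) by meson
    have near: "real j - 1 < of_int s * c \<and> of_int s * c < real j + 1 \<and> \<lfloor>c\<rfloor> = s * int j" if "c \<in> block (s * int j)" for c j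
      using that s by (auto simp: block_def floor_eq_iff)
    have "c1 \<noteq> c2" "c2 \<noteq> c3" "c1 \<noteq> c3"
      using near[OF c(2)] near[OF c(4)] near[OF c(6)] klm(1,2) s by auto
    then have "card {c1, c2, c3} = 3" by simp
    moreover have "\<forall>c\<in>{c1, c2, c3}. t < of_int s * c \<and> of_int s * c < 2 * t"
      using near[OF c(2)] near[OF c(4)] near[OF c(6)] klm by auto
    ultimately show "\<exists>S\<subseteq>?C. card S = 3 \<and> (\<forall>c\<in>S. t < of_int s * c \<and> of_int s * c < 2 * t)"
      using c by (intro exI[of _ "{c1, c2, c3}"]) auto
  qed
qed

lemma suminf_indicator_eq: "(\<Sum>i. indicator S i :: ennreal) = emeasure (count_space UNIV) S" for S :: "nat set"
  by (simp flip: nn_integral_count_space_nat)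

text \<open>Mass transport. Let every point send mass \<open>1\<close> to the leaf of its infinite component. The mass that
  leaves block \<open>0\<close> is at most the number of its points and thus has finite mean; the mass that arrives in
  block \<open>0\<close> is infinite as soon as there is such a leaf. By stationarity the two means agree, if mass is
  counted by blocks as in \<open>T\<close>.\<close>

lemma AE_no_infinite_leaf:
  assumes unique: "\<And>\<omega> x y. \<omega> \<in> \<Omega> \<Longrightarrow> is_leaf (E \<omega>) x \<Longrightarrow> is_leaf (E \<omega>) y \<Longrightarrow> (linked (E \<omega>))\<^sup>*\<^sup>* x y \<Longrightarrow>
      infinite (component (E \<omega>) x) \<Longrightarrow> x = y"
    and N: "\<And>\<omega>. \<omega> \<in> \<Omega> \<Longrightarrow> of_nat (card (vertices (E \<omega>) \<inter> block 0)) \<le> N \<omega>" "(\<integral>\<^sup>+\<omega>. N \<omega> \<partial>W) < \<infinity>"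
  shows "AE \<omega> in W. \<forall>x\<in>vertices (E \<omega>). is_leaf (E \<omega>) x \<longrightarrow> finite (component (E \<omega>) x)"
proof -
  define T where "T m n = {\<omega>\<in>\<Omega>. infinite_leaf_block m n (E \<omega>)}" for m n
  have T_sets [measurable]: "T m n \<in> sets W" for m n
    unfolding T_def by (rule event_sets[OF pred_infinite_leaf_block])
  have shift: "prob (T m n) = prob (T (m - k) (n - k))" for m n k
  proof -
    have "prob (T m n) = prob {\<omega>\<in>\<Omega>. infinite_leaf_block m n (translate_pairs (of_int k) (E \<omega>))}"
      unfolding T_def by (rule prob_translate(1)[symmetric, OF pred_infinite_leaf_block])
    also have "{\<omega>\<in>\<Omega>. infinite_leaf_block m n (translate_pairs (of_int k) (E \<omega>))} = T (m - k) (n - k)"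
      unfolding T_def using infinite_leaf_block_translate[OF counting] by auto
    finally show ?thesis .
  qed
  have emeasure_shift: "emeasure W (T 0 (int_decode i)) = emeasure W (T (- int_decode i) 0)" for i
    using shift[of 0 "int_decode i" "int_decode i"] by (simp add: emeasure_eq_measure)
  have space: "\<omega> \<in> \<Omega> \<Longrightarrow> \<omega> \<in> space W" for \<omega> using sets.sets_into_space[OF \<Omega>_sets] by auto
  have "(\<integral>\<^sup>+\<omega>. (\<Sum>i. indicator (T 0 (int_decode i)) \<omega>) \<partial>W) = (\<Sum>i. emeasure W (T 0 (int_decode i)))"
    by (subst nn_integral_suminf) auto
  also have "\<dots> = (\<Sum>i. emeasure W (T (- int_decode i) 0))" by (simp add: emeasure_shift)
  also have "\<dots> = (\<integral>\<^sup>+\<omega>. (\<Sum>i. indicator (T (- int_decode i) 0) \<omega>) \<partial>W)"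
    by (subst nn_integral_suminf) auto
  also have "\<dots> \<le> (\<integral>\<^sup>+\<omega>. N \<omega> \<partial>W)"
  proof (rule nn_integral_mono_AE)
    show "AE \<omega> in W. (\<Sum>i. indicator (T (- int_decode i) 0) \<omega>) \<le> N \<omega>"
      using AE_\<Omega>
    proof eventually_elim
      case (elim \<omega>)
      define I where "I = {i. \<omega> \<in> T (- int_decode i) 0}"
      let ?V = "vertices (E \<omega>) \<inter> block 0"
      have "\<exists>x y. x \<in> block (- int_decode i) \<and> is_leaf (E \<omega>) x \<and> infinite (component (E \<omega>) x) \<and>
          y \<in> ?V \<and> (linked (E \<omega>))\<^sup>*\<^sup>* x y" if "i \<in> I" for i
        using that by (auto simp: I_def T_def infinite_leaf_block_def)
      then obtain x y where xy: "\<And>i. i \<in> I \<Longrightarrow> x i \<in> block (- int_decode i) \<and> is_leaf (E \<omega>) (x i) \<and>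
          infinite (component (E \<omega>) (x i)) \<and> y i \<in> ?V \<and> (linked (E \<omega>))\<^sup>*\<^sup>* (x i) (y i)" by metis
      have "inj_on y I"
      proof (rule inj_onI)
        fix i j assume ij: "i \<in> I" "j \<in> I" "y i = y j"
        have "symp (linked (E \<omega>))" using linked_sym by (auto simp: symp_def)
        then have "(linked (E \<omega>))\<^sup>*\<^sup>* (y j) (x j)" using xy[OF ij(2)] symp_rtranclp[of "linked (E \<omega>)"] by (auto dest: sympD)
        then have "(linked (E \<omega>))\<^sup>*\<^sup>* (x i) (x j)" using xy[OF ij(1)] ij(3) by auto
        then have "x i = x j" using unique[OF elim] xy[OF ij(1)] xy[OF ij(2)] by blast
        then have "int_decode i = int_decode j"
          using xy[OF ij(1)] xy[OF ij(2)] by (auto simp: block_def)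
        then show "i = j" using inj_int_decode by (simp add: inj_eq)
      qed
      moreover have "finite ?V"
        by (rule finite_subset[of _ "vertices (E \<omega>) \<inter> {0..1}"])
          (use graph[OF elim] in \<open>auto simp: locally_finite_graph_def block_def\<close>)
      moreover have "y ` I \<subseteq> ?V" using xy by auto
      ultimately have "finite I" "card I \<le> card ?V"
        using inj_on_finite card_inj_on_le by blast+
      have "(\<Sum>i. indicator (T (- int_decode i) 0) \<omega>) = (\<Sum>i. indicator I i :: ennreal)"
        by (intro suminf_cong) (auto simp: I_def indicator_def)
      also have "\<dots> = of_nat (card I)" using \<open>finite I\<close> by (simp add: suminf_indicator_eq)
      also have "\<dots> \<le> of_nat (card ?V)" using \<open>card I \<le> card ?V\<close> by simp
      also have "\<dots> \<le> N \<omega>" by (rule N(1)[OF elim])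
      finally show ?case .
    qed
  qed
  also have "\<dots> < \<infinity>" by (rule N(2))
  finally have "AE \<omega> in W. (\<Sum>i. indicator (T 0 (int_decode i)) \<omega>) \<noteq> (\<infinity> :: ennreal)"
    by (intro nn_integral_noteq_infinite) auto
  then have AE0: "AE \<omega> in W. \<forall>n. \<omega> \<notin> T 0 n"
    using AE_\<Omega>
  proof eventually_elim
    case (elim \<omega>)
    show ?case
    proof (rule ccontr)
      assume "\<not> ?thesis"
      then obtain x where x: "x \<in> vertices (E \<omega>)" "x \<in> block 0" "is_leaf (E \<omega>) x" "infinite (component (E \<omega>) x)"
        by (auto simp: T_def infinite_leaf_block_def)
      have "infinite ((\<lambda>y. \<lfloor>y\<rfloor>) ` component (E \<omega>) x)"
      proof
        assume fin: "finite ((\<lambda>y. \<lfloor>y\<rfloor>) ` component (E \<omega>) x)"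
        let ?F = "(\<lambda>y. \<lfloor>y\<rfloor>) ` component (E \<omega>) x"
        have "component (E \<omega>) x \<subseteq> (\<Union>n\<in>?F. vertices (E \<omega>) \<inter> {of_int n..of_int n + 1})"
        proof
          fix y assume y: "y \<in> component (E \<omega>) x"
          then have "y \<in> vertices (E \<omega>)" using component_subset x(1) by blast
          then show "y \<in> (\<Union>n\<in>?F. vertices (E \<omega>) \<inter> {of_int n..of_int n + 1})"
            using y by (intro UN_I[of "\<lfloor>y\<rfloor>"]) auto
        qed
        moreover have "finite (\<Union>n\<in>?F. vertices (E \<omega>) \<inter> {of_int n..of_int n + 1})"
          using graph[OF \<open>\<omega> \<in> \<Omega>\<close>] by (intro finite_UN_I fin) (simp add: locally_finite_graph_def)
        ultimately show False using x(4) finite_subset by blast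
      qed
      moreover have "\<omega> \<in> T 0 \<lfloor>y\<rfloor>" if y: "y \<in> component (E \<omega>) x" for y
      proof -
        have "y \<in> vertices (E \<omega>)" "y \<in> block \<lfloor>y\<rfloor>" using component_subset x(1) y by (auto simp: block_def)
        then show ?thesis using x y \<open>\<omega> \<in> \<Omega>\<close> unfolding T_def infinite_leaf_block_def component_def by blast
      qed
      then have "(\<lambda>y. \<lfloor>y\<rfloor>) ` component (E \<omega>) x \<subseteq> {n. \<omega> \<in> T 0 n}" by auto
      ultimately have "infinite {n. \<omega> \<in> T 0 n}" using finite_subset by blast
      moreover have "{n. \<omega> \<in> T 0 n} = int_decode ` {i. \<omega> \<in> T 0 (int_decode i)}"
        by (auto simp: image_iff) (metis int_encode_inverse)
      ultimately have inf: "infinite {i. \<omega> \<in> T 0 (int_decode i)}" by auto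
      have "(\<Sum>i. indicator (T 0 (int_decode i)) \<omega>) = (\<Sum>i. indicator {i. \<omega> \<in> T 0 (int_decode i)} i :: ennreal)"
        by (intro suminf_cong) (auto simp: indicator_def)
      also have "\<dots> = \<infinity>" using inf by (simp add: suminf_indicator_eq)
      finally show False using elim(1) by simp
    qed
  qed
  have "AE \<omega> in W. \<forall>m n. \<omega> \<notin> T m n"
  proof (subst AE_all_countable, intro allI, subst AE_all_countable, intro allI)
    fix m n
    have "AE \<omega> in W. \<omega> \<notin> T 0 (n - m)" using AE0 by auto
    then have "prob (T 0 (n - m)) = 0" by (subst prob_eq_0) auto
    then have "prob (T m n) = 0" using shift[of m n m] by simp
    then show "AE \<omega> in W. \<omega> \<notin> T m n" by (subst (asm) prob_eq_0) auto
  qed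
  then show ?thesis
    using AE_\<Omega>
  proof eventually_elim
    case (elim \<omega>)
    show ?case
    proof (intro ballI impI, rule ccontr)
      fix x assume x: "x \<in> vertices (E \<omega>)" "is_leaf (E \<omega>) x" "infinite (component (E \<omega>) x)"
      have "x \<in> block \<lfloor>x\<rfloor>" by (auto simp: block_def)
      then have "\<omega> \<in> T \<lfloor>x\<rfloor> \<lfloor>x\<rfloor>" using x elim(2) unfolding T_def infinite_leaf_block_def by blast
      then show False using elim(1) by blast
    qed
  qed
qed

end

text \<open>A shortest path between two different leaves passes its inner points on two different edges and
  therefore uses up all degrees, so it would be the whole component.\<close>

lemma (in stable_graph) unique_leaf:
  assumes le2: "\<And>x. x \<in> V \<Longrightarrow> D x \<le> 2"
    and leaf: "\<And>z w. L x z \<Longrightarrow> L x w \<Longrightarrow> z = w" "\<And>z w. L y z \<Longrightarrow> L y w \<Longrightarrow> z = w"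
    and path: "L\<^sup>*\<^sup>* x y" and inf: "infinite (comp x)"
  shows "x = y"
proof (rule ccontr)
  assume "x \<noteq> y"
  define n where "n = (LEAST n. (L ^^ n) x y)"
  have Ln: "(L ^^ n) x y" unfolding n_def using path by (auto simp: rtranclp_power intro: LeastI)
  have minimal: "n \<le> k" if "(L ^^ k) x y" for k unfolding n_def using that by (rule Least_le)
  obtain f where f: "f 0 = x" "f n = y" "\<And>i. i < n \<Longrightarrow> L (f i) (f (Suc i))"
    using Ln by (auto simp: relpowp_fun_conv)
  have "0 < n" using \<open>x \<noteq> y\<close> f by (cases n) auto
  have sub: "(L ^^ k) (f i) (f (i + k))" if "i + k \<le> n" for i k
    unfolding relpowp_fun_conv using that f by (intro exI[of _ "\<lambda>j. f (i + j)"]) auto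
  have bend: "f i \<noteq> f (i + 2)" if "i + 2 \<le> n" for i
  proof
    assume eq: "f i = f (i + 2)"
    have "(L ^^ i) x (f (i + 2))" using sub[of 0 i] that f eq by simp
    moreover have "i + 2 + (n - (i + 2)) = n" using that by simp
    then have "(L ^^ (n - (i + 2))) (f (i + 2)) y" using sub[of "i + 2" "n - (i + 2)"] f(2) by (simp only: order_refl)
    ultimately have "(L ^^ (i + (n - (i + 2)))) x y" unfolding relpowp_add by (rule relcomppI)
    then show False using minimal[of "i + (n - (i + 2))"] that by simp
  qed
  have "comp x \<subseteq> f ` {..n}"
  proof (rule comp_subset_closed)
    show "x \<in> f ` {..n}" using f(1) by (intro image_eqI[of _ _ 0]) auto
    fix z w assume "z \<in> f ` {..n}" and L: "L z w"
    then obtain i where i: "i \<le> n" "z = f i" by auto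
    consider "i = 0" | "i = n" | "0 < i" "i < n" using i by linarith
    then show "w \<in> f ` {..n}"
    proof cases
      case 1
      then have "w = f 1" using leaf(1)[of w "f 1"] L i f(1) f(3)[of 0] \<open>0 < n\<close> by simp
      then show ?thesis using \<open>0 < n\<close> by auto
    next
      case 2
      have "L y (f (n - 1))" using f(3)[of "n - 1"] f(2) \<open>0 < n\<close> L_sym by simp
      then have "w = f (n - 1)" using leaf(2)[of w "f (n - 1)"] L i 2 f(2) by simp
      then show ?thesis by auto
    next
      case 3
      have zV: "z \<in> V" using L L_vertex by auto
      have nb: "L z (f (i - 1))" "L z (f (i + 1))" "f (i - 1) \<noteq> f (i + 1)"
        using f(3)[of "i - 1"] f(3)[of i] bend[of "i - 1"] 3 i L_sym by auto
      show ?thesis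
      proof (rule ccontr)
        assume "w \<notin> f ` {..n}"
        then have "w \<noteq> f (i - 1)" "w \<noteq> f (i + 1)" using 3 by auto
        then have "card {w, f (i - 1), f (i + 1)} = 3" using nb(3) by simp
        moreover have "card {w, f (i - 1), f (i + 1)} \<le> card {y. L z y}"
          using finite_nbrs[OF zV] nb L by (intro card_mono) auto
        ultimately show False using card_nbrs[OF zV] le2[OF zV] by simp
      qed
    qed
  qed
  then show False using inf finite_subset by blast
qed

section \<open>The Poisson process\<close>

abbreviation hit_space :: "(nat \<times> int \<Rightarrow> bool) measure" where
  "hit_space \<equiv> Pi\<^sub>M UNIV (\<lambda>_. count_space UNIV)"

locale poisson_line = prob_space W for W :: "'w measure" +
  fixes P :: "'w \<Rightarrow> real measure"
  assumes poisson: "poisson_process W 1 P"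
begin

lemma P_measurable: "P \<in> measurable W (counting_algebra borel)"
  using poisson by (simp add: poisson_process_def point_process_def)

lemma P_counting: "\<omega> \<in> space W \<Longrightarrow> counting_measure borel (P \<omega>)"
  using measurable_space[OF P_measurable] counting_measure_borel by (auto simp: space_counting_algebra)

lemma count_measurable [measurable]: "B \<in> sets borel \<Longrightarrow> (\<lambda>\<omega>. emeasure (P \<omega>) B) \<in> borel_measurable W"
  by (rule measurable_compose[OF P_measurable measurable_emeasure_counting])

lemma prob_count:
  assumes "B \<in> sets borel" "bounded B"
  shows "prob {\<omega>\<in>space W. emeasure (P \<omega>) B = of_nat k} =
    measure lborel B ^ k / fact k * exp (- measure lborel B)"
  using poisson assms by (simp add: poisson_process_def)

lemma indep_counts:
  fixes B :: "nat \<Rightarrow> real set"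
  assumes "\<And>i. B i \<in> sets borel" "\<And>i. bounded (B i)" "disjoint_family B"
  shows "indep_vars (\<lambda>_. borel) (\<lambda>i \<omega>. emeasure (P \<omega>) (B i)) UNIV"
  using poisson assms by (simp add: poisson_process_def)

lemma prob_empty:
  assumes "B \<in> sets borel" "bounded B"
  shows "prob {\<omega>\<in>space W. emeasure (P \<omega>) B = 0} = exp (- measure lborel B)"
  using prob_count[OF assms, of 0] by simp

lemma prob_one:
  assumes "B \<in> sets borel" "bounded B"
  shows "prob {\<omega>\<in>space W. emeasure (P \<omega>) B = 1} = measure lborel B * exp (- measure lborel B)"
  using prob_count[OF assms, of 1] by simp

lemma AE_not_point: "AE \<omega> in W. u \<notin> point_set (P \<omega>)"
proof -
  have "AE \<omega> in W. emeasure (P \<omega>) {u} = 0"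
  proof -
    have "prob {\<omega>\<in>space W. emeasure (P \<omega>) {u} = 0} = 1" using prob_empty[of "{u}"] by simp
    then have "AE \<omega> in W. \<omega> \<in> {\<omega>\<in>space W. emeasure (P \<omega>) {u} = 0}" by (subst (asm) prob_eq_1) auto
    then show ?thesis by auto
  qed
  then show ?thesis by eventually_elim (simp add: point_set_def)
qed

lemma AE_some_empty:
  fixes B :: "nat \<Rightarrow> real set"
  assumes B: "\<And>i. B i \<in> sets borel" "\<And>i. bounded (B i)" "disjoint_family B"
    and r: "\<And>i. measure lborel (B i) = r"
  shows "AE \<omega> in W. \<exists>i. emeasure (P \<omega>) (B i) = 0"
proof -
  let ?X = "\<lambda>i \<omega>. emeasure (P \<omega>) (B i)"
  let ?N = "\<lambda>i. ?X i -` {x. x \<noteq> 0} \<inter> space W"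
  have N_sets: "?N i \<in> sets W" for i
    by (rule measurable_sets[OF count_measurable[OF B(1)]]) (simp add: Collect_neg_eq)
  have N_eq: "?N i = space W - {\<omega>\<in>space W. ?X i \<omega> = 0}" for i by auto
  have pN: "prob (?N i) = 1 - exp (- r)" for i
    unfolding N_eq using B by (subst prob_compl) (auto simp: prob_empty r)
  define A where "A = (\<Inter>i. ?N i)"
  have A_sets: "A \<in> sets W" unfolding A_def by (rule sets.countable_INT) (use N_sets in \<open>blast intro: UNIV_not_empty\<close>)+
  have "prob A \<le> (1 - exp (- r)) ^ Suc n" for n
  proof -
    have "prob A \<le> prob (\<Inter>i\<in>{..n}. ?N i)"
    proof (rule finite_measure_mono)
      show "(\<Inter>i\<in>{..n}. ?N i) \<in> sets W" by (intro sets.finite_INT N_sets) auto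
    qed (auto simp: A_def)
    also have "\<dots> = (\<Prod>i\<in>{..n}. prob (?N i))"
      by (rule indep_varsD[OF indep_counts[OF B]]) (auto simp: Collect_neg_eq)
    also have "\<dots> = (\<Prod>i\<in>{..n}. 1 - exp (- r))" by (intro prod.cong refl pN)
    also have "\<dots> = (1 - exp (- r)) ^ Suc n" by simp
    finally show ?thesis .
  qed
  moreover have "0 \<le> r" using r[of 0] measure_nonneg[of lborel "B 0"] by simp
  then have "(\<lambda>n. (1 - exp (- r)) ^ Suc n) \<longlonglongrightarrow> 0"
    by (intro LIMSEQ_Suc LIMSEQ_power_zero) auto
  ultimately have "prob A \<le> 0" by (intro LIMSEQ_le_const) auto
  then have "prob A = 0" using measure_nonneg[of W A] by linarith
  then have "AE \<omega> in W. \<omega> \<notin> A" using A_sets by (simp add: prob_eq_0)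
  then show ?thesis
    using AE_space by eventually_elim (auto simp: A_def)
qed

lemma no_points_iff:
  assumes "\<omega> \<in> space W" "B \<in> sets borel"
  shows "emeasure (P \<omega>) B = 0 \<longleftrightarrow> point_set (P \<omega>) \<inter> B = {}"
  using counting_measure.positive_iff_atom[OF P_counting[OF assms(1)] assms(2)]
  by (auto simp: zero_less_iff_neq_zero)

text \<open>Infinitely many disjoint intervals of the same length are empty independently of each other and with
  the same positive probability. The factor \<open>s\<close> selects the side of the origin.\<close>

lemma AE_gaps:
  "AE \<omega> in W. \<forall>s\<in>{1, -1}. \<forall>r K::nat. \<exists>t. real K < s * t \<and> point_set (P \<omega>) \<inter> {t..t + real r} = {}"
proof -
  have "AE \<omega> in W. \<exists>t. real K < s * t \<and> point_set (P \<omega>) \<inter> {t..t + real r} = {}"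
    if s: "s \<in> {1, -1}" for s and r K :: nat
  proof -
    define a where "a i = s * (real K + 1 + real i * (real r + 1))" for i
    have step: "real i * (real r + 1) + (real r + 1) \<le> real j * (real r + 1)" if "i < j" for i j
      using mult_right_mono[of "real (Suc i)" "real j" "real r + 1"] that by (simp add: algebra_simps)
    have sep: "a i + real r < a j \<or> a j + real r < a i" if "i \<noteq> j" for i j
      using that s step[of i j] step[of j i] by (cases i j rule: linorder_cases) (auto simp: a_def)
    have "AE \<omega> in W. \<exists>i. emeasure (P \<omega>) {a i..a i + real r} = 0"
    proof (rule AE_some_empty)
      show "disjoint_family (\<lambda>i. {a i..a i + real r})"
        unfolding disjoint_family_on_def using sep by fastforce
    qed auto
    then show ?thesis
      using AE_space
    proof eventually_elim
      case (elim \<omega>)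
      then obtain i where "point_set (P \<omega>) \<inter> {a i..a i + real r} = {}" by (auto simp: no_points_iff)
      moreover have "real K < s * a i"
        using s by (auto simp: a_def add_pos_nonneg add_nonneg_pos)
      ultimately show ?case by blast
    qed
  qed
  from this[of 1] this[of "- 1"] show ?thesis by (simp add: AE_all_countable)
qed

lemma finite_mean_count: "(\<integral>\<^sup>+\<omega>. emeasure (P \<omega>) (block 0) \<partial>W) < \<infinity>"
proof -
  let ?N = "\<lambda>\<omega>. emeasure (P \<omega>) (block 0)"
  let ?S = "\<lambda>k::nat. {\<omega>\<in>space W. ?N \<omega> = of_nat k}"
  have S_sets: "?S k \<in> sets W" for k by measurable
  have "(\<integral>\<^sup>+\<omega>. ?N \<omega> \<partial>W) \<le> (\<integral>\<^sup>+\<omega>. (\<Sum>k. of_nat k * indicator (?S k) \<omega>) \<partial>W)"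
  proof (rule nn_integral_mono)
    fix \<omega> assume \<omega>: "\<omega> \<in> space W"
    obtain k where k: "?N \<omega> = of_nat k"
      by (rule counting_measure.emeasure_bounded[OF P_counting[OF \<omega>], of "block 0"]) (auto simp: block_def)
    have "?N \<omega> = (\<Sum>j\<in>{k}. of_nat j * indicator (?S j) \<omega>)" using k \<omega> by simp
    also have "\<dots> \<le> (\<Sum>j. of_nat j * indicator (?S j) \<omega>)" by (rule sum_le_suminf) auto
    finally show "?N \<omega> \<le> (\<Sum>j. of_nat j * indicator (?S j) \<omega>)" .
  qed
  also have "\<dots> = (\<Sum>k. of_nat k * emeasure W (?S k))"
    using S_sets by (subst nn_integral_suminf) (auto simp: nn_integral_cmult)
  also have "\<dots> = (\<Sum>k. ennreal (real k * (1 / fact k * exp (- 1))))"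
  proof (rule suminf_cong)
    fix k :: nat
    have "prob (?S k) = 1 / fact k * exp (- 1)" using prob_count[of "block 0" k] by (simp add: block_def)
    then show "of_nat k * emeasure W (?S k) = ennreal (real k * (1 / fact k * exp (- 1)))"
      by (simp add: emeasure_eq_measure ennreal_of_nat_eq_real_of_nat flip: ennreal_mult')
  qed
  also have "\<dots> = ennreal (\<Sum>k. real k * (1 / fact k * exp (- 1)))"
  proof (rule suminf_ennreal2)
    have "(\<lambda>k. real (Suc k) * (1 / fact (Suc k))) = (\<lambda>k. inverse (fact k) * 1 ^ k)"
      by (rule ext) (simp add: inverse_eq_divide)
    then have "summable (\<lambda>k. real (Suc k) * (1 / fact (Suc k)))" using summable_exp[of "1::real"] by simp
    then have "summable (\<lambda>k. real k * (1 / fact k))" by (subst (asm) summable_Suc_iff)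
    then have "summable (\<lambda>k. real k * (1 / fact k) * exp (- 1))" by (rule summable_mult2)
    then show "summable (\<lambda>k. real k * (1 / fact k * exp (- 1)))" by (simp add: mult.assoc)
  qed auto
  finally show ?thesis by (auto intro: le_less_trans)
qed

lemma prob_two_le:
  assumes B: "B \<in> sets borel" "bounded B"
  shows "prob {\<omega>\<in>space W. 2 \<le> emeasure (P \<omega>) B} \<le> (measure lborel B)\<^sup>2"
proof -
  let ?l = "measure lborel B" and ?N = "\<lambda>\<omega>. emeasure (P \<omega>) B"
  let ?A = "{\<omega>\<in>space W. 2 \<le> ?N \<omega>}" and ?B = "{\<omega>\<in>space W. ?N \<omega> = 0}" and ?C = "{\<omega>\<in>space W. ?N \<omega> = 1}"
  have sets: "?A \<in> sets W" "?B \<in> sets W" "?C \<in> sets W" using B by measurable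
  have disj: "?A \<inter> ?B = {}" "(?A \<union> ?B) \<inter> ?C = {}" by auto
  have "prob ?A + prob ?B + prob ?C = prob (?A \<union> ?B) + prob ?C"
    by (simp only: finite_measure_Union[OF sets(1,2) disj(1)])
  also have "\<dots> = prob ((?A \<union> ?B) \<union> ?C)"
    by (rule finite_measure_Union[symmetric, OF _ sets(3) disj(2)]) (rule sets.Un[OF sets(1,2)])
  also have "\<dots> \<le> 1" by simp
  finally have "prob ?A \<le> 1 - (1 + ?l) * exp (- ?l)"
    by (simp add: prob_empty prob_one B algebra_simps)
  moreover have "(1 + ?l) * (1 - ?l) \<le> (1 + ?l) * exp (- ?l)"
    using exp_ge_add_one_self[of "- ?l"] by (intro mult_left_mono) auto
  ultimately show ?thesis by (simp add: algebra_simps power2_eq_square)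
qed

lemma measure_cell: "measure lborel (cell c) = 1 / 2 ^ fst c"
  by (cases c) (simp add: cell_eq add_divide_distrib)

text \<open>Among the \<open>2 * K * 2 ^ n\<close> cells of level \<open>n\<close> that cover \<open>[-K, K)\<close>, each has two points with probability
  at most \<open>(1 / 2 ^ n)\<^sup>2\<close>.\<close>

lemma AE_simple: "AE \<omega> in W. \<forall>x. emeasure (P \<omega>) {x} \<le> 1"
proof -
  have "AE \<omega> in W. \<forall>x\<in>{- real K..<real K}. emeasure (P \<omega>) {x} < 2" for K :: nat
  proof -
    define S where "S n = (\<Union>i\<in>{- int (K * 2 ^ n)..<int (K * 2 ^ n)}. {\<omega>\<in>space W. 2 \<le> emeasure (P \<omega>) (cell (n, i))})" for n
    have S_sets: "S n \<in> sets W" for n unfolding S_def by measurable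
    have "prob (S n) \<le> 2 * real K * (1 / 2) ^ n" for n
    proof -
      have "prob (S n) \<le> (\<Sum>i\<in>{- int (K * 2 ^ n)..<int (K * 2 ^ n)}. prob {\<omega>\<in>space W. 2 \<le> emeasure (P \<omega>) (cell (n, i))})"
        unfolding S_def by (rule finite_measure_subadditive_finite) auto
      also have "\<dots> \<le> (\<Sum>i\<in>{- int (K * 2 ^ n)..<int (K * 2 ^ n)}. (1 / 2 ^ n)\<^sup>2)"
        by (intro sum_mono order_trans[OF prob_two_le[OF cell_sets bounded_cell]]) (simp add: measure_cell)
      also have "\<dots> = 2 * real K * (1 / 2) ^ n"
        by (simp add: power2_eq_square power_divide field_simps)
      finally show ?thesis .
    qed
    then have "prob (\<Inter>n. S n) \<le> 2 * real K * (1 / 2) ^ n" for n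
      using finite_measure_mono[of "\<Inter>n. S n" "S n"] S_sets order_trans by blast
    moreover have "(\<lambda>n. 2 * real K * (1 / 2) ^ n) \<longlonglongrightarrow> 2 * real K * 0"
      by (intro tendsto_intros LIMSEQ_power_zero) auto
    ultimately have "prob (\<Inter>n. S n) \<le> 0" by (intro LIMSEQ_le_const[of _ 0]) auto
    then have "prob (\<Inter>n. S n) = 0" using measure_nonneg[of W "\<Inter>n. S n"] by linarith
    moreover have "(\<Inter>n. S n) \<in> sets W" using S_sets by auto
    ultimately have "AE \<omega> in W. \<omega> \<notin> (\<Inter>n. S n)" by (simp add: prob_eq_0)
    then show ?thesis
      using AE_space
    proof eventually_elim
      case (elim \<omega>)
      show ?case
      proof (rule ballI, rule ccontr)
        fix x assume x: "x \<in> {- real K..<real K}" "\<not> emeasure (P \<omega>) {x} < 2"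
        interpret counting_measure borel "P \<omega>" using P_counting elim(2) .
        have "\<omega> \<in> S n" for n
        proof -
          let ?i = "\<lfloor>2 ^ n * x\<rfloor>"
          have "2 ^ n * (- real K) \<le> 2 ^ n * x" using x(1) by (intro mult_left_mono) auto
          moreover have "2 ^ n * x < 2 ^ n * real K" using x(1) by (intro mult_strict_left_mono) auto
          ultimately have "- real (K * 2 ^ n) \<le> 2 ^ n * x" "2 ^ n * x < real (K * 2 ^ n)"
            by (simp_all add: mult.commute)
          then have "?i \<in> {- int (K * 2 ^ n)..<int (K * 2 ^ n)}"
            by (simp add: le_floor_iff floor_less_iff)
          moreover have "emeasure (P \<omega>) {x} \<le> emeasure (P \<omega>) (cell (n, ?i))"
            using mem_cell_at[of x n] sets_eq by (intro emeasure_mono) (auto simp: cell_at_def)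
          then have "2 \<le> emeasure (P \<omega>) (cell (n, ?i))" using x(2) by (simp add: not_less)
          ultimately show ?thesis using elim(2) by (auto simp: S_def)
        qed
        then show False using elim(1) by auto
      qed
    qed
  qed
  then have "AE \<omega> in W. \<forall>K::nat. \<forall>x\<in>{- real K..<real K}. emeasure (P \<omega>) {x} < 2" by (simp add: AE_all_countable)
  then show ?thesis
    using AE_space
  proof eventually_elim
    case (elim \<omega>)
    interpret counting_measure borel "P \<omega>" using P_counting elim(2) .
    show ?case
    proof
      fix x :: real
      obtain K :: nat where "\<bar>x\<bar> < K" using reals_Archimedean2[of "\<bar>x\<bar>"] by (elim exE)
      then have "x \<in> {- real K..<real K}" by auto
      then have "emeasure (P \<omega>) {x} < 2" using elim(1) by (simp only:)
      moreover obtain n where n: "emeasure (P \<omega>) {x} = of_nat n" by (rule emeasure_bounded[of "{x}"]) auto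
      ultimately have "(of_nat n :: ennreal) < of_nat 2" by simp
      then have "n < 2" by (simp only: of_nat_less_iff)
      then have "(of_nat n :: ennreal) \<le> of_nat 1" by (simp only: of_nat_le_iff)
      then show "emeasure (P \<omega>) {x} \<le> 1" by (simp add: n)
    qed
  qed
qed

section \<open>Resampling a bounded set\<close>

text \<open>All information about the points outside \<open>R\<close>: the cells that contain such points.\<close>

definition outside :: "real set \<Rightarrow> 'w \<Rightarrow> nat \<times> int \<Rightarrow> bool" where
  "outside R \<omega> = hit_cells (point_set (P \<omega>) - R)"

lemma outside_iff:
  assumes "\<omega> \<in> space W" "R \<in> sets borel"
  shows "outside R \<omega> c \<longleftrightarrow> emeasure (P \<omega>) (cell c - R) \<noteq> 0"
proof -
  have "cell c - R \<in> sets borel" using assms by auto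
  then show ?thesis
    using no_points_iff[OF assms(1), of "cell c - R"] by (auto simp: outside_def hit_cells_def)
qed

lemma outside_measurable_P:
  assumes N: "P \<in> measurable N (counting_algebra borel)" "space N = space W" and R: "R \<in> sets borel"
  shows "outside R \<in> measurable N hit_space"
proof (rule measurable_PiM_single')
  fix c
  have [measurable]: "(\<lambda>\<omega>. emeasure (P \<omega>) (cell c - R)) \<in> borel_measurable N"
    by (rule measurable_compose[OF N(1) measurable_emeasure_counting]) (use R in auto)
  have pred: "Measurable.pred N (\<lambda>\<omega>. emeasure (P \<omega>) (cell c - R) \<noteq> 0)" by measurable
  have "outside R \<omega> c = (emeasure (P \<omega>) (cell c - R) \<noteq> 0)" if "\<omega> \<in> space N" for \<omega>
    using outside_iff[OF _ R] that unfolding N(2) by blast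
  from measurable_cong[OF this] show "(\<lambda>\<omega>. outside R \<omega> c) \<in> measurable N (count_space UNIV)"
    using pred by (rule iffD2)
qed auto

lemma outside_measurable [measurable]: "R \<in> sets borel \<Longrightarrow> outside R \<in> measurable W hit_space"
  by (rule outside_measurable_P[OF P_measurable refl])

text \<open>Finitely many cells are unions of cells of a common level \<open>j\<close>. Cut by the complement of \<open>R\<close>, these are
  disjoint from each other and from the two sets in \<open>R\<close>, so that independence of the counts applies.\<close>

lemma indep_counts_outside_cylinder:
  assumes A: "A1 \<in> sets borel" "A2 \<in> sets borel" "bounded A1" "bounded A2" "A1 \<inter> A2 = {}" "A1 \<subseteq> R" "A2 \<subseteq> R"
    and R: "R \<in> sets borel" and J: "finite J"
  shows "prob ({\<omega>\<in>space W. emeasure (P \<omega>) A1 = 1 \<and> emeasure (P \<omega>) A2 = 0} \<inter> {\<omega>\<in>space W. \<forall>c\<in>J. outside R \<omega> c \<in> F c}) =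
    prob {\<omega>\<in>space W. emeasure (P \<omega>) A1 = 1 \<and> emeasure (P \<omega>) A2 = 0} * prob {\<omega>\<in>space W. \<forall>c\<in>J. outside R \<omega> c \<in> F c}"
proof -
  define j where "j = Max (insert 0 (fst ` J))"
  have j: "fst c \<le> j" if "c \<in> J" for c unfolding j_def using J that by (intro Max_ge) auto
  define B where "B n = (if n = 0 then A1 else if n = 1 then A2 else cell (j, int_decode (n - 2)) - R)" for n :: nat
  have B: "B n \<in> sets borel" "bounded (B n)" for n
    unfolding B_def using A R by (auto intro: bounded_subset[OF bounded_cell])
  have disj: "disjoint_family B"
    unfolding disjoint_family_on_def
  proof (intro ballI impI)
    fix m n :: nat assume "m \<noteq> n"
    have cells: "cell (j, int_decode a) \<inter> cell (j, int_decode b) = {}" if "a \<noteq> b" for a b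
    proof -
      have "int_decode a \<noteq> int_decode b" using that inj_int_decode by (simp add: inj_eq)
      then show ?thesis by (auto simp: cell_def)
    qed
    have "m - 2 \<noteq> n - 2" if "2 \<le> m" "2 \<le> n" using that \<open>m \<noteq> n\<close> by linarith
    then show "B m \<inter> B n = {}"
      using cells[of "m - 2" "n - 2"] A \<open>m \<noteq> n\<close> unfolding B_def by (auto split: if_splits)
  qed
  let ?X = "\<lambda>i \<omega>. emeasure (P \<omega>) (B i)"
  let ?I = "\<lambda>b. if b then {0, 1} else {2::nat..}"
  let ?M = "\<lambda>b. Pi\<^sub>M (?I b) (\<lambda>_. borel :: ennreal measure)"
  have ind: "indep_vars ?M (\<lambda>b \<omega>. restrict (\<lambda>i. ?X i \<omega>) (?I b)) UNIV"
    by (rule indep_vars_restrict[OF indep_counts[OF B disj]]) (auto simp: disjoint_family_on_def)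
  define S1 where "S1 = {f\<in>space (Pi\<^sub>M {0, 1::nat} (\<lambda>_. borel :: ennreal measure)). f 0 = 1 \<and> f 1 = 0}"
  define S2 where "S2 = {f\<in>space (Pi\<^sub>M {2::nat..} (\<lambda>_. borel :: ennreal measure)).
    \<forall>c\<in>J. (\<exists>n. cell (j, int_decode n) \<subseteq> cell c \<and> f (n + 2) \<noteq> 0) \<in> F c}"
  have S1: "S1 \<in> sets (?M True)" unfolding S1_def by simp
  have S2: "S2 \<in> sets (?M False)" unfolding S2_def using J
    by simp
  have hit: "outside R \<omega> c \<longleftrightarrow> (\<exists>n. cell (j, int_decode n) \<subseteq> cell c \<and> ?X (n + 2) \<omega> \<noteq> 0)"
    if \<omega>: "\<omega> \<in> space W" and c: "c \<in> J" for \<omega> c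
  proof -
    have Xn: "?X (n + 2) \<omega> \<noteq> 0 \<longleftrightarrow> (point_set (P \<omega>) - R) \<inter> cell (j, int_decode n) \<noteq> {}" for n
      using outside_iff[OF \<omega> R, of "(j, int_decode n)"] by (auto simp: B_def outside_def hit_cells_def)
    show ?thesis
    proof
      assume "outside R \<omega> c"
      then obtain x where x: "x \<in> point_set (P \<omega>)" "x \<notin> R" "x \<in> cell c" by (auto simp: outside_def hit_cells_def)
      have "cell (cell_at j x) \<subseteq> cell c" using cell_at_antimono[OF j[OF c], of x] cell_at_eq[OF x(3)] by simp
      moreover have "cell_at j x = (j, int_decode (int_encode \<lfloor>2 ^ j * x\<rfloor>))" by (simp add: cell_at_def)
      ultimately show "\<exists>n. cell (j, int_decode n) \<subseteq> cell c \<and> ?X (n + 2) \<omega> \<noteq> 0"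
        unfolding Xn using x mem_cell_at[of x j] by (intro exI[of _ "int_encode \<lfloor>2 ^ j * x\<rfloor>"]) auto
    next
      assume "\<exists>n. cell (j, int_decode n) \<subseteq> cell c \<and> ?X (n + 2) \<omega> \<noteq> 0"
      then show "outside R \<omega> c" unfolding Xn by (auto simp: outside_def hit_cells_def)
    qed
  qed
  have E1: "(\<lambda>\<omega>. restrict (\<lambda>i. ?X i \<omega>) (?I True)) -` S1 \<inter> space W =
      {\<omega>\<in>space W. emeasure (P \<omega>) A1 = 1 \<and> emeasure (P \<omega>) A2 = 0}"
    by (auto simp: S1_def B_def space_PiM)
  have E2: "(\<lambda>\<omega>. restrict (\<lambda>i. ?X i \<omega>) (?I False)) -` S2 \<inter> space W =
      {\<omega>\<in>space W. \<forall>c\<in>J. outside R \<omega> c \<in> F c}"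
    using hit by (auto simp: S2_def space_PiM)
  have "prob (\<Inter>b\<in>UNIV. (\<lambda>\<omega>. restrict (\<lambda>i. ?X i \<omega>) (?I b)) -` (if b then S1 else S2) \<inter> space W) =
      (\<Prod>b\<in>UNIV. prob ((\<lambda>\<omega>. restrict (\<lambda>i. ?X i \<omega>) (?I b)) -` (if b then S1 else S2) \<inter> space W))"
    by (rule indep_varsD_finite[OF ind]) (use S1 S2 in auto)
  then show ?thesis using E1 E2 by (simp add: UNIV_bool Int_commute mult.commute)
qed


lemma indep_counts_outside:
  assumes A: "A1 \<in> sets borel" "A2 \<in> sets borel" "bounded A1" "bounded A2" "A1 \<inter> A2 = {}" "A1 \<subseteq> R" "A2 \<subseteq> R"
    and R [measurable]: "R \<in> sets borel" and B: "B \<in> sets hit_space"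
  shows "prob {\<omega>\<in>space W. emeasure (P \<omega>) A1 = 1 \<and> emeasure (P \<omega>) A2 = 0 \<and> outside R \<omega> \<in> B} =
    prob {\<omega>\<in>space W. emeasure (P \<omega>) A1 = 1 \<and> emeasure (P \<omega>) A2 = 0} * prob {\<omega>\<in>space W. outside R \<omega> \<in> B}"
proof -
  define Q where "Q = {\<omega>\<in>space W. emeasure (P \<omega>) A1 = 1 \<and> emeasure (P \<omega>) A2 = 0}"
  have Q [measurable]: "Q \<in> sets W" unfolding Q_def using A by measurable
  define M1 where "M1 = distr (density W (indicator Q)) hit_space (outside R)"
  define M2 where "M2 = scale_measure (prob Q) (distr W hit_space (outside R))"
  have M1: "emeasure M1 B = emeasure W (Q \<inter> {\<omega>\<in>space W. outside R \<omega> \<in> B})" if B: "B \<in> sets hit_space" for B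
  proof -
    have pre: "outside R -` B \<inter> space W \<in> sets W" using B by measurable
    have "emeasure M1 B = emeasure (density W (indicator Q)) (outside R -` B \<inter> space W)"
      unfolding M1_def using B by (subst emeasure_distr) (auto simp: space_density)
    also have "\<dots> = emeasure W (Q \<inter> (outside R -` B \<inter> space W))"
      using pre Q by (simp add: emeasure_restricted)
    finally show ?thesis by (simp add: vimage_def Int_def conj_commute)
  qed
  have M2: "emeasure M2 B = prob Q * emeasure W {\<omega>\<in>space W. outside R \<omega> \<in> B}" if "B \<in> sets hit_space" for B
    unfolding M2_def using that by (simp add: emeasure_distr vimage_def Int_def conj_commute)
  have "M1 = M2"
  proof (rule measure_eqI_PiM_infinite[where I = UNIV and M = "\<lambda>_. count_space UNIV"])
    show "sets M1 = sets hit_space" "sets M2 = sets hit_space" by (simp_all add: M1_def M2_def)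
    show "finite_measure M1"
    proof
      have "emeasure M1 (space M1) \<le> emeasure W (space W)"
        using M1[of "space hit_space"] by (simp add: M1_def) (auto intro!: emeasure_mono)
      then show "emeasure M1 (space M1) \<noteq> \<infinity>"
        unfolding emeasure_space_1 by (metis ennreal_one_less_top infinity_ennreal_def leD)
    qed
    fix F J assume J: "finite J" "J \<subseteq> (UNIV :: (nat \<times> int) set)" "\<And>i. i \<in> J \<Longrightarrow> F i \<in> sets (count_space (UNIV :: bool set))"
    have cyl: "prod_emb UNIV (\<lambda>_. count_space UNIV) J (Pi\<^sub>E J F) \<in> sets hit_space"
      using J by (intro sets_PiM_I) auto
    have eq: "{\<omega>\<in>space W. outside R \<omega> \<in> prod_emb UNIV (\<lambda>_. count_space UNIV) J (Pi\<^sub>E J F)} =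
      {\<omega>\<in>space W. \<forall>c\<in>J. outside R \<omega> c \<in> F c}"
      by (auto simp: prod_emb_def space_PiM PiE_iff)
    show "emeasure M1 (prod_emb UNIV (\<lambda>_. count_space UNIV) J (Pi\<^sub>E J F)) = emeasure M2 (prod_emb UNIV (\<lambda>_. count_space UNIV) J (Pi\<^sub>E J F))"
      unfolding M1[OF cyl] M2[OF cyl] eq
      using indep_counts_outside_cylinder[OF A R J(1), of F]
      by (simp add: emeasure_eq_measure Q_def ennreal_mult)
  qed
  then have "prob (Q \<inter> {\<omega>\<in>space W. outside R \<omega> \<in> B}) = prob Q * prob {\<omega>\<in>space W. outside R \<omega> \<in> B}"
    using M1[OF B] M2[OF B] by (simp add: emeasure_eq_measure flip: ennreal_mult)
  moreover have "Q \<inter> {\<omega>\<in>space W. outside R \<omega> \<in> B} =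
    {\<omega>\<in>space W. emeasure (P \<omega>) A1 = 1 \<and> emeasure (P \<omega>) A2 = 0 \<and> outside R \<omega> \<in> B}" by (auto simp: Q_def)
  ultimately show ?thesis by (simp add: Q_def)
qed

lemma prob_one_zero:
  assumes A: "A1 \<in> sets borel" "A2 \<in> sets borel" "bounded A1" "bounded A2" "A1 \<inter> A2 = {}"
  shows "prob {\<omega>\<in>space W. emeasure (P \<omega>) A1 = 1 \<and> emeasure (P \<omega>) A2 = 0} =
    measure lborel A1 * exp (- measure lborel (A1 \<union> A2))"
proof -
  define B where "B n = (if n = 0 then A1 else if n = 1 then A2 else {})" for n :: nat
  have B: "B n \<in> sets borel" "bounded (B n)" for n using A by (auto simp: B_def)
  have disj: "disjoint_family B" using A by (auto simp: disjoint_family_on_def B_def)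
  have "prob (\<Inter>n\<in>{0, 1}. (\<lambda>\<omega>. emeasure (P \<omega>) (B n)) -` (if n = 0 then {1} else {0}) \<inter> space W) =
    (\<Prod>n\<in>{0, 1}. prob ((\<lambda>\<omega>. emeasure (P \<omega>) (B n)) -` (if n = 0 then {1} else {0}) \<inter> space W))"
    by (rule indep_varsD[OF indep_counts[OF B disj]]) auto
  also have "\<dots> = prob {\<omega>\<in>space W. emeasure (P \<omega>) A1 = 1} * prob {\<omega>\<in>space W. emeasure (P \<omega>) A2 = 0}"
    by (simp add: B_def vimage_def Int_def conj_commute)
  also have "(\<Inter>n\<in>{0, 1}. (\<lambda>\<omega>. emeasure (P \<omega>) (B n)) -` (if n = 0 then {1} else {0}) \<inter> space W) =
    {\<omega>\<in>space W. emeasure (P \<omega>) A1 = 1 \<and> emeasure (P \<omega>) A2 = 0}"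
    by (auto simp: B_def)
  also have "prob {\<omega>\<in>space W. emeasure (P \<omega>) A1 = 1} * prob {\<omega>\<in>space W. emeasure (P \<omega>) A2 = 0} =
    measure lborel A1 * exp (- (measure lborel A1 + measure lborel A2))"
    using A by (simp add: prob_one prob_empty exp_add[symmetric] mult.assoc)
  also have "measure lborel A1 + measure lborel A2 = measure lborel (A1 \<union> A2)"
    using A emeasure_bounded_finite by (intro measure_Union[symmetric]) (auto simp: less_top)
  finally show ?thesis .
qed

definition single_point :: "real set \<Rightarrow> 'w \<Rightarrow> real" where
  "single_point R \<omega> = (if emeasure (P \<omega>) R = 1 then THE x. x \<in> point_set (P \<omega>) \<inter> R else 0)"

lemma single_point_unique:
  assumes \<omega>: "\<omega> \<in> space W" and R: "R \<in> sets borel" and one: "emeasure (P \<omega>) R = 1"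
  shows "point_set (P \<omega>) \<inter> R = {single_point R \<omega>}"
proof -
  interpret counting_measure borel "P \<omega>" using P_counting \<omega> .
  have fin: "finite (R \<inter> point_set (P \<omega>))" using finite_points[OF R] one by simp
  have "(of_nat (card (R \<inter> point_set (P \<omega>))) :: ennreal) \<le> of_nat 1" using card_points_le[OF R] one by simp
  then have "card (R \<inter> point_set (P \<omega>)) \<le> 1" by (simp only: of_nat_le_iff)
  moreover obtain x where x: "x \<in> R" "x \<in> point_set (P \<omega>)"
    using atom_of_positive[OF R] one by (auto simp: zero_less_one)
  moreover from calculation have "\<forall>y\<in>R \<inter> point_set (P \<omega>). y = x"
    using card_le_one_iff_unique[OF fin] by blast
  ultimately have eq: "point_set (P \<omega>) \<inter> R = {x}" by blast
  then have "(THE x. x \<in> point_set (P \<omega>) \<inter> R) = x" by simp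
  then show ?thesis using eq one by (simp add: single_point_def)
qed

lemma single_point_mem_iff:
  assumes \<omega>: "\<omega> \<in> space W" and R: "R \<in> sets borel" and A: "A \<in> sets borel"
  shows "emeasure (P \<omega>) R = 1 \<and> single_point R \<omega> \<in> A \<longleftrightarrow>
    emeasure (P \<omega>) (R \<inter> A) = 1 \<and> emeasure (P \<omega>) (R - A) = 0"
proof -
  interpret counting_measure borel "P \<omega>" using P_counting \<omega> .
  have split: "emeasure (P \<omega>) R = emeasure (P \<omega>) (R \<inter> A) + emeasure (P \<omega>) (R - A)"
    using R A sets_eq by (subst plus_emeasure) (auto intro!: arg_cong[where f = "emeasure (P \<omega>)"])
  show ?thesis
  proof
    assume *: "emeasure (P \<omega>) R = 1 \<and> single_point R \<omega> \<in> A"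
    then have "point_set (P \<omega>) \<inter> R = {single_point R \<omega>}" using single_point_unique[OF \<omega> R] by simp
    then have "(point_set (P \<omega>) \<inter> R) - A = {}" using * by simp
    then have "point_set (P \<omega>) \<inter> (R - A) = {}" by (simp add: Int_Diff)
    then have "emeasure (P \<omega>) (R - A) = 0" using no_points_iff[OF \<omega>, of "R - A"] R A by auto
    then show "emeasure (P \<omega>) (R \<inter> A) = 1 \<and> emeasure (P \<omega>) (R - A) = 0" using split * by simp
  next
    assume *: "emeasure (P \<omega>) (R \<inter> A) = 1 \<and> emeasure (P \<omega>) (R - A) = 0"
    then have one: "emeasure (P \<omega>) R = 1" using split by simp
    have "point_set (P \<omega>) \<inter> (R - A) = {}" using no_points_iff[OF \<omega>, of "R - A"] R A * by auto
    then have "single_point R \<omega> \<in> A" using single_point_unique[OF \<omega> R one] by auto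
    then show "emeasure (P \<omega>) R = 1 \<and> single_point R \<omega> \<in> A" using one by simp
  qed
qed

lemma single_point_measurable_P:
  assumes N: "P \<in> measurable N (counting_algebra borel)" "space N = space W" and R [measurable]: "R \<in> sets borel"
  shows "single_point R \<in> borel_measurable N"
proof (rule measurableI)
  fix A :: "real set" assume A [measurable]: "A \<in> sets borel"
  have [measurable]: "(\<lambda>\<omega>. emeasure (P \<omega>) B) \<in> borel_measurable N" if "B \<in> sets borel" for B
    by (rule measurable_compose[OF N(1) measurable_emeasure_counting[OF that]])
  have "single_point R -` A \<inter> space N =
    {\<omega>\<in>space N. emeasure (P \<omega>) (R \<inter> A) = 1 \<and> emeasure (P \<omega>) (R - A) = 0} \<union>
    {\<omega>\<in>space N. emeasure (P \<omega>) R \<noteq> 1 \<and> 0 \<in> A}"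
    (is "?lhs = ?rhs")
  proof (rule set_eqI)
    fix \<omega>
    have "emeasure (P \<omega>) R \<noteq> 1 \<Longrightarrow> single_point R \<omega> = 0" by (simp add: single_point_def)
    then show "\<omega> \<in> ?lhs \<longleftrightarrow> \<omega> \<in> ?rhs"
      using single_point_mem_iff[OF _ R A, of \<omega>] unfolding N(2) vimage_eq Int_iff Un_iff mem_Collect_eq by metis
  qed
  also have "\<dots> \<in> sets N" by measurable
  finally show "single_point R -` A \<inter> space N \<in> sets N" .
qed simp

lemma single_point_measurable [measurable]: "R \<in> sets borel \<Longrightarrow> single_point R \<in> borel_measurable W"
  by (rule single_point_measurable_P[OF P_measurable refl])

text \<open>Given that \<open>R\<close> contains exactly one point, this point is uniform in \<open>R\<close> and independent of the points
  outside. Hence placing a point at a Lebesgue-typical site of \<open>R\<close>, whatever \<open>P\<close> does there, yields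
  nothing but what the process itself shows with positive probability.\<close>

lemma AE_resample:
  assumes R [measurable]: "R \<in> sets borel" "bounded R"
    and G: "Measurable.pred (borel \<Otimes>\<^sub>M hit_space) (\<lambda>p. G (fst p) (snd p))"
  shows "(AE \<omega> in W. emeasure (P \<omega>) R = 1 \<longrightarrow> G (single_point R \<omega>) (outside R \<omega>)) \<longleftrightarrow>
    (AE u in lborel. u \<in> R \<longrightarrow> (AE \<omega> in W. G u (outside R \<omega>)))"
proof -
  note [measurable] = R(1)
  define Q where "Q = {\<omega>\<in>space W. emeasure (P \<omega>) R = 1}"
  have Q [measurable]: "Q \<in> sets W" unfolding Q_def by measurable
  define Y where "Y \<omega> = (single_point R \<omega>, outside R \<omega>)" for \<omega>
  have Y [measurable]: "Y \<in> measurable W (borel \<Otimes>\<^sub>M hit_space)" unfolding Y_def by measurable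
  define M where "M = distr (density W (indicator Q)) (borel \<Otimes>\<^sub>M hit_space) Y"
  define c where "c = ennreal (exp (- measure lborel R))"
  define M1 where "M1 = density lborel (\<lambda>x. c * indicator R x)"
  define M2 where "M2 = distr W hit_space (outside R)"
  have finR: "emeasure lborel R < \<infinity>" using R(2) emeasure_bounded_finite by auto
  interpret M2: prob_space M2 unfolding M2_def by (rule prob_space_distr) measurable
  have M1_eq: "emeasure M1 A = c * emeasure lborel (R \<inter> A)" if A: "A \<in> sets borel" for A
    unfolding M1_def using A
    by (subst emeasure_density) (auto simp: mult.assoc indicator_inter_arith[symmetric] nn_integral_cmult)
  interpret M1: finite_measure M1
  proof
    have "emeasure M1 (space M1) = c * emeasure lborel R"
      using M1_eq[of UNIV] by (simp add: M1_def)
    then show "emeasure M1 (space M1) \<noteq> \<infinity>" using finR by (auto simp: c_def ennreal_mult_eq_top_iff)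
  qed
  interpret pair_sigma_finite M1 M2 ..
  have "M1 \<Otimes>\<^sub>M M2 = M"
  proof (rule pair_measure_eqI)
    show "sigma_finite_measure M1" "sigma_finite_measure M2" by unfold_locales
    show "sets (M1 \<Otimes>\<^sub>M M2) = sets M" unfolding M_def M1_def M2_def by (simp cong: sets_pair_measure_cong)
    fix A B assume "A \<in> sets M1" "B \<in> sets M2"
    then have A [measurable]: "A \<in> sets borel" and B [measurable]: "B \<in> sets hit_space"
      by (auto simp: M1_def M2_def)
    have pre: "Y -` (A \<times> B) \<inter> space W \<in> sets W" by (rule measurable_sets[OF Y]) measurable
    have "emeasure M (A \<times> B) = emeasure (density W (indicator Q)) (Y -` (A \<times> B) \<inter> space W)"
      unfolding M_def by (subst emeasure_distr) (auto simp: space_density)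
    also have "\<dots> = emeasure W (Q \<inter> (Y -` (A \<times> B) \<inter> space W))"
      using pre Q by (simp add: emeasure_restricted)
    also have "Q \<inter> (Y -` (A \<times> B) \<inter> space W) =
      {\<omega>\<in>space W. emeasure (P \<omega>) (R \<inter> A) = 1 \<and> emeasure (P \<omega>) (R - A) = 0 \<and> outside R \<omega> \<in> B}"
      using single_point_mem_iff[OF _ R(1) A]
      unfolding Q_def Y_def set_eq_iff vimage_eq Int_iff mem_Collect_eq mem_Times_iff fst_conv snd_conv by blast
    also have "emeasure W \<dots> = prob {\<omega>\<in>space W. emeasure (P \<omega>) (R \<inter> A) = 1 \<and> emeasure (P \<omega>) (R - A) = 0} * prob {\<omega>\<in>space W. outside R \<omega> \<in> B}"
      unfolding emeasure_eq_measure
      by (subst indep_counts_outside[where R = R]) (use R(2) in \<open>auto intro: bounded_subset\<close>)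
    also have "prob {\<omega>\<in>space W. emeasure (P \<omega>) (R \<inter> A) = 1 \<and> emeasure (P \<omega>) (R - A) = 0} =
      measure lborel (R \<inter> A) * exp (- measure lborel ((R \<inter> A) \<union> (R - A)))"
      by (rule prob_one_zero) (use R(2) in \<open>auto intro: bounded_subset\<close>)
    also have "(R \<inter> A) \<union> (R - A) = R" by auto
    finally have "emeasure M (A \<times> B) = measure lborel (R \<inter> A) * exp (- measure lborel R) * prob {\<omega>\<in>space W. outside R \<omega> \<in> B}" .
    moreover have "emeasure lborel (R \<inter> A) = measure lborel (R \<inter> A)"
      using finR emeasure_mono[of "R \<inter> A" R lborel] by (intro emeasure_eq_ennreal_measure) (auto simp: top_unique)
    then have "emeasure M1 A = c * measure lborel (R \<inter> A)" by (simp add: M1_eq)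
    moreover have "emeasure M2 B = prob {\<omega>\<in>space W. outside R \<omega> \<in> B}"
      unfolding M2_def by (simp add: emeasure_distr emeasure_eq_measure vimage_def Int_def conj_commute)
    ultimately show "emeasure M1 A * emeasure M2 B = emeasure M (A \<times> B)"
      by (simp add: c_def ennreal_mult'' ennreal_mult' mult_ac)
  qed
  have G_sets: "{p \<in> space (M1 \<Otimes>\<^sub>M M2). G (fst p) (snd p)} \<in> sets (M1 \<Otimes>\<^sub>M M2)"
  proof -
    have "sets (M1 \<Otimes>\<^sub>M M2) = sets (borel \<Otimes>\<^sub>M hit_space)"
      unfolding M1_def M2_def by (simp cong: sets_pair_measure_cong)
    then show ?thesis using G sets_eq_imp_space_eq[of "M1 \<Otimes>\<^sub>M M2" "borel \<Otimes>\<^sub>M hit_space"] by (simp add: pred_def)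
  qed
  have G_h: "{h \<in> space hit_space. G u h} \<in> sets hit_space" for u
  proof -
    have "(\<lambda>h. (u, h)) \<in> measurable hit_space (borel \<Otimes>\<^sub>M hit_space)" by measurable
    from measurable_compose[OF this G] show ?thesis by (simp add: pred_def)
  qed
  have "(AE \<omega> in W. emeasure (P \<omega>) R = 1 \<longrightarrow> G (single_point R \<omega>) (outside R \<omega>)) \<longleftrightarrow>
      (AE \<omega> in density W (indicator Q). G (fst (Y \<omega>)) (snd (Y \<omega>)))"
    by (subst AE_density) (auto simp: Q_def Y_def indicator_def intro!: AE_cong)
  also have "\<dots> \<longleftrightarrow> (AE p in M. G (fst p) (snd p))"
    unfolding M_def using G by (subst AE_distr_iff) (auto simp: pred_def)
  also have "\<dots> \<longleftrightarrow> (AE u in M1. AE h in M2. G u h)"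
    unfolding \<open>M1 \<Otimes>\<^sub>M M2 = M\<close>[symmetric] by (rule AE_pair_iff[symmetric, OF G_sets])
  also have "\<dots> \<longleftrightarrow> (AE u in M1. AE \<omega> in W. G u (outside R \<omega>))"
    unfolding M2_def using G_h by (subst AE_distr_iff) auto
  also have "\<dots> \<longleftrightarrow> (AE u in lborel. u \<in> R \<longrightarrow> (AE \<omega> in W. G u (outside R \<omega>)))"
    unfolding M1_def by (subst AE_density) (auto simp: c_def indicator_def)
  finally show ?thesis .
qed

end

section \<open>A measurable enumeration\<close>

text \<open>The same point is the first one in many cells; \<open>new_point\<close> keeps the first cell, in the enumeration of
  all cells, for every point. This gives an enumeration without repetition.\<close>

definition new_point :: "(nat \<times> int \<Rightarrow> bool) \<Rightarrow> nat \<Rightarrow> bool" where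
  "new_point h k \<longleftrightarrow> h (from_nat k) \<and>
     (\<forall>j<k. h (from_nat j) \<longrightarrow> first_point h (from_nat j) \<noteq> first_point h (from_nat k))"

primrec new_index :: "(nat \<times> int \<Rightarrow> bool) \<Rightarrow> nat \<Rightarrow> nat" where
  "new_index h 0 = (LEAST k. new_point h k)"
| "new_index h (Suc n) = (LEAST k. new_point h k \<and> new_index h n < k)"

definition enum_points :: "(nat \<times> int \<Rightarrow> bool) \<Rightarrow> nat \<Rightarrow> real" where
  "enum_points h n = first_point h (from_nat (new_index h n))"

lemma new_index_eq_enumerate:
  assumes "infinite {k. new_point h k}"
  shows "new_index h n = enumerate {k. new_point h k} n"
proof (induction n)
  case 0 then show ?case by (simp add: enumerate_0)
next
  case (Suc n)
  then show ?case using enumerate_Suc''[OF assms, of n] by simp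
qed

lemma bij_enum_points:
  assumes fin: "\<And>a b. finite (V \<inter> {a..b})" and inf: "infinite V"
  shows "bij_betw (enum_points (hit_cells V)) UNIV V"
proof -
  let ?h = "hit_cells V" and ?S = "{k. new_point (hit_cells V) k}"
  let ?f = "\<lambda>k. first_point ?h (from_nat k)"
  have finc: "finite (V \<inter> cell c)" for c
  proof -
    have "V \<inter> cell c \<subseteq> V \<inter> {of_int (snd c) / 2 ^ fst c..(of_int (snd c) + 1) / 2 ^ fst c}"
      by (cases c) (auto simp: cell_eq)
    then show ?thesis using fin finite_subset by blast
  qed
  have inj: "inj_on ?f ?S"
    by (rule inj_onI) (metis (no_types, lifting) mem_Collect_eq new_point_def linorder_neqE_nat)
  have "?f ` ?S = V"
  proof (intro equalityI subsetI)
    fix x assume "x \<in> ?f ` ?S"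
    then obtain k where "?h (from_nat k)" "x = ?f k" by (auto simp: new_point_def)
    then show "x \<in> V" using first_point_mem[OF finc, of "from_nat k"] by blast
  next
    fix x assume "x \<in> V"
    then obtain c where c: "?h c" "first_point ?h c = x" using first_point_surj[OF fin] by blast
    define k where "k = (LEAST k. ?h (from_nat k) \<and> ?f k = x)"
    have ex: "?h (from_nat (to_nat c)) \<and> ?f (to_nat c) = x" using c by simp
    then have k: "?h (from_nat k) \<and> ?f k = x" unfolding k_def by (rule LeastI)
    have "\<not> (?h (from_nat j) \<and> ?f j = x)" if "j < k" for j using not_less_Least that unfolding k_def by blast
    then have "k \<in> ?S" using k by (auto simp: new_point_def)
    then show "x \<in> ?f ` ?S" using k by auto
  qed
  with inj have bij: "bij_betw ?f ?S V" by (simp add: bij_betw_def)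
  have infS: "infinite ?S" using bij_betw_finite[OF bij] inf by simp
  have "bij_betw (?f \<circ> enumerate ?S) UNIV V" by (rule bij_betw_trans[OF bij_enumerate[OF infS] bij])
  moreover have "enum_points ?h = ?f \<circ> enumerate ?S"
    by (rule ext) (simp add: enum_points_def new_index_eq_enumerate[OF infS])
  ultimately show ?thesis by simp
qed

lemma pred_hit: "Measurable.pred hit_space (\<lambda>h. h c)"
  by (rule measurable_component_singleton) simp

lemma pred_new_point: "Measurable.pred hit_space (\<lambda>h. new_point h k)"
proof -
  have "Measurable.pred hit_space (\<lambda>h. first_point h c \<noteq> first_point h c')" for c c'
    unfolding pred_def by (intro borel_measurable_neq measurable_first_point)
  then show ?thesis
    unfolding new_point_def
    by (intro pred_intros_logic(3,4) pred_intros_countable pred_hit) simp_all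
qed

lemma measurable_new_index [measurable]: "(\<lambda>h. new_index h n) \<in> measurable hit_space (count_space UNIV)"
proof (induction n)
  case 0
  show ?case unfolding new_index.simps by (rule measurable_Least) (rule pred_new_point)
next
  case (Suc n)
  note [measurable] = Suc.IH
  show ?case unfolding new_index.simps
    by (rule measurable_Least, rule pred_intros_logic(3), rule pred_new_point) measurable
qed

lemma restrict_UNIV: "restrict f UNIV = f"
  by (simp add: restrict_def)

lemma measurable_enum_points_component: "(\<lambda>h. enum_points h n) \<in> borel_measurable hit_space"
  unfolding enum_points_def
  by (rule measurable_compose_countable[where f = "\<lambda>k h. first_point h (from_nat k)"])
    (rule measurable_first_point measurable_new_index)+

abbreviation point_space :: "(nat \<Rightarrow> real) measure" where
  "point_space \<equiv> Pi\<^sub>M UNIV (\<lambda>_. borel)"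

abbreviation mark_space :: "(nat \<Rightarrow> nat) measure" where
  "mark_space \<equiv> Pi\<^sub>M UNIV (\<lambda>_. count_space UNIV)"

lemma measurable_enum_points [measurable]: "enum_points \<in> measurable hit_space point_space"
  by (rule measurable_PiM_single') (auto simp: measurable_enum_points_component)

lemma pred_bex_countable:
  assumes "countable I" "\<And>i. i \<in> I \<Longrightarrow> Measurable.pred N (\<lambda>x. Q x i)"
  shows "Measurable.pred N (\<lambda>x. \<exists>i\<in>I. Q x i)"
  using assms unfolding pred_def by (intro sets.sets_Collect_countable_Ex') auto

lemma pred_unfilled: "Measurable.pred (point_space \<Otimes>\<^sub>M mark_space) (\<lambda>p. unfilled (fst p) (snd p))"
proof -
  let ?M = "point_space \<Otimes>\<^sub>M mark_space"
  have [measurable]: "(\<lambda>p. fst p i) \<in> borel_measurable ?M" for i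
    by (rule measurable_compose[OF measurable_fst]) measurable
  have [measurable]: "(\<lambda>p. snd p i) \<in> measurable ?M (count_space UNIV)" for i
    by (rule measurable_compose[OF measurable_snd]) measurable
  have sat: "Measurable.pred ?M (\<lambda>p. sated (fst p) (snd p) M i j)" for M i j
    unfolding sated_def by measurable
  have far: "Measurable.pred ?M (\<lambda>p. far_isolated r (fst p) I)" for r I
    unfolding far_isolated_def by measurable
  have "Measurable.pred ?M (\<lambda>p. truncated_stable r (fst p) (snd p) I M)" for r I M
    unfolding truncated_stable_def
    by (intro pred_intros_logic(3-5) pred_intros_countable_bounded sat) (simp_all; measurable)+
  note trunc = this
  show ?thesis
    unfolding unfilled_def
  proof (intro pred_intros_countable(1) pred_bex_countable countable_Collect_finite pred_intros_logic(3) far trunc)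
    show "Measurable.pred ?M (\<lambda>p. 0 \<in> I)" for I :: "nat set" by simp
    show "Measurable.pred ?M (\<lambda>p. card (M `` {0}) < snd p 0)" for M :: "(nat \<times> nat) set" by measurable
  qed
qed


section \<open>Marks\<close>

lemma pred_AE:
  assumes "sigma_finite_measure M" and G: "Measurable.pred (S \<Otimes>\<^sub>M M) (\<lambda>p. G (fst p) (snd p))"
  shows "Measurable.pred S (\<lambda>s. AE d in M. G s d)"
proof -
  interpret sigma_finite_measure M by fact
  define Q where "Q = {p \<in> space (S \<Otimes>\<^sub>M M). \<not> G (fst p) (snd p)}"
  have Q: "Q \<in> sets (S \<Otimes>\<^sub>M M)" unfolding Q_def using G by measurable
  have "(AE d in M. G s d) \<longleftrightarrow> emeasure M (Pair s -` Q) = 0" if "s \<in> space S" for s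
  proof (rule AE_iff_measurable)
    show "Pair s -` Q \<in> sets M" using sets_Pair1[OF Q] .
  qed (use that in \<open>auto simp: Q_def space_pair_measure\<close>)
  moreover have "Measurable.pred S (\<lambda>s. emeasure M (Pair s -` Q) = 0)"
    using measurable_emeasure_Pair[OF Q] by measurable
  ultimately show ?thesis by (subst measurable_cong)
qed

text \<open>\<open>PS\<close> is the space \<open>W\<close> with the \<open>\<sigma>\<close>-algebra of the point process alone, and \<open>X\<close> the enumeration of the
  points in whose order the marks are i.i.d.\<close>

locale marked_poisson = poisson_line W P for W :: "'w measure" and P +
  fixes \<mu> :: "nat pmf" and \<xi> :: "'w \<Rightarrow> real measure" and X :: "nat \<Rightarrow> 'w \<Rightarrow> real"
  fixes PS :: "'w measure"
  defines "PS \<equiv> vimage_algebra (space W) P (counting_algebra borel)"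
  assumes X_PS: "X n \<in> borel_measurable PS"
    and X_bij: "AE \<omega> in W. bij_betw (\<lambda>n. X n \<omega>) UNIV (point_set (P \<omega>))"
    and X_indep: "indep_vars (\<lambda>_. borel) (\<lambda>n \<omega>. emeasure (\<xi> \<omega>) {X n \<omega>}) UNIV"
    and X_distr: "distr W borel (\<lambda>\<omega>. emeasure (\<xi> \<omega>) {X n \<omega>}) = distr (measure_pmf \<mu>) borel of_nat"
    and PS_indep: "indep_set (sets PS)
      (sets (vimage_algebra (space W) (\<lambda>\<omega> n. emeasure (\<xi> \<omega>) {X n \<omega>}) (Pi\<^sub>M UNIV (\<lambda>_. borel))))"
begin

lemma space_PS: "space PS = space W"
  by (simp add: PS_def)

lemma P_PS: "P \<in> measurable PS (counting_algebra borel)"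
  unfolding PS_def using measurable_space[OF P_measurable] by (intro measurable_vimage_algebra1) auto

lemma sets_PS_subset:
  assumes "A \<in> sets PS"
  shows "A \<in> sets W"
proof -
  have "P \<in> space W \<rightarrow> space (counting_algebra borel)" using measurable_space[OF P_measurable] by auto
  then obtain B where "B \<in> sets (counting_algebra borel)" "A = P -` B \<inter> space W"
    using assms unfolding PS_def sets_vimage_algebra2[OF \<open>P \<in> _\<close>] by blast
  then show ?thesis using measurable_sets[OF P_measurable] by simp
qed

lemma measurable_PS_W:
  assumes f: "f \<in> measurable PS S"
  shows "f \<in> measurable W S"
proof (rule measurableI)
  show "\<omega> \<in> space W \<Longrightarrow> f \<omega> \<in> space S" for \<omega>
    using measurable_space[OF f] by (simp only: space_PS)
  show "A \<in> sets S \<Longrightarrow> f -` A \<inter> space W \<in> sets W" for A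
    using sets_PS_subset[OF measurable_sets[OF f]] by (simp only: space_PS)
qed

definition point_mark :: "'w \<Rightarrow> nat \<Rightarrow> nat" where
  "point_mark \<omega> n = mark (\<xi> \<omega>) (X n \<omega>)"

abbreviation mark_law :: "(nat \<Rightarrow> nat) measure" where
  "mark_law \<equiv> Pi\<^sub>M UNIV (\<lambda>_. measure_pmf \<mu>)"

lemma prob_space_mark_law: "prob_space mark_law"
  by (intro prob_space_PiM) (rule measure_pmf.prob_space_axioms)

lemma sets_mark_law: "sets mark_law = sets mark_space"
  by (intro sets_PiM_cong) auto

definition to_nat_mark :: "ennreal \<Rightarrow> nat" where
  "to_nat_mark x = nat \<lfloor>enn2real x\<rfloor>"

lemma to_nat_mark_measurable [measurable]: "to_nat_mark \<in> measurable borel (count_space UNIV)"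
  unfolding to_nat_mark_def by measurable

lemma point_mark_eq: "point_mark \<omega> n = to_nat_mark (emeasure (\<xi> \<omega>) {X n \<omega>})"
  by (simp add: point_mark_def mark_def to_nat_mark_def)

lemma count_at_X_measurable [measurable]: "(\<lambda>\<omega>. emeasure (\<xi> \<omega>) {X n \<omega>}) \<in> borel_measurable W"
  using X_indep by (simp add: indep_vars_def)

lemma point_mark_component [measurable]: "(\<lambda>\<omega>. point_mark \<omega> n) \<in> measurable W (count_space UNIV)"
  unfolding point_mark_eq by measurable

lemma point_mark_measurable [measurable]: "point_mark \<in> measurable W mark_space"
  by (rule measurable_PiM_single') (auto simp: point_mark_component)

lemma distr_point_mark_component: "distr W (count_space UNIV) (\<lambda>\<omega>. point_mark \<omega> n) = measure_pmf \<mu>"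
proof -
    have "distr W (count_space UNIV) (\<lambda>\<omega>. point_mark \<omega> n) = distr (distr W borel (\<lambda>\<omega>. emeasure (\<xi> \<omega>) {X n \<omega>})) (count_space UNIV) to_nat_mark"
      by (subst distr_distr) (auto simp: comp_def point_mark_eq)
    also have "\<dots> = distr (measure_pmf \<mu>) (count_space UNIV) (to_nat_mark \<circ> of_nat)"
      unfolding X_distr by (subst distr_distr) auto
    also have "to_nat_mark \<circ> of_nat = (\<lambda>n. n)"
      by (auto simp: to_nat_mark_def fun_eq_iff)
    also have "distr (measure_pmf \<mu>) (count_space UNIV) (\<lambda>n. n) = measure_pmf \<mu>"
      by (rule distr_id2) simp
    finally show ?thesis .
qed

lemma distr_point_mark: "distr W mark_space point_mark = mark_law"
proof -
  have "indep_vars (\<lambda>_. count_space UNIV) (\<lambda>n \<omega>. point_mark \<omega> n) UNIV"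
    unfolding point_mark_eq by (rule indep_vars_compose2[OF X_indep]) measurable
  then have "distr W mark_space (\<lambda>\<omega>. \<lambda>i\<in>UNIV. point_mark \<omega> i) = Pi\<^sub>M UNIV (\<lambda>i. distr W (count_space UNIV) (\<lambda>\<omega>. point_mark \<omega> i))"
    by (subst (asm) indep_vars_iff_distr_eq_PiM') auto
  then show ?thesis by (simp only: distr_point_mark_component restrict_UNIV)
qed

lemma indep_point_mark:
  assumes A: "A \<in> sets PS" and B: "B \<in> sets mark_space"
  shows "prob (A \<inter> (point_mark -` B \<inter> space W)) = prob A * prob (point_mark -` B \<inter> space W)"
proof (rule indep_setD[OF PS_indep A])
  let ?g = "\<lambda>f n. to_nat_mark (f n) :: nat"
  have "?g \<in> measurable (Pi\<^sub>M UNIV (\<lambda>_. borel)) mark_space"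
    by (rule measurable_PiM_single') (auto intro: measurable_compose[OF measurable_component_singleton])
  from measurable_sets[OF this B]
  have "(\<lambda>\<omega> n. emeasure (\<xi> \<omega>) {X n \<omega>}) -` (?g -` B \<inter> space (Pi\<^sub>M UNIV (\<lambda>_. borel))) \<inter> space W \<in>
    sets (vimage_algebra (space W) (\<lambda>\<omega> n. emeasure (\<xi> \<omega>) {X n \<omega>}) (Pi\<^sub>M UNIV (\<lambda>_. borel)))"
    by (rule in_vimage_algebra)
  also have "(\<lambda>\<omega> n. emeasure (\<xi> \<omega>) {X n \<omega>}) -` (?g -` B \<inter> space (Pi\<^sub>M UNIV (\<lambda>_. borel))) \<inter> space W = point_mark -` B \<inter> space W"
    by (auto simp: space_PiM point_mark_eq[abs_def])
  finally show "point_mark -` B \<inter> space W \<in> sets (vimage_algebra (space W) (\<lambda>\<omega> n. emeasure (\<xi> \<omega>) {X n \<omega>}) (Pi\<^sub>M UNIV (\<lambda>_. borel)))" .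
qed

lemma measurable_reindex [measurable]:
  "(\<lambda>p. \<lambda>n. snd p (snd (fst p) n)) \<in> measurable ((S \<Otimes>\<^sub>M mark_space) \<Otimes>\<^sub>M mark_space) mark_space"
proof (rule measurable_PiM_single')
  fix n
  let ?N = "(S \<Otimes>\<^sub>M mark_space) \<Otimes>\<^sub>M mark_space"
  show "(\<lambda>p. snd p (snd (fst p) n)) \<in> measurable ?N (count_space UNIV)"
  proof (rule measurable_compose_countable[where f = "\<lambda>i p. snd p i"])
    show "(\<lambda>p. snd p i) \<in> measurable ?N (count_space UNIV)" for i
      by (rule measurable_compose[OF measurable_snd measurable_component_singleton]) simp
    have "(\<lambda>p. snd (fst p)) \<in> measurable ?N mark_space" by measurable
    then show "(\<lambda>p. snd (fst p) n) \<in> measurable ?N (count_space UNIV)"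
      by (rule measurable_compose) (rule measurable_component_singleton, simp)
  qed
qed auto

text \<open>The marks of the points \<open>Y 0, Y 1, \<dots>\<close> are again i.i.d. and independent of the point process, for
  every sequence \<open>Y\<close> of different points that is determined by the point process. Indeed they arise from
  the original sequence of marks by the reindexing \<open>\<tau>\<close>; this is independent of the marks, and every
  fixed injective reindexing preserves the product measure.\<close>

lemma AE_marks_iff:
  assumes \<eta>: "\<eta> \<in> measurable PS S" and Y: "\<And>n. Y n \<in> borel_measurable PS"
    and inj: "AE \<omega> in W. inj (\<lambda>n. Y n \<omega>) \<and> range (\<lambda>n. Y n \<omega>) \<subseteq> point_set (P \<omega>)"
    and G: "Measurable.pred (S \<Otimes>\<^sub>M mark_space) (\<lambda>p. G (fst p) (snd p))"
  shows "(AE \<omega> in W. G (\<eta> \<omega>) (\<lambda>n. mark (\<xi> \<omega>) (Y n \<omega>))) \<longleftrightarrow> (AE \<omega> in W. AE d in mark_law. G (\<eta> \<omega>) d)"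
proof -
  interpret Mk: prob_space mark_law by (rule prob_space_mark_law)
  define \<tau> where "\<tau> \<omega> n = (LEAST k. X k \<omega> = Y n \<omega>)" for \<omega> n
  have X\<tau>: "AE \<omega> in W. \<forall>n. X (\<tau> \<omega> n) \<omega> = Y n \<omega>"
    using X_bij inj
  proof eventually_elim
    case (elim \<omega>)
    show ?case
    proof
      fix n
      have "Y n \<omega> \<in> range (\<lambda>k. X k \<omega>)" using elim by (auto simp: bij_betw_def)
      then obtain k where "X k \<omega> = Y n \<omega>" by auto
      then show "X (\<tau> \<omega> n) \<omega> = Y n \<omega>" unfolding \<tau>_def by (rule LeastI)
    qed
  qed
  have \<tau>_comp: "(\<lambda>\<omega>. \<tau> \<omega> n) \<in> measurable PS (count_space UNIV)" for n
    unfolding \<tau>_def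
  proof (rule measurable_Least)
    show "Measurable.pred PS (\<lambda>\<omega>. X k \<omega> = Y n \<omega>)" for k
      unfolding pred_def by (rule borel_measurable_eq[OF X_PS Y])
  qed
  have \<tau>: "\<tau> \<in> measurable PS mark_space"
    by (rule measurable_PiM_single') (auto simp: \<tau>_comp)
  let ?K = "S \<Otimes>\<^sub>M mark_space"
  let ?Z = "\<lambda>\<omega>. (\<eta> \<omega>, \<tau> \<omega>)"
  have Z_PS: "?Z \<in> measurable PS ?K" using \<eta> \<tau> by measurable
  have Z [measurable]: "?Z \<in> measurable W ?K" by (rule measurable_PS_W[OF Z_PS])
  have joint: "distr W ?K ?Z \<Otimes>\<^sub>M mark_law = distr W (?K \<Otimes>\<^sub>M mark_space) (\<lambda>\<omega>. (?Z \<omega>, point_mark \<omega>))"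
  proof (rule pair_measure_eqI)
    interpret Zl: prob_space "distr W ?K ?Z" by (rule prob_space_distr[OF Z])
    show "sigma_finite_measure (distr W ?K ?Z)" "sigma_finite_measure mark_law" by unfold_locales
    show "sets (distr W ?K ?Z \<Otimes>\<^sub>M mark_law) = sets (distr W (?K \<Otimes>\<^sub>M mark_space) (\<lambda>\<omega>. (?Z \<omega>, point_mark \<omega>)))"
      using sets_mark_law by (simp cong: sets_pair_measure_cong)
    fix A B assume "A \<in> sets (distr W ?K ?Z)" "B \<in> sets mark_law"
    then have A: "A \<in> sets ?K" and B: "B \<in> sets mark_space" using sets_mark_law by auto
    have AB: "A \<times> B \<in> sets (?K \<Otimes>\<^sub>M mark_space)" using A B by simp
    have pre: "?Z -` A \<inter> space W \<in> sets PS" using measurable_sets[OF Z_PS A] by (simp add: space_PS)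
    have ZD: "(\<lambda>\<omega>. (?Z \<omega>, point_mark \<omega>)) \<in> measurable W (?K \<Otimes>\<^sub>M mark_space)" by measurable
    have "emeasure (distr W (?K \<Otimes>\<^sub>M mark_space) (\<lambda>\<omega>. (?Z \<omega>, point_mark \<omega>))) (A \<times> B) =
        emeasure W ((\<lambda>\<omega>. (?Z \<omega>, point_mark \<omega>)) -` (A \<times> B) \<inter> space W)"
      by (rule emeasure_distr[OF ZD AB])
    also have "(\<lambda>\<omega>. (?Z \<omega>, point_mark \<omega>)) -` (A \<times> B) \<inter> space W = (?Z -` A \<inter> space W) \<inter> (point_mark -` B \<inter> space W)" by auto
    also have "emeasure W \<dots> = prob (?Z -` A \<inter> space W) * prob (point_mark -` B \<inter> space W)"
      unfolding emeasure_eq_measure indep_point_mark[OF pre B] by simp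
    also have "\<dots> = emeasure W (?Z -` A \<inter> space W) * emeasure W (point_mark -` B \<inter> space W)"
      by (simp add: emeasure_eq_measure ennreal_mult')
    also have "\<dots> = emeasure (distr W ?K ?Z) A * emeasure mark_law B"
      unfolding distr_point_mark[symmetric] emeasure_distr[OF Z A] emeasure_distr[OF point_mark_measurable B] by simp
    finally show "emeasure (distr W ?K ?Z) A * emeasure mark_law B =
      emeasure (distr W (?K \<Otimes>\<^sub>M mark_space) (\<lambda>\<omega>. (?Z \<omega>, point_mark \<omega>))) (A \<times> B)" by simp
  qed
  interpret Zl: prob_space "distr W ?K ?Z" by (rule prob_space_distr[OF Z])
  interpret ZM: pair_sigma_finite "distr W ?K ?Z" mark_law ..
  define H where "H z d \<longleftrightarrow> G (fst z) (\<lambda>n. d (snd z n))" for z :: "_ \<times> (nat \<Rightarrow> nat)" and d :: "nat \<Rightarrow> nat"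
  have H: "Measurable.pred (?K \<Otimes>\<^sub>M mark_space) (\<lambda>p. H (fst p) (snd p))"
  proof -
    have "(\<lambda>p. (fst (fst p), \<lambda>n. snd p (snd (fst p) n))) \<in> measurable (?K \<Otimes>\<^sub>M mark_space) (S \<Otimes>\<^sub>M mark_space)"
      by measurable
    from measurable_compose[OF this G] show ?thesis by (simp add: H_def)
  qed
  have sets_KM: "sets (distr W ?K ?Z \<Otimes>\<^sub>M mark_law) = sets (?K \<Otimes>\<^sub>M mark_space)"
    using sets_mark_law by (simp cong: sets_pair_measure_cong)
  have H_sets: "{p \<in> space (distr W ?K ?Z \<Otimes>\<^sub>M mark_law). H (fst p) (snd p)} \<in> sets (distr W ?K ?Z \<Otimes>\<^sub>M mark_law)"
    using H sets_eq_imp_space_eq[OF sets_KM] by (simp add: sets_KM pred_def)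
  have "(AE \<omega> in W. G (\<eta> \<omega>) (\<lambda>n. mark (\<xi> \<omega>) (Y n \<omega>))) \<longleftrightarrow> (AE \<omega> in W. H (?Z \<omega>) (point_mark \<omega>))"
  proof -
    have "AE \<omega> in W. (\<lambda>n. mark (\<xi> \<omega>) (Y n \<omega>)) = (\<lambda>n. point_mark \<omega> (\<tau> \<omega> n))"
      using X\<tau> by eventually_elim (simp add: point_mark_def)
    then have "AE \<omega> in W. G (\<eta> \<omega>) (\<lambda>n. mark (\<xi> \<omega>) (Y n \<omega>)) \<longleftrightarrow> H (?Z \<omega>) (point_mark \<omega>)"
      by eventually_elim (simp add: H_def)
    then show ?thesis by (rule eventually_subst)
  qed
  also have "\<dots> \<longleftrightarrow> (AE p in distr W (?K \<Otimes>\<^sub>M mark_space) (\<lambda>\<omega>. (?Z \<omega>, point_mark \<omega>)). H (fst p) (snd p))"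
    using H by (subst AE_distr_iff) (auto simp: pred_def)
  also have "\<dots> \<longleftrightarrow> (AE z in distr W ?K ?Z. AE d in mark_law. H z d)"
    unfolding joint[symmetric] by (rule ZM.AE_pair_iff[symmetric, OF H_sets])
  also have "\<dots> \<longleftrightarrow> (AE \<omega> in W. AE d in mark_law. H (?Z \<omega>) d)"
  proof (rule AE_distr_iff[OF Z])
    have "Measurable.pred (?K \<Otimes>\<^sub>M mark_law) (\<lambda>p. H (fst p) (snd p))"
      using H by (subst measurable_cong_sets[OF sets_pair_measure_cong[OF refl sets_mark_law] refl])
    from pred_AE[OF Mk.sigma_finite_measure_axioms this]
    show "{z \<in> space ?K. AE d in mark_law. H z d} \<in> sets ?K" by (simp add: pred_def)
  qed
  also have "\<dots> \<longleftrightarrow> (AE \<omega> in W. AE d in mark_law. G (\<eta> \<omega>) d)"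
  proof -
    have "AE \<omega> in W. (AE d in mark_law. H (?Z \<omega>) d) \<longleftrightarrow> (AE d in mark_law. G (\<eta> \<omega>) d)"
      using X\<tau> inj AE_space
    proof eventually_elim
      case (elim \<omega>)
      have X\<tau>: "X (\<tau> \<omega> n) \<omega> = Y n \<omega>" for n using elim(1) by blast
      have inj_\<tau>: "inj (\<tau> \<omega>)"
      proof (rule injI)
        fix m n assume "\<tau> \<omega> m = \<tau> \<omega> n"
        then have "Y m \<omega> = Y n \<omega>" using X\<tau> by metis
        then show "m = n" using elim(2) by (auto dest: injD)
      qed
      have "distr mark_law mark_law (\<lambda>d. \<lambda>n\<in>UNIV. d (\<tau> \<omega> n)) = mark_law"
        by (rule distr_PiM_reindex) (use inj_\<tau> in \<open>auto intro: measure_pmf.prob_space_axioms\<close>)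
      then have d: "distr mark_law mark_law (\<lambda>d n. d (\<tau> \<omega> n)) = mark_law" by (simp only: restrict_UNIV)
      have m: "(\<lambda>d n. d (\<tau> \<omega> n)) \<in> measurable mark_law mark_law"
        by (rule measurable_PiM_single') (auto intro: measurable_component_singleton simp: space_PiM)
      have \<eta>S: "\<eta> \<omega> \<in> space S" using measurable_space[OF \<eta>] elim(3) by (simp add: space_PS)
      have "(\<lambda>d. (\<eta> \<omega>, d)) \<in> measurable mark_space (S \<Otimes>\<^sub>M mark_space)" using \<eta>S by measurable
      from measurable_compose[OF this G] have "Measurable.pred mark_space (G (\<eta> \<omega>))" by simp
      then have G': "{d \<in> space mark_law. G (\<eta> \<omega>) d} \<in> sets mark_law"
        using sets_eq_imp_space_eq[OF sets_mark_law] by (simp add: sets_mark_law pred_def)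
      have "(AE d in mark_law. G (\<eta> \<omega>) d) \<longleftrightarrow> (AE d in distr mark_law mark_law (\<lambda>d n. d (\<tau> \<omega> n)). G (\<eta> \<omega>) d)"
        by (simp only: d)
      also have "\<dots> \<longleftrightarrow> (AE d in mark_law. G (\<eta> \<omega>) (\<lambda>n. d (\<tau> \<omega> n)))"
        by (rule AE_distr_iff[OF m G'])
      finally show ?case by (simp add: H_def)
    qed
    then show ?thesis by (rule eventually_subst)
  qed
  finally show ?thesis .
qed

end

section \<open>Absence of ties\<close>

text \<open>A countable family of regions that is rich enough to cut any finite set out of a locally finite one.\<close>

definition rat_union :: "(rat \<times> rat) list \<Rightarrow> real set" where
  "rat_union l = (\<Union>p\<in>set l. {of_rat (fst p)<..<of_rat (snd p)})"

lemma rat_union_borel [measurable]: "rat_union l \<in> sets borel"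
  unfolding rat_union_def by (intro borel_open open_UN) auto

lemma bounded_rat_union: "bounded (rat_union l)"
  unfolding rat_union_def by (intro bounded_UN) auto

lemma isolating_rat_union:
  assumes fin: "\<And>a b. finite (V \<inter> {a..b})" and "finite A"
  shows "\<exists>l. A \<subseteq> rat_union l \<and> V \<inter> rat_union l \<subseteq> A"
  using \<open>finite A\<close>
proof (induction A)
  case empty
  show ?case by (intro exI[of _ "[]"]) (simp add: rat_union_def)
next
  case (insert x A)
  then obtain l where l: "A \<subseteq> rat_union l" "V \<inter> rat_union l \<subseteq> A" by blast
  let ?F = "V \<inter> {x - 1..x + 1} - {x}"
  have "\<exists>e>0. \<forall>y\<in>?F. e \<le> dist x y" using finite_set_avoid[of ?F x] fin by auto
  then obtain e where e: "0 < e" "\<And>y. y \<in> ?F \<Longrightarrow> e \<le> \<bar>x - y\<bar>" by (auto simp: dist_real_def)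
  obtain a where a: "x - min e 1 < of_rat a" "of_rat a < x" using of_rat_dense[of "x - min e 1" x] e by auto
  obtain b where b: "x < of_rat b" "of_rat b < x + min e 1" using of_rat_dense[of x "x + min e 1"] e by auto
  have "y = x" if y: "y \<in> V" "of_rat a < y" "y < of_rat b" for y
  proof (rule ccontr)
    assume "y \<noteq> x"
    then have "y \<in> ?F" using y a b by auto
    then have "e \<le> \<bar>x - y\<bar>" by (rule e(2))
    then show False using y a b by linarith
  qed
  then show ?case
    using l a b by (intro exI[of _ "(a, b) # l"]) (auto simp: rat_union_def)
qed

context poisson_line
begin

lemma finite_points_window: "\<omega> \<in> space W \<Longrightarrow> finite (point_set (P \<omega>) \<inter> {a..b})"
  using counting_measure.finite_points_bounded[OF P_counting, of \<omega> "{a..b}"] by (simp add: Int_commute)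

lemma finite_points_bounded: "\<omega> \<in> space W \<Longrightarrow> R \<in> sets borel \<Longrightarrow> bounded R \<Longrightarrow> finite (point_set (P \<omega>) \<inter> R)"
  using counting_measure.finite_points_bounded[OF P_counting, of \<omega> R] by (simp add: Int_commute)

text \<open>A tie makes some point \<open>x\<close> the midpoint of two others. Resample the only point of a small set around
  \<open>x\<close>: given the points outside, there are only countably many midpoints to avoid.\<close>

lemma AE_no_ties:
  "AE \<omega> in W. \<forall>x\<in>point_set (P \<omega>). \<forall>w\<in>point_set (P \<omega>). \<forall>z\<in>point_set (P \<omega>).
     w \<noteq> x \<longrightarrow> z \<noteq> x \<longrightarrow> \<bar>x - w\<bar> = \<bar>x - z\<bar> \<longrightarrow> w = z"
proof -
  define G where "G u h \<longleftrightarrow> (\<forall>c c'. u \<noteq> (first_point h c + first_point h c') / 2)" for u h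
  have G: "Measurable.pred (borel \<Otimes>\<^sub>M hit_space) (\<lambda>p. G (fst p) (snd p))"
  proof -
    have [measurable]: "(\<lambda>p. first_point (snd p) c) \<in> borel_measurable (borel \<Otimes>\<^sub>M hit_space)" for c
      by (rule measurable_compose[OF measurable_snd measurable_first_point])
    show ?thesis unfolding G_def by measurable
  qed
  have resample: "AE \<omega> in W. emeasure (P \<omega>) R = 1 \<longrightarrow> G (single_point R \<omega>) (outside R \<omega>)"
    if R: "R \<in> sets borel" "bounded R" for R
  proof (subst AE_resample[OF R G])
    interpret L: pair_sigma_finite lborel W ..
    have "AE u in lborel. G u (outside R \<omega>)" for \<omega>
    proof -
      let ?C = "(\<lambda>(c, c'). (first_point (outside R \<omega>) c + first_point (outside R \<omega>) c') / 2) ` UNIV"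
      have "?C \<in> null_sets lborel" by (rule countable_imp_null_set_lborel) simp
      then have "AE u in lborel. u \<notin> ?C" by (rule AE_not_in)
      then show ?thesis by eventually_elim (auto simp: G_def image_iff)
    qed
    then have "AE \<omega> in W. AE u in lborel. G u (outside R \<omega>)" by simp
    moreover have "{p \<in> space (lborel \<Otimes>\<^sub>M W). G (fst p) (outside R (snd p))} \<in> sets (lborel \<Otimes>\<^sub>M W)"
    proof -
      have "(\<lambda>p. (fst p, outside R (snd p))) \<in> measurable (lborel \<Otimes>\<^sub>M W) (borel \<Otimes>\<^sub>M hit_space)"
        using outside_measurable[OF R(1)] by measurable
      from measurable_compose[OF this G] show ?thesis by (simp add: pred_def)
    qed
    ultimately have "AE u in lborel. AE \<omega> in W. G u (outside R \<omega>)" by (subst L.AE_commute)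
    then show "AE u in lborel. u \<in> R \<longrightarrow> (AE \<omega> in W. G u (outside R \<omega>))" by eventually_elim simp
  qed
  then have "AE \<omega> in W. \<forall>l. emeasure (P \<omega>) (rat_union l) = 1 \<longrightarrow> G (single_point (rat_union l) \<omega>) (outside (rat_union l) \<omega>)"
    using bounded_rat_union by (auto simp: AE_all_countable)
  then show ?thesis
    using AE_simple AE_space
  proof eventually_elim
    case (elim \<omega>)
    interpret counting_measure borel "P \<omega>" using P_counting elim(3) .
    let ?V = "point_set (P \<omega>)"
    show ?case
    proof (intro ballI impI, rule ccontr)
      fix x w z assume V: "x \<in> ?V" "w \<in> ?V" "z \<in> ?V" and "w \<noteq> x" "z \<noteq> x" "\<bar>x - w\<bar> = \<bar>x - z\<bar>" "w \<noteq> z"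
      then have mid: "x = (w + z) / 2" by (auto simp: abs_if split: if_splits)
      obtain l where l: "{x} \<subseteq> rat_union l" "?V \<inter> rat_union l \<subseteq> {x}"
        using isolating_rat_union[of ?V "{x}"] finite_points_window[OF elim(3)] by blast
      let ?R = "rat_union l"
      have R: "?V \<inter> ?R = {x}" using l V by blast
      have "emeasure (P \<omega>) ?R = of_nat (card (?R \<inter> ?V))"
        by (rule emeasure_eq_card) (use R elim(2) in \<open>auto simp: Int_commute\<close>)
      then have one: "emeasure (P \<omega>) ?R = 1" using R by (simp add: Int_commute)
      then have "single_point ?R \<omega> = x" using single_point_unique[OF elim(3) rat_union_borel one] R by simp
      then have g: "G x (outside ?R \<omega>)" using elim(1) one by metis
      have win: "finite ((?V - ?R) \<inter> {a..b})" for a b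
        by (rule finite_subset[OF _ finite_points_window[OF elim(3), of a b]]) auto
      have "w \<in> ?V - ?R" "z \<in> ?V - ?R" using R V \<open>w \<noteq> x\<close> \<open>z \<noteq> x\<close> by auto
      then obtain c c' where "first_point (outside ?R \<omega>) c = w" "first_point (outside ?R \<omega>) c' = z"
        using first_point_surj[of "?V - ?R", OF win] unfolding outside_def by metis
      then show False using g mid unfolding G_def by metis
    qed
  qed
qed

end

section \<open>Inserting a point\<close>

lemma bij_betw_case_nat:
  assumes "bij_betw Z UNIV A" "u \<notin> A"
  shows "bij_betw (case_nat u Z) UNIV (insert u A)"
proof -
  have Z: "Z n \<in> A" "Z m = Z n \<longleftrightarrow> m = n" "x \<in> A \<Longrightarrow> \<exists>n. x = Z n" for m n x
    using assms(1) by (auto simp: bij_betw_def inj_eq)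
  show ?thesis
    unfolding bij_betw_def
  proof
    show "inj (case_nat u Z)"
    proof (rule injI)
      fix m n assume "case_nat u Z m = case_nat u Z n"
      then show "m = n" using Z assms(2) by (cases m; cases n) auto
    qed
    show "range (case_nat u Z) = insert u A"
    proof (intro equalityI subsetI)
      fix x assume "x \<in> range (case_nat u Z)"
      then show "x \<in> insert u A" using Z(1) by (auto split: nat.splits)
    next
      fix x assume "x \<in> insert u A"
      then consider "x = u" | n where "x = Z n" using Z(3) by blast
      then show "x \<in> range (case_nat u Z)"
        by cases (auto intro: rev_image_eqI[of 0] rev_image_eqI[of "Suc _"])
    qed
  qed
qed

context marked_poisson
begin

lemma AE_infinite_points: "AE \<omega> in W. infinite (point_set (P \<omega>))"
  using X_bij by eventually_elim (metis bij_betw_finite infinite_UNIV_nat)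

lemma outside_enum:
  assumes "\<omega> \<in> space W" "infinite (point_set (P \<omega>))" "R \<in> sets borel" "bounded R"
  shows "bij_betw (enum_points (outside R \<omega>)) UNIV (point_set (P \<omega>) - R)"
  unfolding outside_def
proof (rule bij_enum_points)
  show "finite ((point_set (P \<omega>) - R) \<inter> {a..b})" for a b
    by (rule finite_subset[OF _ finite_points_window[OF assms(1), of a b]]) auto
  have "point_set (P \<omega>) \<subseteq> (point_set (P \<omega>) - R) \<union> (point_set (P \<omega>) \<inter> R)" by auto
  then show "infinite (point_set (P \<omega>) - R)"
    using finite_points_bounded[OF assms(1,3,4)] assms(2) by (meson finite_UnI finite_subset)
qed

text \<open>The configuration with index \<open>0\<close> for a point at \<open>u\<close>, followed by the points that are coded in \<open>h\<close>.\<close>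

definition config :: "real \<Rightarrow> (nat \<times> int \<Rightarrow> bool) \<Rightarrow> nat \<Rightarrow> real" where
  "config u h = case_nat u (enum_points h)"

lemma config_measurable: "(\<lambda>p. config (fst p) (snd p)) \<in> measurable (borel \<Otimes>\<^sub>M hit_space) point_space"
proof (rule measurable_PiM_single')
  fix n
  show "(\<lambda>p. config (fst p) (snd p) n) \<in> borel_measurable (borel \<Otimes>\<^sub>M hit_space)"
    by (cases n) (simp_all add: config_def measurable_compose[OF measurable_snd measurable_enum_points_component])
qed auto

lemma case_nat_measurable: "case_nat k \<in> measurable mark_space mark_space" for k :: nat
proof (rule measurable_PiM_single')
  fix n
  show "(\<lambda>d. case_nat k d n) \<in> measurable mark_space (count_space UNIV)"
    by (cases n) (simp_all add: measurable_component_singleton)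
qed auto

text \<open>Absolute continuity: an almost sure property of the marked points survives the deletion of all points
  in \<open>R\<close> and the insertion of a point at almost any \<open>u \<in> R\<close> with any possible mark \<open>k\<close>. Since the property is
  known for every enumeration of the points, on the event that \<open>R\<close> contains one point it may be applied to
  the enumeration that starts with this point and continues outside \<open>R\<close>. The marks of this enumeration are
  i.i.d. and independent of all positions, so they can be integrated out; then the position of the first
  point and the points outside can be separated, and finally the mark of the first point is fixed.\<close>

lemma AE_not_unfilled_insert:
  assumes stable: "AE \<omega> in W. \<forall>y. bij_betw y UNIV (point_set (P \<omega>)) \<longrightarrow> \<not> unfilled y (\<lambda>n. mark (\<xi> \<omega>) (y n))"
    and R: "R \<in> sets borel" "bounded R"
  shows "AE u in lborel. u \<in> R \<longrightarrow> (\<forall>k\<in>set_pmf \<mu>. AE \<omega> in W.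
    \<not> unfilled (case_nat u (enum_points (outside R \<omega>))) (case_nat k (\<lambda>n. mark (\<xi> \<omega>) (enum_points (outside R \<omega>) n))))"
proof -
  interpret Mk: prob_space mark_law by (rule prob_space_mark_law)
  note out_PS = outside_measurable_P[OF P_PS space_PS R(1)]
  note sp_PS = single_point_measurable_P[OF P_PS space_PS R(1)]
  let ?S = "borel \<Otimes>\<^sub>M hit_space"
  have unf: "Measurable.pred (?S \<Otimes>\<^sub>M mark_space) (\<lambda>p. \<not> unfilled (config (fst (fst p)) (snd (fst p))) (snd p))"
  proof -
    have "(\<lambda>p. (config (fst (fst p)) (snd (fst p)), snd p)) \<in> measurable (?S \<Otimes>\<^sub>M mark_space) (point_space \<Otimes>\<^sub>M mark_space)"
      using measurable_compose[OF measurable_fst config_measurable] by measurable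
    from measurable_compose[OF this pred_unfilled] show ?thesis by simp
  qed
  let ?one = "\<lambda>\<omega>. emeasure (P \<omega>) R = 1"
  let ?S' = "count_space UNIV \<Otimes>\<^sub>M ?S"
  define \<eta> where "\<eta> \<omega> = (?one \<omega>, single_point R \<omega>, outside R \<omega>)" for \<omega>
  \<comment> \<open>Off the event of interest, \<open>X\<close> provides some sequence of different points.\<close>
  define Y where "Y n \<omega> = (if ?one \<omega> then config (single_point R \<omega>) (outside R \<omega>) n else X n \<omega>)" for n \<omega>
  have [measurable]: "(\<lambda>\<omega>. emeasure (P \<omega>) R) \<in> borel_measurable PS"
    by (rule measurable_compose[OF P_PS measurable_emeasure_counting[OF R(1)]])
  have one_PS: "Measurable.pred PS ?one" by measurable
  have \<eta>: "\<eta> \<in> measurable PS ?S'"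
    unfolding \<eta>_def using one_PS sp_PS out_PS by (intro measurable_Pair) auto
  have Y: "Y n \<in> borel_measurable PS" for n
  proof -
    have "(\<lambda>\<omega>. (single_point R \<omega>, outside R \<omega>)) \<in> measurable PS ?S" using sp_PS out_PS by (intro measurable_Pair)
    from measurable_compose[OF this config_measurable]
    have "(\<lambda>\<omega>. config (single_point R \<omega>) (outside R \<omega>)) \<in> measurable PS point_space" by simp
    from measurable_compose[OF this measurable_component_singleton]
    have "(\<lambda>\<omega>. config (single_point R \<omega>) (outside R \<omega>) n) \<in> borel_measurable PS" by simp
    then show ?thesis unfolding Y_def using one_PS X_PS by (intro measurable_If) auto
  qed
  have Y_bij: "AE \<omega> in W. bij_betw (\<lambda>n. Y n \<omega>) UNIV (point_set (P \<omega>))"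
    using X_bij AE_infinite_points AE_space
  proof eventually_elim
    case (elim \<omega>)
    show ?case
    proof (cases "?one \<omega>")
      case True
      have "point_set (P \<omega>) \<inter> R = {single_point R \<omega>}" by (rule single_point_unique[OF elim(3) R(1) True])
      then have "point_set (P \<omega>) = insert (single_point R \<omega>) (point_set (P \<omega>) - R)"
        "single_point R \<omega> \<notin> point_set (P \<omega>) - R" by auto
      then have "bij_betw (config (single_point R \<omega>) (outside R \<omega>)) UNIV (point_set (P \<omega>))"
        unfolding config_def using bij_betw_case_nat[OF outside_enum[OF elim(3,2) R]] by metis
      moreover have "(\<lambda>n. Y n \<omega>) = config (single_point R \<omega>) (outside R \<omega>)" using True by (simp add: Y_def)
      ultimately show ?thesis by simp
    next
      case False
      then show ?thesis using elim(1) by (simp add: Y_def)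
    qed
  qed
  define G where "G s d \<longleftrightarrow> (fst s \<longrightarrow> \<not> unfilled (config (fst (snd s)) (snd (snd s))) d)"
    for s :: "bool \<times> real \<times> (nat \<times> int \<Rightarrow> bool)" and d :: "nat \<Rightarrow> nat"
  have G: "Measurable.pred (?S' \<Otimes>\<^sub>M mark_space) (\<lambda>p. G (fst p) (snd p))"
  proof -
    have "(\<lambda>p. (snd (fst p), snd p)) \<in> measurable (?S' \<Otimes>\<^sub>M mark_space) (?S \<Otimes>\<^sub>M mark_space)" by measurable
    from measurable_compose[OF this unf]
    have "Measurable.pred (?S' \<Otimes>\<^sub>M mark_space) (\<lambda>p. \<not> unfilled (config (fst (snd (fst p))) (snd (snd (fst p)))) (snd p))" by simp
    moreover have "Measurable.pred (?S' \<Otimes>\<^sub>M mark_space) (\<lambda>p. fst (fst p))" by measurable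
    ultimately show ?thesis unfolding G_def by (intro pred_intros_logic(4))
  qed
  have "AE \<omega> in W. G (\<eta> \<omega>) (\<lambda>n. mark (\<xi> \<omega>) (Y n \<omega>))"
    using stable Y_bij
  proof eventually_elim
    case (elim \<omega>)
    show ?case
      unfolding G_def
    proof
      assume "fst (\<eta> \<omega>)"
      then have "(\<lambda>n. Y n \<omega>) = config (fst (snd (\<eta> \<omega>))) (snd (snd (\<eta> \<omega>)))" by (simp add: \<eta>_def Y_def)
      then show "\<not> unfilled (config (fst (snd (\<eta> \<omega>))) (snd (snd (\<eta> \<omega>)))) (\<lambda>n. mark (\<xi> \<omega>) (Y n \<omega>))"
        using elim(1)[rule_format, OF elim(2)] by simp
    qed
  qed
  moreover have Y_inj: "AE \<omega> in W. inj (\<lambda>n. Y n \<omega>) \<and> range (\<lambda>n. Y n \<omega>) \<subseteq> point_set (P \<omega>)"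
    using Y_bij by eventually_elim (simp add: bij_betw_def)
  ultimately have "AE \<omega> in W. AE d in mark_law. G (\<eta> \<omega>) d"
    by (simp only: AE_marks_iff[where Y = Y and G = G, OF \<eta> Y Y_inj G])
  then have "AE \<omega> in W. ?one \<omega> \<longrightarrow> (AE d in mark_law. \<not> unfilled (config (single_point R \<omega>) (outside R \<omega>)) d)"
    by eventually_elim (simp add: G_def \<eta>_def)
  moreover have "Measurable.pred ?S (\<lambda>p. AE d in mark_law. \<not> unfilled (config (fst p) (snd p)) d)"
  proof (rule pred_AE[OF Mk.sigma_finite_measure_axioms])
    show "Measurable.pred (?S \<Otimes>\<^sub>M mark_law) (\<lambda>p. \<not> unfilled (config (fst (fst p)) (snd (fst p))) (snd p))"
      using unf by (subst measurable_cong_sets[OF sets_pair_measure_cong[OF refl sets_mark_law] refl])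
  qed
  ultimately have "AE u in lborel. u \<in> R \<longrightarrow> (AE \<omega> in W. AE d in mark_law. \<not> unfilled (config u (outside R \<omega>)) d)"
    using AE_resample[OF R, of "\<lambda>u h. AE d in mark_law. \<not> unfilled (config u h) d"] by blast
  then show ?thesis
  proof eventually_elim
    case (elim u)
    show ?case
    proof (intro impI ballI)
      fix k assume "u \<in> R" and k: "k \<in> set_pmf \<mu>"
      interpret Sq: sequence_space "measure_pmf \<mu>" ..
      have Sq: "distr (measure_pmf \<mu> \<Otimes>\<^sub>M mark_law) mark_law (\<lambda>(s, d). case_nat s d) = mark_law" by (rule Sq.PiM_iter)
      interpret PMk: pair_sigma_finite "measure_pmf \<mu>" mark_law ..
      have first: "AE d in mark_law. \<Phi> (case_nat k d)" if "AE d in mark_law. \<Phi> d" for \<Phi>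
      proof -
        have "AE d in distr (measure_pmf \<mu> \<Otimes>\<^sub>M mark_law) mark_law (\<lambda>(s, d). case_nat s d). \<Phi> d"
          unfolding Sq by (rule that)
        then have "AE p in measure_pmf \<mu> \<Otimes>\<^sub>M mark_law. \<Phi> ((\<lambda>(s, d). case_nat s d) p)"
          by (rule AE_distrD[rotated]) measurable
        then have "AE s in measure_pmf \<mu>. AE d in mark_law. \<Phi> ((\<lambda>(s, d). case_nat s d) (s, d))"
          by (rule PMk.AE_pair)
        then show ?thesis using k by (simp add: AE_measure_pmf_iff)
      qed
      have "AE \<omega> in W. AE d in mark_law. \<not> unfilled (config u (outside R \<omega>)) d" using elim \<open>u \<in> R\<close> by blast
      then have "AE \<omega> in W. AE d in mark_law. \<not> unfilled (config u (outside R \<omega>)) (case_nat k d)"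
        by eventually_elim (rule first)
      moreover have "Measurable.pred (hit_space \<Otimes>\<^sub>M mark_space) (\<lambda>p. \<not> unfilled (config u (fst p)) (case_nat k (snd p)))"
      proof -
        have "(\<lambda>p. ((u, fst p), case_nat k (snd p))) \<in> measurable (hit_space \<Otimes>\<^sub>M mark_space) (?S \<Otimes>\<^sub>M mark_space)"
          using measurable_compose[OF measurable_snd case_nat_measurable] by measurable
        from measurable_compose[OF this unf] show ?thesis by simp
      qed
      moreover have "(\<lambda>\<omega>. enum_points (outside R \<omega>) n) \<in> borel_measurable PS" for n
        by (rule measurable_compose[OF out_PS measurable_enum_points_component])
      moreover have "AE \<omega> in W. inj (\<lambda>n. enum_points (outside R \<omega>) n) \<and> range (\<lambda>n. enum_points (outside R \<omega>) n) \<subseteq> point_set (P \<omega>)"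
        using AE_infinite_points AE_space
      proof eventually_elim
        case (elim \<omega>)
        show ?case using outside_enum[OF elim(2,1) R] by (auto simp: bij_betw_def)
      qed
      ultimately show "AE \<omega> in W. \<not> unfilled (case_nat u (enum_points (outside R \<omega>)))
          (case_nat k (\<lambda>n. mark (\<xi> \<omega>) (enum_points (outside R \<omega>) n)))"
        using AE_marks_iff[OF out_PS, of "\<lambda>n \<omega>. enum_points (outside R \<omega>) n" "\<lambda>h d. \<not> unfilled (config u h) (case_nat k d)"]
        by (simp add: config_def)
    qed
  qed
qed

lemma AE_marks_support: "AE \<omega> in W. \<forall>x\<in>point_set (P \<omega>). mark (\<xi> \<omega>) x \<in> set_pmf \<mu>"
proof -
  have "AE \<omega> in W. point_mark \<omega> n \<in> set_pmf \<mu>" for n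
  proof -
    have "AE d in measure_pmf \<mu>. d \<in> set_pmf \<mu>" by (simp add: AE_measure_pmf_iff)
    then have "AE d in distr W (count_space UNIV) (\<lambda>\<omega>. point_mark \<omega> n). d \<in> set_pmf \<mu>" by (simp only: distr_point_mark_component)
    then show ?thesis by (rule AE_distrD[OF point_mark_component])
  qed
  then have "AE \<omega> in W. \<forall>n. point_mark \<omega> n \<in> set_pmf \<mu>" by (simp add: AE_all_countable)
  then show ?thesis
    using X_bij
  proof eventually_elim
    case (elim \<omega>)
    have "mark (\<xi> \<omega>) (X n \<omega>) \<in> set_pmf \<mu>" for n using elim(1) by (simp add: point_mark_def)
    moreover have "\<exists>n. x = X n \<omega>" if "x \<in> point_set (P \<omega>)" for x
      using elim(2) that by (auto simp: bij_betw_def)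
    ultimately show ?case by metis
  qed
qed

end


section \<open>Infinitely and finitely many desiring points\<close>

lemma AE_sets_superset:
  assumes "AE \<omega> in W. Q \<omega>"
  obtains \<Omega> where "\<Omega> \<in> sets W" "AE \<omega> in W. \<omega> \<in> \<Omega>" "\<And>\<omega>. \<omega> \<in> \<Omega> \<Longrightarrow> Q \<omega>" "\<Omega> \<subseteq> space W"
proof -
  obtain N where N: "{\<omega>\<in>space W. \<not> Q \<omega>} \<subseteq> N" "N \<in> null_sets W" using assms by (auto simp: eventually_ae_filter)
  show thesis
  proof
    show "space W - N \<in> sets W" using N by auto
    show "AE \<omega> in W. \<omega> \<in> space W - N" using AE_not_in[OF N(2)] AE_space by eventually_elim simp
  qed (use N in auto)
qed

lemma (in stable_graph) vertex_iff: "x \<in> V \<longleftrightarrow> (\<exists>y. L x y)"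
  using longest_edge_attained L_vertex by metis

lemma desired_points_eq:
  assumes "stable_graph (point_set m) D (linked E)"
  shows "infinite (desiring_points m E u) \<longleftrightarrow> infinitely_desired u E"
proof -
  interpret stable_graph "point_set m" D "linked E" by fact
  have "vertices E = point_set m" using vertex_iff by (auto simp: vertices_def)
  then have "desiring_points m E u = {x\<in>vertices E. \<exists>y. linked E x y \<and> \<bar>x - u\<bar> < \<bar>x - y\<bar>}"
    using less_longest_edge_iff
    by (auto simp: desiring_points_def desires_def longest_edge_def abs_minus_commute[of u])
  then show ?thesis by (simp add: infinitely_desired_def)
qed

text \<open>If only finitely many points desire \<open>u\<close> and all components are finite, then the components of the
  desiring points form a finite set, which some \<open>rat_union l\<close> containing \<open>u\<close> cuts out. Removing it and
  inserting a point at \<open>u\<close> produces an unfilled configuration.\<close>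

lemma infinitely_desired_of_filled:
  assumes "stable_graph (point_set m) D (linked E)" and "infinite (point_set m)"
    and "u \<notin> point_set m" and "1 \<le> k"
    and no_inf: "\<not> has_infinite_component m E"
    and gaps: "\<And>s (r::nat) (K::nat). s \<in> {1, -1} \<Longrightarrow> \<exists>t. real K < s * t \<and> point_set m \<inter> {t..t + real r} = {}"
    and enum: "\<And>l. bij_betw (Z l) UNIV (point_set m - rat_union l)"
    and filled: "\<And>l. u \<in> rat_union l \<Longrightarrow> \<not> unfilled (case_nat u (Z l)) (case_nat k (\<lambda>n. D (Z l n)))"
  shows "infinitely_desired u E"
proof (rule ccontr)
  interpret stable_graph "point_set m" D "linked E" by fact
  have V: "vertices E = point_set m" using vertex_iff by (auto simp: vertices_def)
  have comp: "comp x = component E x" for x by (simp add: comp_def component_def)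
  define Des where "Des = {x\<in>vertices E. \<exists>y. linked E x y \<and> \<bar>x - u\<bar> < \<bar>x - y\<bar>}"
  assume "\<not> infinitely_desired u E"
  then have "finite Des" by (simp add: infinitely_desired_def Des_def)
  define A where "A = (\<Union>x\<in>Des. component E x)"
  have "finite A"
    unfolding A_def using \<open>finite Des\<close> no_inf V by (intro finite_UN_I) (auto simp: Des_def has_infinite_component_def)
  have AV: "A \<subseteq> point_set m"
    unfolding A_def using comp_subset_V V by (auto simp: comp[symmetric] Des_def)
  have DesA: "Des \<subseteq> A" by (auto simp: A_def component_def)
  have closed: "y \<in> A" if "x \<in> A" "linked E x y" for x y
    using that by (auto simp: A_def component_def intro: rtranclp.rtrancl_into_rtrancl)
  obtain l where l: "insert u A \<subseteq> rat_union l" "point_set m \<inter> rat_union l \<subseteq> insert u A"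
    using isolating_rat_union[of "point_set m" "insert u A"] finite_window \<open>finite A\<close> by auto
  then have "point_set m - rat_union l = point_set m - A" using AV \<open>u \<notin> point_set m\<close> by blast
  then have bij: "bij_betw (Z l) UNIV (point_set m - A)" using enum[of l] by simp
  have "unfilled (case_nat u (Z l)) (case_nat k (\<lambda>n. D (Z l n)))"
  proof (rule unfilled_insert[OF \<open>u \<notin> point_set m\<close> \<open>finite A\<close> closed _ bij \<open>1 \<le> k\<close> gaps])
    show "\<bar>x - z\<bar> \<le> \<bar>x - u\<bar>" if "x \<in> point_set m - A" "linked E x z" for x z
    proof (rule ccontr)
      assume "\<not> \<bar>x - z\<bar> \<le> \<bar>x - u\<bar>"
      then have "x \<in> Des" using that V unfolding Des_def by (auto simp: not_le)
      then show False using that(1) DesA by blast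
    qed
  qed
  then show False using filled l by simp
qed

text \<open>Without leaves in infinite components, all their points have degree \<open>2\<close>, as required for paths
  without an end.\<close>

lemma finitely_desired_of_dense:
  assumes "stable_graph (point_set m) D (linked E)"
    and D: "\<And>x. x \<in> point_set m \<Longrightarrow> D x \<in> {1, 2}"
    and no_leaf: "\<And>x. x \<in> vertices E \<Longrightarrow> is_leaf E x \<Longrightarrow> finite (component E x)"
    and inf: "has_infinite_component m E"
    and dense: "\<And>s::int. s \<in> {1, -1} \<Longrightarrow> \<exists>t0>0. \<forall>t\<ge>t0::real. \<exists>S\<subseteq>{x\<in>vertices E. infinite (component E x)}.
      card S = 3 \<and> (\<forall>c\<in>S. t < of_int s * c \<and> of_int s * c < 2 * t)"
  shows "\<not> infinitely_desired 0 E"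
proof -
  interpret G: stable_graph "point_set m" D "linked E" by fact
  have V: "vertices E = point_set m" using G.vertex_iff by (auto simp: vertices_def)
  have comp: "G.comp x = component E x" for x by (simp add: G.comp_def component_def)
  interpret path_graph "point_set m" D "linked E" "{x\<in>point_set m. infinite (G.comp x)}"
  proof unfold_locales
    show "D x \<le> 2" if "x \<in> point_set m" for x using D[OF that] by auto
    show "D x = 2" if "x \<in> {x\<in>point_set m. infinite (G.comp x)}" for x
    proof (rule ccontr)
      assume "D x \<noteq> 2"
      moreover have x: "x \<in> point_set m" "infinite (component E x)" using that by (auto simp: comp)
      ultimately have "card {y. linked E x y} \<le> 1" using D[of x] G.card_nbrs[of x] by auto
      then have "is_leaf E x"
        unfolding is_leaf_def using card_le_one_iff_unique[OF G.finite_nbrs[OF x(1)]] by blast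
      then show False using no_leaf x V by blast
    qed
  qed
  have "finite {x\<in>point_set m. \<exists>z. linked E x z \<and> \<bar>x\<bar> < \<bar>x - z\<bar>}"
  proof (rule finite_desire)
    show "{x\<in>point_set m. infinite (G.comp x)} \<noteq> {}"
      using inf by (auto simp: has_infinite_component_def comp)
    show "\<exists>t0>0. \<forall>t\<ge>t0. \<exists>S\<subseteq>{x\<in>point_set m. infinite (G.comp x)}. card S = 3 \<and> (\<forall>c\<in>S. t < s * c \<and> s * c < 2 * t)"
      if "s \<in> {1, -1}" for s :: real
      using dense[of 1] dense[of "-1"] that unfolding V comp by auto
  qed
  then show ?thesis by (simp add: infinitely_desired_def V)
qed

theorem theorem1p3:
  fixes W :: "'w measure" and \<mu> :: "nat pmf"
    and P \<xi> :: "'w \<Rightarrow> real measure" and E :: "'w \<Rightarrow> (real \<times> real) measure"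
  assumes "prob_space W"
    and "poisson_process W 1 P"
    and "set_pmf \<mu> \<subseteq> {1..}"
    and "iid_marking W \<mu> P \<xi>"
    and "stable_multi_matching W P \<xi> E"
  shows "((AE \<omega> in W. \<not> has_infinite_component (P \<omega>) (E \<omega>)) \<longrightarrow>
            (AE \<omega> in W. infinite (desiring_points (P \<omega>) (E \<omega>) 0))) \<and>
         (measure (measure_pmf \<mu>) {1, 2} = 1 \<and>
          (AE \<omega> in W. has_infinite_component (P \<omega>) (E \<omega>)) \<longrightarrow>
            (AE \<omega> in W. finite (desiring_points (P \<omega>) (E \<omega>) 0)))"
proof -
  define PS where "PS = vimage_algebra (space W) P (counting_algebra borel)"
  have "\<exists>X::nat \<Rightarrow> 'w \<Rightarrow> real.
        (\<forall>n. X n \<in> borel_measurable PS) \<and>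
        (AE \<omega> in W. bij_betw (\<lambda>n. X n \<omega>) UNIV (point_set (P \<omega>))) \<and>
        prob_space.indep_vars W (\<lambda>_. borel) (\<lambda>n \<omega>. emeasure (\<xi> \<omega>) {X n \<omega>}) UNIV \<and>
        (\<forall>n. distr W borel (\<lambda>\<omega>. emeasure (\<xi> \<omega>) {X n \<omega>}) = distr (measure_pmf \<mu>) borel of_nat) \<and>
        prob_space.indep_set W (sets PS)
          (sets (vimage_algebra (space W) (\<lambda>\<omega> n. emeasure (\<xi> \<omega>) {X n \<omega>}) (Pi\<^sub>M UNIV (\<lambda>_. borel))))"
    (is "\<exists>X. ?Q X")
    using assms(4) unfolding iid_marking_def PS_def by (elim conjE)
  then obtain X where "?Q X" ..
  note X1 = this[THEN conjunct1] and X = this[THEN conjunct2]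
  note X2 = X[THEN conjunct1] and X3 = X[THEN conjunct2, THEN conjunct1]
    and X4 = X[THEN conjunct2, THEN conjunct2, THEN conjunct1]
    and X5 = X[THEN conjunct2, THEN conjunct2, THEN conjunct2]
  interpret marked_poisson W P \<mu> \<xi> X PS
    by (intro marked_poisson.intro poisson_line.intro poisson_line_axioms.intro marked_poisson_axioms.intro)
      (rule assms(1,2) X1[rule_format, unfolded PS_def] X2 X3 X4[rule_format] X5[unfolded PS_def] PS_def[THEN eq_reflection])+
  have \<xi>: "\<xi> \<in> measurable W (counting_algebra borel)"
    using assms(4) by (simp add: iid_marking_def point_process_def)
  have scheme: "matching_scheme W P \<xi> E" using assms(5) by (simp add: stable_multi_matching_def)
  then have E: "E \<in> measurable W (counting_algebra upair_borel)"
    by (simp add: matching_scheme_def point_process_def)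
  have good: "AE \<omega> in W. stable_graph (point_set (P \<omega>)) (mark (\<xi> \<omega>)) (linked (E \<omega>)) \<and> locally_finite_graph (E \<omega>) \<and>
      (\<forall>x\<in>point_set (P \<omega>). mark (\<xi> \<omega>) x \<in> set_pmf \<mu>)"
  proof -
    have "AE \<omega> in W. \<forall>(x, y)\<in>point_set (E \<omega>). x \<in> point_set (P \<omega>) \<and> y \<in> point_set (P \<omega>)"
      "AE \<omega> in W. \<forall>x\<in>point_set (P \<omega>). degree_at (E \<omega>) x = emeasure (\<xi> \<omega>) {x}"
      "AE \<omega> in W. simple_edges (E \<omega>)"
      using scheme by (simp_all add: matching_scheme_def)
    moreover have "AE \<omega> in W. \<forall>x\<in>point_set (P \<omega>). \<forall>y\<in>point_set (P \<omega>). x \<noteq> y \<longrightarrow>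
        linked (E \<omega>) x y \<or>
        (\<forall>z. linked (E \<omega>) x z \<longrightarrow> \<bar>x - z\<bar> \<le> \<bar>x - y\<bar>) \<or>
        (\<forall>z. linked (E \<omega>) y z \<longrightarrow> \<bar>y - z\<bar> \<le> \<bar>x - y\<bar>)"
      using assms(5) by (simp add: stable_multi_matching_def)
    ultimately show ?thesis
      using AE_marks_support AE_space
    proof eventually_elim
      case (elim \<omega>)
      have lfP: "locally_finite_counting borel (P \<omega>)"
        using measurable_space[OF P_measurable elim(6)] by (simp add: space_counting_algebra)
      have lf\<xi>: "locally_finite_counting borel (\<xi> \<omega>)"
        using measurable_space[OF \<xi> elim(6)] by (simp add: space_counting_algebra)
      have lfE: "locally_finite_counting upair_borel (E \<omega>)"
        using measurable_space[OF E elim(6)] by (simp add: space_counting_algebra)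
      have "\<forall>x\<in>point_set (P \<omega>). 1 \<le> mark (\<xi> \<omega>) x" using elim(5) assms(3) by auto
      from stable_graphI[OF lfP lf\<xi> lfE elim(3,1,2) this elim(4)]
      have st: "stable_graph (point_set (P \<omega>)) (mark (\<xi> \<omega>)) (linked (E \<omega>))" .
      then interpret stable_graph "point_set (P \<omega>)" "mark (\<xi> \<omega>)" "linked (E \<omega>)" .
      have "vertices (E \<omega>) = point_set (P \<omega>)" using vertex_iff by (auto simp: vertices_def)
      then have "locally_finite_graph (E \<omega>)" using lfE finite_window by (simp add: locally_finite_graph_def)
      then show ?case using st elim(5) by blast
    qed
  qed
  obtain \<Omega> where \<Omega>: "\<Omega> \<in> sets W" "AE \<omega> in W. \<omega> \<in> \<Omega>" "\<Omega> \<subseteq> space W"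
    and \<Omega>_good: "\<And>\<omega>. \<omega> \<in> \<Omega> \<Longrightarrow> stable_graph (point_set (P \<omega>)) (mark (\<xi> \<omega>)) (linked (E \<omega>)) \<and> locally_finite_graph (E \<omega>) \<and>
      (\<forall>x\<in>point_set (P \<omega>). mark (\<xi> \<omega>) x \<in> set_pmf \<mu>)"
    using AE_sets_superset[OF good] by metis
  interpret S: stationary_graph W E \<Omega>
  proof unfold_locales
    show "distr W (counting_algebra upair_borel) (\<lambda>\<omega>. translate_pairs t (E \<omega>)) = distr W (counting_algebra upair_borel) E" for t
      using scheme unfolding matching_scheme_def by blast
  qed (use E \<Omega> \<Omega>_good in auto)
  have vertices_eq: "vertices (E \<omega>) = point_set (P \<omega>)" if "\<omega> \<in> \<Omega>" for \<omega>
  proof -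
    interpret stable_graph "point_set (P \<omega>)" "mark (\<xi> \<omega>)" "linked (E \<omega>)" using \<Omega>_good[OF that] by simp
    show ?thesis using vertex_iff by (auto simp: vertices_def)
  qed
  have desire: "infinite (desiring_points (P \<omega>) (E \<omega>) u) \<longleftrightarrow> infinitely_desired u (E \<omega>)" if "\<omega> \<in> \<Omega>" for \<omega> u
    using desired_points_eq \<Omega>_good[OF that] by blast
  have part1: "AE \<omega> in W. infinite (desiring_points (P \<omega>) (E \<omega>) 0)"
    if no_inf: "AE \<omega> in W. \<not> has_infinite_component (P \<omega>) (E \<omega>)"
  proof -
    let ?Z = "\<lambda>\<omega> l. enum_points (outside (rat_union l) \<omega>)"
    have "AE \<omega> in W. \<forall>y. bij_betw y UNIV (point_set (P \<omega>)) \<longrightarrow> \<not> unfilled y (\<lambda>n. mark (\<xi> \<omega>) (y n))"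
      using \<Omega>(2) AE_no_ties
    proof eventually_elim
      case (elim \<omega>)
      interpret stable_graph "point_set (P \<omega>)" "mark (\<xi> \<omega>)" "linked (E \<omega>)" using \<Omega>_good[OF elim(1)] by simp
      have "w = z" if "x \<in> point_set (P \<omega>)" "w \<in> point_set (P \<omega>)" "z \<in> point_set (P \<omega>)"
        "w \<noteq> x" "z \<noteq> x" "\<bar>x - w\<bar> = \<bar>x - z\<bar>" for x w z
        using elim(2)[rule_format, OF that] .
      then show ?case by (intro allI impI not_unfilled)
    qed
    note ins = AE_not_unfilled_insert[OF this rat_union_borel bounded_rat_union]
    have all: "AE u in lborel. \<forall>l. u \<in> rat_union l \<longrightarrow> (\<forall>k\<in>set_pmf \<mu>. AE \<omega> in W.
      \<not> unfilled (case_nat u (?Z \<omega> l)) (case_nat k (\<lambda>n. mark (\<xi> \<omega>) (?Z \<omega> l n))))"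
      unfolding AE_all_countable by (intro allI ins)
    have "ae_filter (lborel :: real measure) \<noteq> bot" by (simp add: ae_filter_eq_bot_iff)
    \<comment> \<open>One site \<open>u\<close> that admits insertion for all regions \<open>rat_union l\<close> at once; it need not be the origin.\<close>
    from eventually_happens'[OF this all] obtain u where u: "\<forall>l. u \<in> rat_union l \<longrightarrow> (\<forall>k\<in>set_pmf \<mu>. AE \<omega> in W.
      \<not> unfilled (case_nat u (?Z \<omega> l)) (case_nat k (\<lambda>n. mark (\<xi> \<omega>) (?Z \<omega> l n))))" ..
    obtain k where k: "k \<in> set_pmf \<mu>" using set_pmf_not_empty[of \<mu>] by blast
    have "1 \<le> k" using k assms(3) by auto
    have "AE \<omega> in W. u \<in> rat_union l \<longrightarrow> \<not> unfilled (case_nat u (?Z \<omega> l)) (case_nat k (\<lambda>n. mark (\<xi> \<omega>) (?Z \<omega> l n)))" for l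
      using u[rule_format, OF _ k, of l] by (cases "u \<in> rat_union l") auto
    then have filled: "AE \<omega> in W. \<forall>l. u \<in> rat_union l \<longrightarrow> \<not> unfilled (case_nat u (?Z \<omega> l)) (case_nat k (\<lambda>n. mark (\<xi> \<omega>) (?Z \<omega> l n)))"
      by (simp add: AE_all_countable)
    have "AE \<omega> in W. infinitely_desired u (E \<omega>)"
      using filled \<Omega>(2) no_inf AE_gaps AE_not_point[of u] AE_infinite_points
    proof eventually_elim
      case (elim \<omega>)
      have \<omega>: "\<omega> \<in> space W" using elim(2) \<Omega>(3) by auto
      show ?case
      proof (rule infinitely_desired_of_filled)
        show "stable_graph (point_set (P \<omega>)) (mark (\<xi> \<omega>)) (linked (E \<omega>))" using \<Omega>_good[OF elim(2)] by simp
        show "bij_betw (?Z \<omega> l) UNIV (point_set (P \<omega>) - rat_union l)" for l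
          by (rule outside_enum[OF \<omega> elim(6) rat_union_borel bounded_rat_union])
      qed (use elim \<open>1 \<le> k\<close> in auto)
    qed
    then have "AE \<omega> in W. infinitely_desired 0 (E \<omega>)" by (rule S.AE_infinitely_desired)
    then show ?thesis using \<Omega>(2) by eventually_elim (simp add: desire)
  qed
  have part2: "AE \<omega> in W. finite (desiring_points (P \<omega>) (E \<omega>) 0)"
    if \<mu>: "measure (measure_pmf \<mu>) {1, 2} = 1" and inf: "AE \<omega> in W. has_infinite_component (P \<omega>) (E \<omega>)"
  proof -
    have "AE d in measure_pmf \<mu>. d \<in> {1, 2}" using \<mu> by (subst (asm) measure_pmf.prob_eq_1) auto
    then have \<mu>12: "set_pmf \<mu> \<subseteq> {1, 2}" by (auto simp: AE_measure_pmf_iff)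
    have D12: "mark (\<xi> \<omega>) x \<in> {1, 2}" if "\<omega> \<in> \<Omega>" "x \<in> point_set (P \<omega>)" for \<omega> x
      using \<Omega>_good[OF that(1)] that(2) \<mu>12 by blast
    have no_leaf: "AE \<omega> in W. \<forall>x\<in>vertices (E \<omega>). is_leaf (E \<omega>) x \<longrightarrow> finite (component (E \<omega>) x)"
    proof (rule S.AE_no_infinite_leaf)
      fix \<omega> x y assume \<omega>: "\<omega> \<in> \<Omega>" and xy: "is_leaf (E \<omega>) x" "is_leaf (E \<omega>) y" "(linked (E \<omega>))\<^sup>*\<^sup>* x y"
        "infinite (component (E \<omega>) x)"
      interpret stable_graph "point_set (P \<omega>)" "mark (\<xi> \<omega>)" "linked (E \<omega>)" using \<Omega>_good[OF \<omega>] by simp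
      show "x = y"
      proof (rule unique_leaf)
        show "mark (\<xi> \<omega>) x \<le> 2" if "x \<in> point_set (P \<omega>)" for x using D12[OF \<omega> that] by auto
        show "linked (E \<omega>) x z \<Longrightarrow> linked (E \<omega>) x w \<Longrightarrow> z = w" for z w
          using xy(1) linked_vertices(2) unfolding is_leaf_def by blast
        show "linked (E \<omega>) y z \<Longrightarrow> linked (E \<omega>) y w \<Longrightarrow> z = w" for z w
          using xy(2) linked_vertices(2) unfolding is_leaf_def by blast
        show "infinite (comp x)" using xy(4) by (simp add: comp_def component_def)
      qed (rule xy(3))
    next
      fix \<omega> assume \<omega>: "\<omega> \<in> \<Omega>"
      then show "of_nat (card (vertices (E \<omega>) \<inter> block 0)) \<le> emeasure (P \<omega>) (block 0)"
        using counting_measure.card_points_le[OF P_counting, of \<omega> "block 0"] \<Omega>(3) vertices_eq[OF \<omega>]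
        by (auto simp: Int_commute)
    next
      show "(\<integral>\<^sup>+\<omega>. emeasure (P \<omega>) (block 0) \<partial>W) < \<infinity>" by (rule finite_mean_count)
    qed
    have ex: "AE \<omega> in W. \<exists>x\<in>vertices (E \<omega>). infinite (component (E \<omega>) x)"
      using inf \<Omega>(2) by eventually_elim (simp add: has_infinite_component_def vertices_eq)
    have "AE \<omega> in W. \<not> infinitely_desired 0 (E \<omega>)"
      using no_leaf inf \<Omega>(2) S.AE_three_points[OF _ ex, of 1, simplified] S.AE_three_points[OF _ ex, of "-1", simplified]
    proof eventually_elim
      case (elim \<omega>)
      show ?case
      proof (rule finitely_desired_of_dense)
        show "stable_graph (point_set (P \<omega>)) (mark (\<xi> \<omega>)) (linked (E \<omega>))" using \<Omega>_good[OF elim(3)] by simp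
        show "mark (\<xi> \<omega>) x \<in> {1, 2}" if "x \<in> point_set (P \<omega>)" for x by (rule D12[OF elim(3) that])
        show "\<exists>t0>0. \<forall>t\<ge>t0::real. \<exists>S\<subseteq>{x\<in>vertices (E \<omega>). infinite (component (E \<omega>) x)}.
          card S = 3 \<and> (\<forall>c\<in>S. t < of_int s * c \<and> of_int s * c < 2 * t)" if "s \<in> {1, -1}" for s :: int
          using that elim(4,5) by auto
      qed (use elim in auto)
    qed
    then show ?thesis using \<Omega>(2) by eventually_elim (use desire in blast)
  qed
  show ?thesis using part1 part2 by blast
qed

end
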